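(* Let $n\in\mathbb{N}$, let $K$ be a field of characteristic $0$, let $W$ be the $n$-th Weyl algebra over $K$, and let $M$ be a finitely generated left $W$-module. For every $\nu\in\mathbb{N}_0^{2n}$ there exists $s_\nu\in\mathbb{N}_0$ such that for all $\omega\in\Omega$ and all $s\in\mathbb{N}$ with $s>s_\nu$ one has $$\sqrt{(0:\mathrm{G}^{\nu}\mathrm{G}^{\omega}M)}=\sqrt{(0:\mathrm{G}^{\nu}\mathrm{G}^{\nu+s\omega}M)}=\sqrt{(0:\mathrm{G}^{\nu+s\omega}M)}$$ as ideals of $K[X,Y]$. (In particular $s_\nu$ does not depend on $\omega$.)
   Context: $\mathbb{N}=\{1,2,\dots\}$, $\mathbb{N}_0=\mathbb{N}\cup\{0\}$. $K[X,Y]=K[X_1,\dots,X_n,Y_1,\dots,Y_n]$. The $n$-th Weyl algebra $W$ is the $K$-subalgebra of $\mathrm{End}_K(K[X_1,\dots,X_n])$ generated by $\xi_i$ (multiplication by $X_i$) and $\partial_i=\partial/\partial X_i$, $1\le i\le n$. It has $K$-basis $\{\xi^\lambda\partial^\mu\mid\lambda,\mu\in\mathbb{N}_0^n\}$; for $w=\sum c_{\lambda\mu}\xi^\lambda\partial^\mu$ put $\mathrm{supp}(w)=\{(\lambda,\mu)\mid c_{\lambda\mu}\neq0\}$. Let $(\lambda|\mu)\in\mathbb{N}_0^{2n}$ denote concatenation and $\cdot$ the standard scalar product. For $\omega\in\mathbb{N}_0^{2n}$, $\deg^\omega(w)=\sup\{\omega\cdot(\lambda|\mu)\mid(\lambda,\mu)\in\mathrm{supp}(w)\}$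 (so $\deg^\omega(0)=-\infty$). $\Omega=\{\omega\in\mathbb{N}_0^{2n}\mid\omega_i+\omega_{n+i}>0\text{ for }1\le i\le n\}$. For $\omega\in\Omega$, $W$ is filtered by $\mathrm{F}^\omega_iW=\{w\in W\mid\deg^\omega(w)\le i\}$, $i\in\mathbb{Z}$. The associated graded ring $\mathrm{G}^\omega W=\bigoplus_{i}\mathrm{F}^\omega_iW/\mathrm{F}^\omega_{i-1}W$ is commutative and is identified with $K[X,Y]$ by letting $X_i,Y_i$ correspond to the classes (symbols) of $\xi_i,\partial_i$ in degrees $\omega_i,\omega_{n+i}$. Similarly, for any $\nu\in\mathbb{N}_0^{2n}$, $K[X,Y]$ is filtered by $\nu$-degree (where $X^\lambda Y^\mu$ has $\nu$-degree $\nu\cdot(\lambda|\mu)$), and its associated graded ring is identified with $K[X,Y]$. Given a filtered ring $R$ with filtration $(\mathrm{F}_iR)_{i\in\mathbb{Z}}$, an $R$-filtration of a left $R$-module $M$ is an increasing family of additive subgroups $\mathrm{F}_iM$ ($i\in\mathbb{Z}$) with union $M$ and $\mathrm{F}_iR\,\mathrm{F}_jM\subseteq\mathrm{F}_{i+j}M$; it is good if there are finitely many $m_1,\dots,m_t\in M$ and $p_1,\dots,p_t\in\mathbb{Z}$ with $\mathrm{F}_iM=\sum_j\mathrm{F}_{i-p_j}R\,m_j$ for all $i$. For a finitely generated left $W$-module $M$ and $\omega\in\Omega$, $\mathrm{G}^\omega M=\bigoplus_i\mathrm{F}_iM/\mathrm{F}_{i-1}M$ denotes the associated graded $K[X,Y]$-module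 with respect to some good filtration of $M$ over $W$ with the $\omega$-filtration; it is finitely generated. For a finitely generated $K[X,Y]$-module $N$ and $\nu\in\mathbb{N}_0^{2n}$, $\mathrm{G}^\nu N$ is likewise the associated graded $K[X,Y]$-module with respect to some good filtration over $K[X,Y]$ with the $\nu$-filtration. $(0:N)$ is the annihilator of $N$ in $K[X,Y]$. The radicals of the annihilators of these graded modules do not depend on the chosen good filtrations. *)

theory Defs
  imports
    "HOL-Algebra.Product_Groups"
    "HOL-Algebra.Module"
    "HOL-Algebra.QuotRing"
    "HOL-Library.Poly_Mapping"
    "HOL-Library.Extended_Real"
begin

section \<open>Modules, annihilators, radicals\<close>

text \<open>The locale \<^locale>\<open>module\<close> of \<^theory>\<open>HOL-Algebra.Module\<close> without
  commutativity of the ring. As there, the fields \<open>mult\<close> and \<open>one\<close> of \<open>M\<close> are irrelevant.\<close>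

locale left_module = R?: ring R + M?: abelian_group M
  for R (structure) and M (structure) +
  assumes smult_closed [simp, intro]:
      "\<lbrakk>a \<in> carrier R; x \<in> carrier M\<rbrakk> \<Longrightarrow> a \<odot>\<^bsub>M\<^esub> x \<in> carrier M"
    and smult_l_distr:
      "\<lbrakk>a \<in> carrier R; b \<in> carrier R; x \<in> carrier M\<rbrakk> \<Longrightarrow>
        (a \<oplus> b) \<odot>\<^bsub>M\<^esub> x = a \<odot>\<^bsub>M\<^esub> x \<oplus>\<^bsub>M\<^esub> b \<odot>\<^bsub>M\<^esub> x"
    and smult_r_distr:
      "\<lbrakk>a \<in> carrier R; x \<in> carrier M; y \<in> carrier M\<rbrakk> \<Longrightarrow>
        a \<odot>\<^bsub>M\<^esub> (x \<oplus>\<^bsub>M\<^esub> y) = a \<odot>\<^bsub>M\<^esub> x \<oplus>\<^bsub>M\<^esub> a \<odot>\<^bsub>M\<^esub> y"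
    and smult_assoc1:
      "\<lbrakk>a \<in> carrier R; b \<in> carrier R; x \<in> carrier M\<rbrakk> \<Longrightarrow>
        (a \<otimes> b) \<odot>\<^bsub>M\<^esub> x = a \<odot>\<^bsub>M\<^esub> (b \<odot>\<^bsub>M\<^esub> x)"
    and smult_one [simp]:
      "x \<in> carrier M \<Longrightarrow> \<one> \<odot>\<^bsub>M\<^esub> x = x"

definition finitely_generated :: "('r, 'x) ring_scheme \<Rightarrow> ('r, 'm, 'y) module_scheme \<Rightarrow> bool" where
  "finitely_generated R M \<longleftrightarrow>
    (\<exists>G. finite G \<and> G \<subseteq> carrier M \<and>
      carrier M = {(\<Oplus>\<^bsub>M\<^esub>g\<in>G. r g \<odot>\<^bsub>M\<^esub> g) | r. r \<in> G \<rightarrow> carrier R})"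

definition annihilator :: "('r, 'x) ring_scheme \<Rightarrow> ('r, 'm, 'y) module_scheme \<Rightarrow> 'r set" where
  "annihilator R M = {r \<in> carrier R. \<forall>m\<in>carrier M. r \<odot>\<^bsub>M\<^esub> m = \<zero>\<^bsub>M\<^esub>}"

definition radical :: "('r, 'x) ring_scheme \<Rightarrow> 'r set \<Rightarrow> 'r set" where
  "radical R I = {r \<in> carrier R. \<exists>k::nat. k > 0 \<and> r [^]\<^bsub>R\<^esub> k \<in> I}"

definition restrict_scalars ::
    "('s \<Rightarrow> 'r) \<Rightarrow> ('r, 'm, 'y) module_scheme \<Rightarrow> ('s, 'm) module" where
  "restrict_scalars \<phi> M =
    \<lparr>carrier = carrier M, monoid.mult = monoid.mult M, one = one M, zero = zero M, add = add M,
     smult = (\<lambda>s x. \<phi> s \<odot>\<^bsub>M\<^esub> x)\<rparr>"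


section \<open>Filtrations and associated graded objects\<close>

definition module_filtration ::
    "('r, 'x) ring_scheme \<Rightarrow> (int \<Rightarrow> 'r set) \<Rightarrow> ('r, 'm, 'y) module_scheme \<Rightarrow> (int \<Rightarrow> 'm set) \<Rightarrow> bool"
  where
  "module_filtration R FR M FM \<longleftrightarrow>
    (\<forall>i. additive_subgroup (FM i) M) \<and>
    (\<forall>i j. i \<le> j \<longrightarrow> FM i \<subseteq> FM j) \<and>
    (\<Union>i. FM i) = carrier M \<and>
    (\<forall>i j. \<forall>r\<in>FR i. \<forall>m\<in>FM j. r \<odot>\<^bsub>M\<^esub> m \<in> FM (i + j))"

definition good_filtration ::
    "('r, 'x) ring_scheme \<Rightarrow> (int \<Rightarrow> 'r set) \<Rightarrow> ('r, 'm, 'y) module_scheme \<Rightarrow> (int \<Rightarrow> 'm set) \<Rightarrow> bool"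
  where
  "good_filtration R FR M FM \<longleftrightarrow>
    module_filtration R FR M FM \<and>
    (\<exists>(t::nat) (m :: nat \<Rightarrow> 'm) (p :: nat \<Rightarrow> int).
      (\<forall>j<t. m j \<in> carrier M) \<and>
      (\<forall>i. FM i = {(\<Oplus>\<^bsub>M\<^esub>j\<in>{..<t}. r j \<odot>\<^bsub>M\<^esub> m j) | r. \<forall>j<t. r j \<in> FR (i - p j)}))"

text \<open>The additive group \<open>F\<^sub>i M / F\<^bsub>i-1\<^esub> M\<close>, written multiplicatively
  as always with \<^const>\<open>A_FactGroup\<close>. It applies to rings as well as to modules.\<close>

definition gr_piece :: "('a, 'x) ring_scheme \<Rightarrow> (int \<Rightarrow> 'a set) \<Rightarrow> int \<Rightarrow> 'a set monoid" where
  "gr_piece M FM i = (M\<lparr>carrier := FM i\<rparr>) A_Mod (FM (i - 1))"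

text \<open>The product of a class in \<open>F\<^sub>i R / F\<^bsub>i-1\<^esub> R\<close> and a class in
  \<open>F\<^sub>j M / F\<^bsub>j-1\<^esub> M\<close>, where \<open>H\<close> is \<open>F\<^bsub>i+j-1\<^esub> M\<close>; compare \<^const>\<open>rcoset_mult\<close>.\<close>

definition coset_smult :: "('r, 'm, 'y) module_scheme \<Rightarrow> 'm set \<Rightarrow> 'r set \<Rightarrow> 'm set \<Rightarrow> 'm set" where
  "coset_smult M H A X = (\<Union>r\<in>A. \<Union>m\<in>X. H +>\<^bsub>M\<^esub> (r \<odot>\<^bsub>M\<^esub> m))"

text \<open>The associated graded module \<open>\<Oplus>\<^sub>i F\<^sub>i M / F\<^bsub>i-1\<^esub> M\<close> over the associated
  graded ring \<open>\<Oplus>\<^sub>i F\<^sub>i R / F\<^bsub>i-1\<^esub> R\<close>. The product of \<open>a\<close> and \<open>x\<close> has the component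
  \<open>\<Sum>\<^sub>i a\<^sub>i x\<^bsub>k-i\<^esub>\<close> in degree \<open>k\<close>, the sum being over the support of \<open>a\<close>. It is written
  as a product because of the multiplicative notation for quotient groups.\<close>

definition gr_module ::
    "('r, 'x) ring_scheme \<Rightarrow> (int \<Rightarrow> 'r set) \<Rightarrow> ('r, 'm, 'y) module_scheme \<Rightarrow> (int \<Rightarrow> 'm set)
      \<Rightarrow> (int \<Rightarrow> 'r set, int \<Rightarrow> 'm set) module" where
  "gr_module R FR M FM =
    \<lparr>carrier = carrier (sum_group UNIV (gr_piece M FM)),
     monoid.mult = undefined,
     one = undefined,
     zero = \<one>\<^bsub>sum_group UNIV (gr_piece M FM)\<^esub>,
     add = (\<lambda>x y. x \<otimes>\<^bsub>sum_group UNIV (gr_piece M FM)\<^esub> y),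
     smult = (\<lambda>a x k.
       (\<Otimes>\<^bsub>gr_piece M FM k\<^esub>i\<in>{i. a i \<noteq> \<one>\<^bsub>gr_piece R FR i\<^esub>}.
          coset_smult M (FM (k - 1)) (a i) (x (k - i))))\<rparr>"


section \<open>Polynomials and the Weyl algebra\<close>

text \<open>The number \<open>n\<close> of variables is the cardinality of the index type \<open>'n\<close>. The index
  \<open>Inl i\<close> belongs to \<open>X\<^sub>i\<close> and \<open>Inr i\<close> to \<open>Y\<^sub>i\<close>, so that a pair of exponents
  \<open>(\<lambda>|\<mu>)\<close> and a weight \<open>\<omega>\<close> are indexed by \<open>'n + 'n\<close>.\<close>

type_synonym ('n, 'k) polyX = "('n \<Rightarrow>\<^sub>0 nat) \<Rightarrow>\<^sub>0 'k"
type_synonym ('n, 'k) polyXY = "(('n + 'n) \<Rightarrow>\<^sub>0 nat) \<Rightarrow>\<^sub>0 'k"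
type_synonym ('n, 'k) diffop = "('n, 'k) polyX \<Rightarrow> ('n, 'k) polyX"
type_synonym 'n weight = "'n + 'n \<Rightarrow> nat"

definition polyXY_ring :: "('n::finite, 'k::field_char_0) polyXY ring" where
  "polyXY_ring = \<lparr>carrier = UNIV, monoid.mult = (*), one = 1, zero = 0, add = (+)\<rparr>"

lemma cring_polyXY_ring: "cring polyXY_ring"
proof -
  have "\<exists>y. x + y = 0" for x :: "('n::finite, 'k::field_char_0) polyXY"
    by (rule exI [of _ "- x"]) simp
  then show ?thesis
    by (intro cringI abelian_groupI comm_monoidI)
       (auto simp: polyXY_ring_def algebra_simps)
qed

definition scalar :: "'k \<Rightarrow> ('n::finite, 'k::field_char_0) diffop" where
  "scalar c f = Poly_Mapping.single 0 c * f"

definition xi :: "'n \<Rightarrow> ('n::finite, 'k::field_char_0) diffop" where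
  "xi i f = Poly_Mapping.single (Poly_Mapping.single i 1) 1 * f"

definition pd :: "'n \<Rightarrow> ('n::finite, 'k::field_char_0) diffop" where
  "pd i f = (\<Sum>\<alpha>\<in>Poly_Mapping.keys f.
     Poly_Mapping.single (\<alpha> - Poly_Mapping.single i 1)
       (of_nat (Poly_Mapping.lookup \<alpha> i) * Poly_Mapping.lookup f \<alpha>))"

inductive_set weyl_ops :: "('n::finite, 'k::field_char_0) diffop set" where
  scalar: "scalar c \<in> weyl_ops"
| xi: "xi i \<in> weyl_ops"
| pd: "pd i \<in> weyl_ops"
| add: "u \<in> weyl_ops \<Longrightarrow> v \<in> weyl_ops \<Longrightarrow> (\<lambda>f. u f + v f) \<in> weyl_ops"
| comp: "u \<in> weyl_ops \<Longrightarrow> v \<in> weyl_ops \<Longrightarrow> u \<circ> v \<in> weyl_ops"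

definition weyl_algebra :: "('n::finite, 'k::field_char_0) diffop ring" where
  "weyl_algebra =
    \<lparr>carrier = weyl_ops, monoid.mult = (\<circ>), one = id, zero = (\<lambda>f. 0), add = (\<lambda>u v f. u f + v f)\<rparr>"

text \<open>The operator \<open>\<xi>\<^sup>\<lambda> \<partial>\<^sup>\<mu>\<close>. The order of the factors within \<open>\<xi>\<^sup>\<lambda>\<close> and
  within \<open>\<partial>\<^sup>\<mu>\<close> does not matter, see \<open>xi_fold\<close> and \<open>pd_fold\<close> below.\<close>

definition weyl_monomial :: "('n + 'n \<Rightarrow>\<^sub>0 nat) \<Rightarrow> ('n::finite, 'k::field_char_0) diffop" where
  "weyl_monomial \<alpha> f =
    Finite_Set.fold (\<lambda>i. xi i ^^ Poly_Mapping.lookup \<alpha> (Inl i))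
      (Finite_Set.fold (\<lambda>i. pd i ^^ Poly_Mapping.lookup \<alpha> (Inr i)) f UNIV) UNIV"

text \<open>The bijection of \<open>K[X,Y]\<close> onto the Weyl algebra given by the basis
  \<open>\<xi>\<^sup>\<lambda> \<partial>\<^sup>\<mu>\<close>: it sends \<open>X\<^sup>\<lambda> Y\<^sup>\<mu>\<close> to \<open>\<xi>\<^sup>\<lambda> \<partial>\<^sup>\<mu>\<close>.
  It is linear, but not multiplicative.\<close>

definition weyl_of_poly :: "('n, 'k) polyXY \<Rightarrow> ('n::finite, 'k::field_char_0) diffop" where
  "weyl_of_poly p f =
    (\<Sum>\<alpha>\<in>Poly_Mapping.keys p. scalar (Poly_Mapping.lookup p \<alpha>) (weyl_monomial \<alpha> f))"

text \<open>The rest of this section, up to the definition of the support, proves that the Weyl algebra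
  is a ring and that the operators \<open>\<xi>\<^sup>\<lambda> \<partial>\<^sup>\<mu>\<close> form a basis of it.\<close>

lemma scalar_single: "scalar c (Poly_Mapping.single \<beta> d) = Poly_Mapping.single \<beta> (c * d)"
  by (simp add: scalar_def mult_single)

lemma xi_single: "xi i (Poly_Mapping.single \<beta> c) = Poly_Mapping.single (\<beta> + Poly_Mapping.single i 1) c"
  by (simp add: xi_def mult_single add.commute)

lemma pd_single: "pd i (Poly_Mapping.single \<beta> c) =
    Poly_Mapping.single (\<beta> - Poly_Mapping.single i 1) (of_nat (Poly_Mapping.lookup \<beta> i) * c)"
  by (simp add: pd_def)

lemma scalar_add: "scalar c (f + g) = scalar c f + scalar c g"
  by (simp add: scalar_def distrib_left)

lemma xi_add: "xi i (f + g) = xi i f + xi i g"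
  by (simp add: xi_def distrib_left)

lemma pd_add: "pd i (f + g) = pd i f + pd i g"
proof -
  define S where "S = Poly_Mapping.keys f \<union> Poly_Mapping.keys g"
  have *: "pd i h = (\<Sum>\<alpha>\<in>S. Poly_Mapping.single (\<alpha> - Poly_Mapping.single i 1)
             (of_nat (Poly_Mapping.lookup \<alpha> i) * Poly_Mapping.lookup h \<alpha>))"
    if "Poly_Mapping.keys h \<subseteq> S" for h
    unfolding pd_def using that
    by (intro sum.mono_neutral_left) (auto simp: S_def in_keys_iff)
  show ?thesis
    using keys_add [of f g]
    by (simp add: * S_def lookup_add distrib_left single_add sum.distrib)
qed

lemma weyl_ops_add: "w \<in> weyl_ops \<Longrightarrow> w (f + g) = w f + w g"
  by (induction arbitrary: f g rule: weyl_ops.induct)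
     (simp_all add: scalar_add xi_add pd_add add_ac)

lemma additive_eqI:
  fixes u v :: "('n::finite, 'k::field_char_0) diffop"
  assumes u: "\<And>f g. u (f + g) = u f + u g" and v: "\<And>f g. v (f + g) = v f + v g"
    and "\<And>\<beta> c. u (Poly_Mapping.single \<beta> c) = v (Poly_Mapping.single \<beta> c)"
  shows "u = v"
proof
  fix f :: "('n, 'k) polyX"
  have sums: "w (sum h A) = (\<Sum>a\<in>A. w (h a))"
    if "\<And>f g. w (f + g) = w f + w g" for w :: "('n, 'k) diffop" and h and A :: "('n \<Rightarrow>\<^sub>0 nat) set"
  proof -
    have "w 0 = 0" using that [of 0 0] by simp
    then show ?thesis by (induction A rule: infinite_finite_induct) (simp_all add: that)
  qed
  have "f = (\<Sum>\<beta>\<in>Poly_Mapping.keys f. Poly_Mapping.single \<beta> (Poly_Mapping.lookup f \<beta>))"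
    by (rule poly_mapping_eqI) (auto simp: lookup_sum lookup_single when_def in_keys_iff)
  then obtain h and A :: "('n \<Rightarrow>\<^sub>0 nat) set" where f: "f = (\<Sum>\<beta>\<in>A. Poly_Mapping.single \<beta> (h \<beta>))" by metis
  show "u f = v f"
    unfolding f by (simp add: sums u v assms(3))
qed

lemma xi_comm: "xi i \<circ> xi j = xi j \<circ> xi i"
  by (auto simp: xi_def mult.left_commute)

lemma pd_comm: "pd i \<circ> pd j = pd j \<circ> pd i"
  by (rule additive_eqI)
     (auto simp: pd_add pd_single lookup_minus lookup_single when_def diff_diff_add add.commute mult.left_commute)

lemma funpow_comm:
  assumes "u \<circ> v = v \<circ> u"
  shows "(u ^^ m) \<circ> (v ^^ n) = (v ^^ n) \<circ> (u ^^ m)"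
proof -
  have "u \<circ> (v ^^ n) = (v ^^ n) \<circ> u"
    using assms by (induction n) (auto simp: fun_eq_iff)
  then show ?thesis
    by (induction m) (auto simp: fun_eq_iff)
qed

lemma xi_fold: "comp_fun_commute (\<lambda>i. xi i ^^ m i)"
  by standard (rule funpow_comm [OF xi_comm])

lemma pd_fold: "comp_fun_commute (\<lambda>i. pd i ^^ m i)"
  by standard (rule funpow_comm [OF pd_comm])

lemma id_in_weyl_ops: "id \<in> (weyl_ops :: ('n::finite, 'k::field_char_0) diffop set)"
proof -
  have "scalar 1 = (id :: ('n, 'k) diffop)" by (auto simp: scalar_def)
  then show ?thesis by (metis weyl_ops.scalar)
qed

lemma fold_in_weyl_ops:
  fixes u :: "'n::finite \<Rightarrow> ('n, 'k::field_char_0) diffop"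
  assumes "comp_fun_commute u" "\<And>i. u i \<in> weyl_ops"
  shows "(\<lambda>f. Finite_Set.fold u f (S :: 'n set)) \<in> weyl_ops"
proof -
  interpret comp_fun_commute u by fact
  have "finite S" by simp
  then show ?thesis
  proof induction
    case empty
    then show ?case using id_in_weyl_ops by (simp add: id_def)
  next
    case (insert i S)
    then show ?case
      using weyl_ops.comp [OF assms(2)[of i] insert.IH] by (simp add: o_def)
  qed
qed

lemma funpow_in_weyl_ops: "u \<in> weyl_ops \<Longrightarrow> u ^^ m \<in> weyl_ops"
  by (induction m) (auto intro: weyl_ops.comp id_in_weyl_ops)

lemma weyl_monomial_in:
  fixes \<alpha> :: "'n::finite + 'n \<Rightarrow>\<^sub>0 nat"
  shows "weyl_monomial \<alpha> \<in> (weyl_ops :: ('n, 'k::field_char_0) diffop set)"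
proof -
  have "(weyl_monomial \<alpha> :: ('n, 'k) diffop) = (\<lambda>f. Finite_Set.fold (\<lambda>i. xi i ^^ Poly_Mapping.lookup \<alpha> (Inl i)) f UNIV)
      \<circ> (\<lambda>f. Finite_Set.fold (\<lambda>i. pd i ^^ Poly_Mapping.lookup \<alpha> (Inr i)) f UNIV)"
    by (auto simp: weyl_monomial_def)
  moreover have "\<dots> \<in> weyl_ops"
    by (intro weyl_ops.comp fold_in_weyl_ops xi_fold pd_fold funpow_in_weyl_ops
        weyl_ops.xi weyl_ops.pd)
  ultimately show ?thesis by (simp only:)
qed

lemma zero_in_weyl_ops: "(\<lambda>f. 0) \<in> (weyl_ops :: ('n::finite, 'k::field_char_0) diffop set)"
proof -
  have "scalar 0 = (\<lambda>f. 0 :: ('n, 'k) polyX)" by (auto simp: scalar_def)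
  then show ?thesis by (metis weyl_ops.scalar)
qed

lemma weyl_of_poly_in: "weyl_of_poly p \<in> weyl_ops"
proof -
  have "(\<lambda>f. \<Sum>\<alpha>\<in>A. scalar (c \<alpha>) (weyl_monomial \<alpha> f)) \<in> weyl_ops" 
    for c :: "_ \<Rightarrow> 'b" and A :: "('a + 'a \<Rightarrow>\<^sub>0 nat) set"
  proof (induction A rule: infinite_finite_induct)
    case (insert \<alpha> A)
    then show ?case
      using weyl_ops.add [OF weyl_ops.comp [OF weyl_ops.scalar weyl_monomial_in [of \<alpha>]] insert.IH]
      by (simp add: o_def)
  qed (simp_all add: zero_in_weyl_ops)
  then show ?thesis
    by (simp add: weyl_of_poly_def [abs_def])
qed

definition trunc_ffact :: "nat \<Rightarrow> nat \<Rightarrow> nat" where "trunc_ffact b m = (\<Prod>k<m. b - k)"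

lemma trunc_ffact_eq_0: "b < m \<Longrightarrow> trunc_ffact b m = 0"
  unfolding trunc_ffact_def by (rule prod_zero) auto

definition lpart :: "('n::finite + 'n \<Rightarrow>\<^sub>0 nat) \<Rightarrow> 'n \<Rightarrow>\<^sub>0 nat" where
  "lpart \<alpha> = (\<Sum>i\<in>UNIV. Poly_Mapping.single i (Poly_Mapping.lookup \<alpha> (Inl i)))"
definition rpart :: "('n::finite + 'n \<Rightarrow>\<^sub>0 nat) \<Rightarrow> 'n \<Rightarrow>\<^sub>0 nat" where
  "rpart \<alpha> = (\<Sum>i\<in>UNIV. Poly_Mapping.single i (Poly_Mapping.lookup \<alpha> (Inr i)))"

lemma lookup_lpart [simp]: "Poly_Mapping.lookup (lpart \<alpha>) i = Poly_Mapping.lookup \<alpha> (Inl i)"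
  by (simp add: lpart_def lookup_sum lookup_single when_def)
lemma lookup_rpart [simp]: "Poly_Mapping.lookup (rpart \<alpha>) i = Poly_Mapping.lookup \<alpha> (Inr i)"
  by (simp add: rpart_def lookup_sum lookup_single when_def)

lemma xi_pow_single: "(xi i ^^ m) (Poly_Mapping.single \<beta> c) =
    Poly_Mapping.single (\<beta> + Poly_Mapping.single i m) c"
  by (induction m) (simp_all add: xi_single add.assoc flip: single_add)

lemma pd_pow_single: "(pd i ^^ m) (Poly_Mapping.single \<beta> c) =
    Poly_Mapping.single (\<beta> - Poly_Mapping.single i m) (of_nat (trunc_ffact (Poly_Mapping.lookup \<beta> i) m) * c)"
  by (induction m)
     (simp_all add: pd_single trunc_ffact_def lookup_minus diff_diff_add mult_ac flip: single_add)

lemma xi_fold_single: "Finite_Set.fold (\<lambda>i. xi i ^^ m i) (Poly_Mapping.single \<beta> c) (S::'n::finite set)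
   = Poly_Mapping.single (\<beta> + (\<Sum>i\<in>S. Poly_Mapping.single i (m i))) c"
proof -
  interpret comp_fun_commute "\<lambda>i. xi i ^^ m i" by (rule xi_fold)
  have "finite S" by simp
  then show ?thesis
    by induction (simp_all add: xi_pow_single add_ac)
qed

lemma pd_fold_single: "Finite_Set.fold (\<lambda>i. pd i ^^ m i) (Poly_Mapping.single \<beta> c) (S::'n::finite set)
   = Poly_Mapping.single (\<beta> - (\<Sum>i\<in>S. Poly_Mapping.single i (m i)))
      (of_nat (\<Prod>i\<in>S. trunc_ffact (Poly_Mapping.lookup \<beta> i) (m i)) * c)"
proof -
  interpret comp_fun_commute "\<lambda>i. pd i ^^ m i" by (rule pd_fold)
  have "finite S" by simp
  then show ?thesis
    by induction (simp_all add: pd_pow_single diff_diff_add add_ac lookup_minus lookup_sum lookup_single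
       when_def mult_ac)
qed

lemma weyl_monomial_single: "weyl_monomial \<alpha> (Poly_Mapping.single \<beta> c) =
    Poly_Mapping.single (\<beta> - rpart \<alpha> + lpart \<alpha>)
      (of_nat (\<Prod>i\<in>UNIV. trunc_ffact (Poly_Mapping.lookup \<beta> i) (Poly_Mapping.lookup \<alpha> (Inr i))) * c)"
  by (simp add: weyl_monomial_def xi_fold_single pd_fold_single lpart_def rpart_def)

lemma weyl_of_poly_superset:
  assumes "Poly_Mapping.keys p \<subseteq> A" "finite A"
  shows "weyl_of_poly p f = (\<Sum>\<alpha>\<in>A. scalar (Poly_Mapping.lookup p \<alpha>) (weyl_monomial \<alpha> f))"
  unfolding weyl_of_poly_def using assms
  by (intro sum.mono_neutral_left) (auto simp: in_keys_iff scalar_def)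

lemma weyl_of_poly_add: "weyl_of_poly (p + q) f = weyl_of_poly p f + weyl_of_poly q f"
  using keys_add [of p q]
  by (simp add: weyl_of_poly_superset [where A = "Poly_Mapping.keys p \<union> Poly_Mapping.keys q"]
       lookup_add scalar_def single_add distrib_right sum.distrib)

lemma weyl_of_poly_single: "weyl_of_poly (Poly_Mapping.single \<alpha> c) f = scalar c (weyl_monomial \<alpha> f)"
  by (auto simp: weyl_of_poly_def scalar_def)

lemma weyl_of_poly_eq_0D:
  fixes p :: "('n::finite, 'k::field_char_0) polyXY"
  assumes "weyl_of_poly p = (\<lambda>f. 0)"
  shows "p = 0"
proof (rule ccontr)
  assume "p \<noteq> 0"
  define d where "d = (\<lambda>\<alpha> :: 'n + 'n \<Rightarrow>\<^sub>0 nat. \<Sum>i\<in>UNIV. Poly_Mapping.lookup \<alpha> (Inr i))"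
  have "\<exists>\<alpha>. \<alpha> \<in> Poly_Mapping.keys p" using \<open>p \<noteq> 0\<close> by (simp flip: keys_eq_empty add: ex_in_conv)
  then obtain \<alpha> where \<alpha>: "\<alpha> \<in> Poly_Mapping.keys p"
    and min: "\<And>\<beta>. \<beta> \<in> Poly_Mapping.keys p \<Longrightarrow> d \<alpha> \<le> d \<beta>"
    using ex_has_least_nat [of "\<lambda>\<alpha>. \<alpha> \<in> Poly_Mapping.keys p" _ d] by blast
  define P where "P = (\<lambda>\<beta> :: 'n + 'n \<Rightarrow>\<^sub>0 nat. (\<Prod>i\<in>UNIV. trunc_ffact (Poly_Mapping.lookup \<alpha> (Inr i)) (Poly_Mapping.lookup \<beta> (Inr i))))"
  have P0: "rpart \<beta> = rpart \<alpha>" if "\<beta> \<in> Poly_Mapping.keys p" "P \<beta> \<noteq> 0" for \<beta>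
  proof -
    have "trunc_ffact (Poly_Mapping.lookup \<alpha> (Inr i)) (Poly_Mapping.lookup \<beta> (Inr i)) \<noteq> 0" for i
      using that(2) by (simp add: P_def)
    then have le: "Poly_Mapping.lookup \<beta> (Inr i) \<le> Poly_Mapping.lookup \<alpha> (Inr i)" for i
      by (meson trunc_ffact_eq_0 not_le)
    have "Poly_Mapping.lookup \<beta> (Inr i) = Poly_Mapping.lookup \<alpha> (Inr i)" for i
    proof (rule ccontr)
      assume "Poly_Mapping.lookup \<beta> (Inr i) \<noteq> Poly_Mapping.lookup \<alpha> (Inr i)"
      then have "Poly_Mapping.lookup \<beta> (Inr i) < Poly_Mapping.lookup \<alpha> (Inr i)"
        using le [of i] by simp
      then have "d \<beta> < d \<alpha>"
        unfolding d_def using le by (intro sum_strict_mono_ex1) auto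
      then show False using min [OF that(1)] by simp
    qed
    then show ?thesis by (intro poly_mapping_eqI) simp
  qed
  have "0 = Poly_Mapping.lookup (weyl_of_poly p (Poly_Mapping.single (rpart \<alpha>) 1)) (lpart \<alpha>)"
    using assms by simp
  also have "\<dots> = (\<Sum>\<beta>\<in>Poly_Mapping.keys p. 
      (Poly_Mapping.lookup p \<beta> * of_nat (P \<beta>)) when rpart \<alpha> - rpart \<beta> + lpart \<beta> = lpart \<alpha>)"
    by (simp add: weyl_of_poly_def weyl_monomial_single scalar_single lookup_sum lookup_single P_def)
  also have "\<dots> = (\<Sum>\<beta>\<in>Poly_Mapping.keys p. 
      (Poly_Mapping.lookup p \<beta> * of_nat (P \<beta>)) when \<beta> = \<alpha>)"
  proof (rule sum.cong)
    fix \<beta> assume \<beta>: "\<beta> \<in> Poly_Mapping.keys p"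
    have "\<beta> = \<alpha>" if "P \<beta> \<noteq> 0" "rpart \<alpha> - rpart \<beta> + lpart \<beta> = lpart \<alpha>"
    proof (rule poly_mapping_eqI)
      fix k
      have r: "rpart \<beta> = rpart \<alpha>" using P0 \<beta> that by blast
      then have l: "lpart \<beta> = lpart \<alpha>" using that(2) by simp
      show "Poly_Mapping.lookup \<beta> k = Poly_Mapping.lookup \<alpha> k"
        using arg_cong [OF r, of "\<lambda>x. Poly_Mapping.lookup x i" for i]
          arg_cong [OF l, of "\<lambda>x. Poly_Mapping.lookup x i" for i]
        by (cases k) auto
    qed
    then show "((Poly_Mapping.lookup p \<beta> * of_nat (P \<beta>)) when rpart \<alpha> - rpart \<beta> + lpart \<beta> = lpart \<alpha>) =
        ((Poly_Mapping.lookup p \<beta> * of_nat (P \<beta>)) when \<beta> = \<alpha>)"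
      by (cases "P \<beta> = 0") (auto simp: when_def)
  qed simp
  also have "\<dots> = Poly_Mapping.lookup p \<alpha> * of_nat (P \<alpha>)"
    using \<alpha> by (simp add: when_def)
  finally have "P \<alpha> = 0" using \<alpha> by (simp add: in_keys_iff)
  then show False
    by (auto simp: P_def trunc_ffact_def)
qed

lemma inj_weyl_of_poly: "inj weyl_of_poly"
proof (rule injI)
  fix p q :: "('n::finite, 'k::field_char_0) polyXY"
  assume eq: "weyl_of_poly p = weyl_of_poly q"
  have "weyl_of_poly ((p - q) + q) f = weyl_of_poly (p - q) f + weyl_of_poly q f" for f
    by (rule weyl_of_poly_add)
  then have "weyl_of_poly (p - q) = (\<lambda>f. 0)"
    using eq by (auto simp: fun_eq_iff)
  then show "p = q"
    using weyl_of_poly_eq_0D by force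
qed

lemma xi_weyl_monomial:
  "xi i \<circ> weyl_monomial \<alpha> = weyl_monomial (\<alpha> + Poly_Mapping.single (Inl i) 1)"
proof (rule additive_eqI)
  have "lpart (\<alpha> + Poly_Mapping.single (Inl i) 1) = lpart \<alpha> + Poly_Mapping.single i 1"
    "rpart (\<alpha> + Poly_Mapping.single (Inl i) 1) = rpart \<alpha>"
    by (auto intro!: poly_mapping_eqI simp: lookup_add lookup_single when_def)
  then show "(xi i \<circ> weyl_monomial \<alpha>) (Poly_Mapping.single \<beta> c) =
    weyl_monomial (\<alpha> + Poly_Mapping.single (Inl i) 1) (Poly_Mapping.single \<beta> c)" for \<beta> c
    by (simp add: weyl_monomial_single xi_single lookup_add lookup_single add_ac)
qed (simp_all add: weyl_ops_add [OF weyl_monomial_in] xi_add)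

lemma pd_weyl_monomial:
  "pd i \<circ> weyl_monomial \<alpha> = (\<lambda>f. weyl_monomial (\<alpha> + Poly_Mapping.single (Inr i) 1) f
     + scalar (of_nat (Poly_Mapping.lookup \<alpha> (Inl i))) (weyl_monomial (\<alpha> - Poly_Mapping.single (Inl i) 1) f))"
proof (rule additive_eqI)
  fix \<beta> :: "'a \<Rightarrow>\<^sub>0 nat" and c :: 'b
  define C where "C = (\<Prod>j\<in>UNIV. trunc_ffact (Poly_Mapping.lookup \<beta> j) (Poly_Mapping.lookup \<alpha> (Inr j)))"
  define \<gamma> where "\<gamma> = \<beta> - rpart \<alpha>"
  have p1: "lpart (\<alpha> + Poly_Mapping.single (Inr i) 1) = lpart \<alpha>"
    "rpart (\<alpha> + Poly_Mapping.single (Inr i) 1) = rpart \<alpha> + Poly_Mapping.single i 1"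
    "lpart (\<alpha> - Poly_Mapping.single (Inl i) 1) = lpart \<alpha> - Poly_Mapping.single i 1"
    "rpart (\<alpha> - Poly_Mapping.single (Inl i) 1) = rpart \<alpha>"
    by (auto intro!: poly_mapping_eqI simp: lookup_add lookup_minus lookup_single when_def)
  have "(\<Prod>j\<in>UNIV. trunc_ffact (Poly_Mapping.lookup \<beta> j)
          (Poly_Mapping.lookup (\<alpha> + Poly_Mapping.single (Inr i) 1) (Inr j))) =
        (\<Prod>j\<in>UNIV. trunc_ffact (Poly_Mapping.lookup \<beta> j) (Poly_Mapping.lookup \<alpha> (Inr j)) *
           (if j = i then Poly_Mapping.lookup \<gamma> i else 1))"
    by (rule prod.cong) (auto simp: lookup_add lookup_single trunc_ffact_def \<gamma>_def lookup_minus)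
  also have "\<dots> = C * Poly_Mapping.lookup \<gamma> i"
    by (simp add: prod.distrib C_def)
  finally have C1: "weyl_monomial (\<alpha> + Poly_Mapping.single (Inr i) 1) (Poly_Mapping.single \<beta> c) =
      Poly_Mapping.single (\<gamma> - Poly_Mapping.single i 1 + lpart \<alpha>) (of_nat (C * Poly_Mapping.lookup \<gamma> i) * c)"
    by (simp only: weyl_monomial_single p1 \<gamma>_def diff_diff_add)
  have C2: "weyl_monomial (\<alpha> - Poly_Mapping.single (Inl i) 1) (Poly_Mapping.single \<beta> c) =
      Poly_Mapping.single (\<gamma> + (lpart \<alpha> - Poly_Mapping.single i 1)) (of_nat C * c)"
    by (simp only: weyl_monomial_single p1) (simp add: \<gamma>_def C_def lookup_minus lookup_single)
  have C3: "pd i (weyl_monomial \<alpha> (Poly_Mapping.single \<beta> c)) =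
      Poly_Mapping.single (\<gamma> + lpart \<alpha> - Poly_Mapping.single i 1)
       (of_nat (Poly_Mapping.lookup \<gamma> i + Poly_Mapping.lookup \<alpha> (Inl i)) * (of_nat C * c))"
    by (simp add: weyl_monomial_single pd_single \<gamma>_def C_def lookup_add)
  have e1: "\<gamma> - Poly_Mapping.single i 1 + lpart \<alpha> = \<gamma> + lpart \<alpha> - Poly_Mapping.single i 1"
    if "Poly_Mapping.lookup \<gamma> i \<noteq> 0"
    using that by (intro poly_mapping_eqI) (auto simp: lookup_add lookup_minus lookup_single when_def)
  have e2: "\<gamma> + (lpart \<alpha> - Poly_Mapping.single i 1) = \<gamma> + lpart \<alpha> - Poly_Mapping.single i 1"
    if "Poly_Mapping.lookup \<alpha> (Inl i) \<noteq> 0"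
    using that by (intro poly_mapping_eqI) (auto simp: lookup_add lookup_minus lookup_single when_def)
  show "(pd i \<circ> weyl_monomial \<alpha>) (Poly_Mapping.single \<beta> c) =
    weyl_monomial (\<alpha> + Poly_Mapping.single (Inr i) 1) (Poly_Mapping.single \<beta> c)
     + scalar (of_nat (Poly_Mapping.lookup \<alpha> (Inl i)))
        (weyl_monomial (\<alpha> - Poly_Mapping.single (Inl i) 1) (Poly_Mapping.single \<beta> c))"
    unfolding o_def C1 C2 C3 scalar_single using e1 e2
    by (cases "Poly_Mapping.lookup \<gamma> i = 0"; cases "Poly_Mapping.lookup \<alpha> (Inl i) = 0")
       (simp_all add: algebra_simps flip: single_add)
qed (simp_all add: weyl_ops_add [OF weyl_monomial_in] pd_add scalar_add add_ac)

lemma weyl_ops_range: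
  fixes w :: "('n::finite, 'k::field_char_0) diffop"
  assumes "w \<in> weyl_ops"
  shows "w \<in> Set.range weyl_of_poly"
proof -
  let ?R = "Set.range weyl_of_poly :: ('n, 'k) diffop set"
  have R_add: "(\<lambda>f. u f + v f) \<in> ?R" if uv: "u \<in> ?R" "v \<in> ?R" for u v
    proof -
    obtain p q where "u = weyl_of_poly p" "v = weyl_of_poly q" using uv by blast
    then have "(\<lambda>f. u f + v f) = weyl_of_poly (p + q)" by (simp add: weyl_of_poly_add fun_eq_iff)
    then show ?thesis by blast
  qed
  have R_mon: "(\<lambda>f. scalar c (weyl_monomial \<alpha> f)) \<in> ?R" for c \<alpha>
    by (rule range_eqI [of _ _ "Poly_Mapping.single \<alpha> c"]) (auto simp: weyl_of_poly_single)
  have R_0: "(\<lambda>f. 0) \<in> ?R"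
    by (rule range_eqI [of _ _ 0]) (auto simp: weyl_of_poly_def)
  have sum_R: "(\<lambda>f. \<Sum>\<alpha>\<in>A. g \<alpha> f) \<in> ?R" if "\<And>\<alpha>. g \<alpha> \<in> ?R" for g and A :: "('n + 'n \<Rightarrow>\<^sub>0 nat) set"
    by (induction A rule: infinite_finite_induct) (auto simp: R_0 intro!: R_add that)
  have step: "u \<circ> v \<in> ?R" if u: "u \<in> weyl_ops" and v: "v \<in> ?R"
    and m: "\<And>c \<alpha>. (\<lambda>f. u (scalar c (weyl_monomial \<alpha> f))) \<in> ?R" for u v
  proof -
    obtain p where p: "v = weyl_of_poly p" using v by blast
    have u0: "u 0 = 0" using weyl_ops_add [OF u, of 0 0] by simp
    have usum: "u (sum h A) = (\<Sum>a\<in>A. u (h a))" for h and A :: "('n + 'n \<Rightarrow>\<^sub>0 nat) set"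
      by (induction A rule: infinite_finite_induct) (simp_all add: u0 weyl_ops_add [OF u])
    show ?thesis
      unfolding p o_def weyl_of_poly_def [of p, abs_def] usum by (rule sum_R) (rule m)
  qed
  have "\<forall>v\<in>?R. w \<circ> v \<in> ?R" if "w \<in> weyl_ops" for w
    using that
  proof induction
    case (scalar c)
    have "scalar c (scalar d f) = scalar (c * d) f" for d and f :: "('n, 'k) polyX"
      by (simp add: scalar_def mult_single flip: mult.assoc)
    then show ?case
      by (intro ballI step [OF weyl_ops.scalar]) (assumption, simp only: R_mon)
  next
    case (xi i)
    have "xi i (scalar d f) = scalar d (xi i f)" for d and f :: "('n, 'k) polyX"
      by (simp add: scalar_def xi_def mult.left_commute)
    moreover have "xi i (weyl_monomial \<alpha> f) = weyl_monomial (\<alpha> + Poly_Mapping.single (Inl i) 1) f" 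
      for \<alpha> and f :: "('n, 'k) polyX"
      using xi_weyl_monomial [of i \<alpha>] by (metis comp_apply)
    ultimately show ?case
      by (intro ballI step [OF weyl_ops.xi]) (assumption, simp only: R_mon)
  next
    case (pd i)
    have "pd i \<circ> scalar d = scalar d \<circ> (pd i :: ('n, 'k) diffop)" for d
      by (rule additive_eqI) (simp_all add: scalar_add pd_add pd_single scalar_single mult_ac)
    then have s: "pd i (scalar d f) = scalar d (pd i f)" for d and f :: "('n, 'k) polyX"
      by (metis comp_apply)
    have "scalar c (scalar d f) = scalar (c * d) f" for c d and f :: "('n, 'k) polyX"
      by (simp add: scalar_def mult_single flip: mult.assoc)
    moreover have "pd i (weyl_monomial \<alpha> f) = weyl_monomial (\<alpha> + Poly_Mapping.single (Inr i) 1) f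
     + scalar (of_nat (Poly_Mapping.lookup \<alpha> (Inl i))) (weyl_monomial (\<alpha> - Poly_Mapping.single (Inl i) 1) f)" 
      for \<alpha> and f :: "('n, 'k) polyX"
      using pd_weyl_monomial [of i \<alpha>] by (metis comp_apply)
    ultimately show ?case
      using s by (intro ballI step [OF weyl_ops.pd]) (assumption, simp only: scalar_add, intro R_add R_mon)
  next
    case (add u v)
    then show ?case
      using R_add by (fastforce simp: o_def)
  next
    case (comp u v)
    then show ?case by (metis comp_assoc)
  qed
  moreover have "id \<in> ?R"
  proof (rule range_eqI [of _ _ 1])
    show "id = (weyl_of_poly 1 :: ('n, 'k) diffop)"
      by (rule additive_eqI)
         (auto simp: scalar_add weyl_ops_add [OF weyl_monomial_in] weyl_of_poly_single weyl_monomial_single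
           scalar_single trunc_ffact_def lpart_def rpart_def simp flip: single_one)
  qed
  ultimately show ?thesis using assms by (metis comp_id)
qed

theorem bij_weyl_of_poly: "bij_betw weyl_of_poly UNIV (carrier weyl_algebra)"
  using weyl_ops_range weyl_of_poly_in inj_weyl_of_poly
  by (auto simp: bij_betw_def weyl_algebra_def)

lemma ring_weyl_algebra: "ring (weyl_algebra :: ('n::finite, 'k::field_char_0) diffop ring)"
proof -
  have neg: "\<exists>v\<in>weyl_ops. \<forall>f. v f + u f = 0" if "u \<in> weyl_ops" for u :: "('n, 'k) diffop"
  proof
    show "scalar (- 1) \<circ> u \<in> weyl_ops" by (rule weyl_ops.comp [OF weyl_ops.scalar that])
    have "Poly_Mapping.single 0 (- 1) = (- 1 :: ('n, 'k) polyX)"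
      by (simp add: single_uminus)
    then show "\<forall>f. (scalar (- 1) \<circ> u) f + u f = 0"
      by (auto simp: scalar_def)
  qed
  have neg': "\<exists>v\<in>weyl_ops. \<forall>f. u f + v f = 0" if "u \<in> weyl_ops" for u :: "('n, 'k) diffop"
    using neg [OF that] by (simp add: add.commute)
  have "abelian_group (weyl_algebra :: ('n, 'k) diffop ring)"
    by (rule abelian_groupI)
       (auto simp: weyl_algebra_def add_ac fun_eq_iff zero_in_weyl_ops
         intro: weyl_ops.add neg neg')
  moreover have "monoid (weyl_algebra :: ('n, 'k) diffop ring)"
    by (rule monoidI)
       (auto simp: weyl_algebra_def id_in_weyl_ops intro: weyl_ops.comp)
  ultimately show ?thesis
    by (intro ringI)
       (auto simp: weyl_algebra_def fun_eq_iff weyl_ops_add)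
qed

definition weyl_supp :: "('n::finite, 'k::field_char_0) diffop \<Rightarrow> ('n + 'n \<Rightarrow>\<^sub>0 nat) set" where
  "weyl_supp w = Poly_Mapping.keys (the_inv weyl_of_poly w)"


section \<open>Weighted degrees and the graded modules of the statement\<close>

definition Omega :: "'n::finite weight set" where
  "Omega = {\<omega>. \<forall>i. \<omega> (Inl i) + \<omega> (Inr i) > 0}"

definition wt :: "'n::finite weight \<Rightarrow> ('n + 'n \<Rightarrow>\<^sub>0 nat) \<Rightarrow> nat" where
  "wt \<omega> \<alpha> = (\<Sum>i\<in>UNIV. \<omega> i * Poly_Mapping.lookup \<alpha> i)"

definition supp_deg :: "'n::finite weight \<Rightarrow> ('n + 'n \<Rightarrow>\<^sub>0 nat) set \<Rightarrow> ereal" where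
  "supp_deg \<omega> S = (SUP \<alpha>\<in>S. ereal (real (wt \<omega> \<alpha>)))"

definition weyl_filtration ::
    "'n weight \<Rightarrow> int \<Rightarrow> ('n::finite, 'k::field_char_0) diffop set" where
  "weyl_filtration \<omega> i =
    {w \<in> carrier weyl_algebra. supp_deg \<omega> (weyl_supp w) \<le> ereal (real_of_int i)}"

definition poly_filtration ::
    "'n weight \<Rightarrow> int \<Rightarrow> ('n::finite, 'k::field_char_0) polyXY set" where
  "poly_filtration \<nu> i = {p. supp_deg \<nu> (Poly_Mapping.keys p) \<le> ereal (real_of_int i)}"

definition hom_component ::
    "'n weight \<Rightarrow> int \<Rightarrow> ('n, 'k) polyXY \<Rightarrow> ('n::finite, 'k::field_char_0) polyXY" where
  "hom_component \<omega> i p =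
    (\<Sum>\<alpha> | \<alpha> \<in> Poly_Mapping.keys p \<and> int (wt \<omega> \<alpha>) = i.
       Poly_Mapping.single \<alpha> (Poly_Mapping.lookup p \<alpha>))"

text \<open>The identifications of \<open>K[X,Y]\<close> with the associated graded rings of the Weyl algebra
  and of \<open>K[X,Y]\<close>: they send \<open>X\<^sup>\<lambda> Y\<^sup>\<mu>\<close> to the class of
  \<open>\<xi>\<^sup>\<lambda> \<partial>\<^sup>\<mu>\<close>, respectively of \<open>X\<^sup>\<lambda> Y\<^sup>\<mu>\<close>, in the degree which is the weight
  of \<open>(\<lambda>|\<mu>)\<close>.\<close>

definition weyl_symbol ::
    "'n weight \<Rightarrow> ('n, 'k) polyXY \<Rightarrow> int \<Rightarrow> ('n::finite, 'k::field_char_0) diffop set" where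
  "weyl_symbol \<omega> p i =
    weyl_filtration \<omega> (i - 1) +>\<^bsub>weyl_algebra\<^esub> weyl_of_poly (hom_component \<omega> i p)"

definition poly_symbol ::
    "'n weight \<Rightarrow> ('n, 'k) polyXY \<Rightarrow> int \<Rightarrow> ('n::finite, 'k::field_char_0) polyXY set" where
  "poly_symbol \<nu> p i = poly_filtration \<nu> (i - 1) +>\<^bsub>polyXY_ring\<^esub> hom_component \<nu> i p"

text \<open>The associated graded modules, as modules over \<open>K[X,Y]\<close>, of a module over the
  Weyl algebra and of a module over \<open>K[X,Y]\<close>.\<close>

definition gr_weyl ::
    "'n weight \<Rightarrow> (('n::finite, 'k::field_char_0) diffop, 'm) module \<Rightarrow> (int \<Rightarrow> 'm set)
      \<Rightarrow> (('n, 'k) polyXY, int \<Rightarrow> 'm set) module" where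
  "gr_weyl \<omega> M FM =
    restrict_scalars (weyl_symbol \<omega>) (gr_module weyl_algebra (weyl_filtration \<omega>) M FM)"

definition gr_poly ::
    "'n weight \<Rightarrow> (('n::finite, 'k::field_char_0) polyXY, 'm) module \<Rightarrow> (int \<Rightarrow> 'm set)
      \<Rightarrow> (('n, 'k) polyXY, int \<Rightarrow> 'm set) module" where
  "gr_poly \<nu> N FN =
    restrict_scalars (poly_symbol \<nu>) (gr_module polyXY_ring (poly_filtration \<nu>) N FN)"

abbreviation good_weyl_filtration ::
    "'n weight \<Rightarrow> (('n::finite, 'k::field_char_0) diffop, 'm) module \<Rightarrow> (int \<Rightarrow> 'm set) \<Rightarrow> bool" where
  "good_weyl_filtration \<omega> \<equiv> good_filtration weyl_algebra (weyl_filtration \<omega>)"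

abbreviation good_poly_filtration ::
    "'n weight \<Rightarrow> (('n::finite, 'k::field_char_0) polyXY, 'm) module \<Rightarrow> (int \<Rightarrow> 'm set) \<Rightarrow> bool" where
  "good_poly_filtration \<nu> \<equiv> good_filtration polyXY_ring (poly_filtration \<nu>)"

definition rad_ann :: "(('n::finite, 'k::field_char_0) polyXY, 'm) module \<Rightarrow> ('n, 'k) polyXY set" where
  "rad_ann N = radical polyXY_ring (annihilator polyXY_ring N)"

end

theory Submission
  imports Defs "HOL-Library.List_Lexorder"
begin

text \<open>
  Let \<open>M\<close> be generated by \<open>x\<^sub>j\<close>, \<open>j < t\<close>, let \<open>V\<close> be the free \<open>K[X,Y]\<close>-module on \<open>t\<close> generators,
  identified with the free module over the Weyl algebra by normal ordering of the coefficients,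
  and let \<open>L \<subseteq> V\<close> be the set of relations between the \<open>x\<^sub>j\<close>. With all generators placed in degree
  \<open>0\<close>, the graded module of \<open>M\<close> for \<open>\<omega>\<close> is the quotient of \<open>V\<close> by the module \<open>in\<^sub>\<omega>(L)\<close> of leading
  forms. All three radicals of the theorem turn out to be the radical of the annihilator of
  \<open>V / in\<^sub>w(L)\<close> for \<open>w = \<nu> + s\<omega>\<close>. Three facts are responsible for this.

  \<^item> The radical of the annihilator of a graded module does not depend on the good filtration
    (\<open>rad_good_filtered_mono\<close>): two good filtrations are at bounded distance, and a high power of an
    annihilator lowers degrees by more than this distance.

  \<^item> For a finitely generated \<open>K[X,Y]\<close>-module \<open>N\<close>, the annihilator of its graded module for \<open>\<nu>\<close> has
    the same radical as the initial ideal of the annihilator of \<open>N\<close> (\<open>rad_initial_ideal_colon\<close>,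
    \<open>rad_ann_gr_poly\<close>). This is a weighted form of the determinant trick. As the radical of
    an initial ideal depends only on the radical of the ideal, an iterated graded module may be
    replaced by the one obtained from any other good filtration of \<open>M\<close>, even though the inner graded
    modules need not be isomorphic. So the first radical is that of the annihilator of
    \<open>V / in\<^sub>\<nu>(in\<^sub>\<omega>(L))\<close>.

  \<^item> There is a number \<open>s\<^sub>\<nu>\<close> with \<open>in\<^sub>w(L) = in\<^sub>\<nu>(in\<^sub>\<omega>(L))\<close> for all \<open>\<omega> \<in> \<Omega>\<close> and \<open>s > s\<^sub>\<nu>\<close>
    (\<open>initial_of_initial\<close>). A single element \<open>u\<close> satisfies \<open>in\<^sub>w(u) = in\<^sub>\<nu>(in\<^sub>\<omega>(u))\<close> once \<open>s\<close> exceeds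
    the \<open>\<nu>\<close>-weights of its monomials, because distinct \<open>\<omega>\<close>-weights differ by at least one. The
    leading forms of a Groebner basis generate the initial module, and uniformity in \<open>\<omega>\<close> comes from
    a finite Groebner basis that serves all monomial orders (\<open>universal_groebner_basis\<close>).

  The second radical equals the third one because \<open>in\<^sub>w(L) = in\<^sub>\<nu>(in\<^sub>\<omega>(L))\<close> is \<open>\<nu>\<close>-homogeneous, so
  that it is its own initial module for \<open>\<nu>\<close>.\<close>

section \<open>Weighted degrees and homogeneous components of polynomials\<close>

abbreviation lookup :: "('a \<Rightarrow>\<^sub>0 'b::zero) \<Rightarrow> 'a \<Rightarrow> 'b" where "lookup \<equiv> Poly_Mapping.lookup"
abbreviation single :: "'a \<Rightarrow> 'b \<Rightarrow> ('a \<Rightarrow>\<^sub>0 'b::zero)" where "single \<equiv> Poly_Mapping.single"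
abbreviation keys :: "('a \<Rightarrow>\<^sub>0 'b::zero) \<Rightarrow> 'a set" where "keys \<equiv> Poly_Mapping.keys"

abbreviation PF :: "'n weight \<Rightarrow> int \<Rightarrow> ('n::finite, 'k::field_char_0) polyXY set" where
  "PF \<equiv> poly_filtration"

abbreviation hc :: "'n weight \<Rightarrow> int \<Rightarrow> ('n, 'k) polyXY \<Rightarrow> ('n::finite, 'k::field_char_0) polyXY" where
  "hc \<equiv> hom_component"

lemma PF_iff: "p \<in> PF w i \<longleftrightarrow> (\<forall>\<alpha>\<in>keys p. int (wt w \<alpha>) \<le> i)"
proof -
  have "real (wt w \<alpha>) \<le> real_of_int i \<longleftrightarrow> int (wt w \<alpha>) \<le> i" for \<alpha>
    by (metis of_int_le_iff of_int_of_nat_eq)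
  then show ?thesis
    by (simp add: poly_filtration_def supp_deg_def SUP_le_iff)
qed

lemma wt_add: "wt w (\<alpha> + \<beta>) = wt w \<alpha> + wt w \<beta>"
  by (simp add: wt_def lookup_add distrib_left sum.distrib)

lemma lookup_hc: "lookup (hc w i p) \<alpha> = (lookup p \<alpha> when int (wt w \<alpha>) = i)"
  by (auto simp: hom_component_def lookup_sum lookup_single when_def in_keys_iff)

lemma PF_iff_lookup: "p \<in> PF w i \<longleftrightarrow> (\<forall>\<alpha>. lookup p \<alpha> \<noteq> 0 \<longrightarrow> int (wt w \<alpha>) \<le> i)"
  by (auto simp: PF_iff in_keys_iff)

lemma PF_0 [simp]: "0 \<in> PF w i"
  by (simp add: PF_iff)

lemma PF_add: "p \<in> PF w i \<Longrightarrow> q \<in> PF w i \<Longrightarrow> p + q \<in> PF w i"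
  using keys_add[of p q] by (auto simp: PF_iff)

lemma PF_uminus_iff [simp]: "- p \<in> PF w i \<longleftrightarrow> p \<in> PF w i"
  by (simp add: PF_iff_lookup)

lemma PF_diff: "p \<in> PF w i \<Longrightarrow> q \<in> PF w i \<Longrightarrow> p - q \<in> PF w i"
  using PF_add[of p w i "- q"] by simp

lemma PF_mono: "p \<in> PF w i \<Longrightarrow> i \<le> j \<Longrightarrow> p \<in> PF w j"
  by (fastforce simp: PF_iff)

lemma PF_sum: "(\<And>x. x \<in> X \<Longrightarrow> f x \<in> PF w i) \<Longrightarrow> sum f X \<in> PF w i"
  by (induction X rule: infinite_finite_induct) (auto intro: PF_add)

lemma PF_mult: "p \<in> PF w i \<Longrightarrow> q \<in> PF w j \<Longrightarrow> p * q \<in> PF w (i + j)"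
  using keys_mult[of p q] by (fastforce simp: PF_iff wt_add)

lemma PF_trans: "p - q \<in> PF w i \<Longrightarrow> q - r \<in> PF w i \<Longrightarrow> p - r \<in> PF w i"
  using PF_add[of "p - q" w i "q - r"] by simp

lemma PF_cong: "p - q \<in> PF w i \<Longrightarrow> p \<in> PF w i \<longleftrightarrow> q \<in> PF w i"
  using PF_add[of "p - q" w i q] PF_diff[of p w i "p - q"] by auto

text \<open>Congruence modulo lower degree is compatible with products; the degrees of \<open>p\<close> and \<open>q'\<close>
  are what the estimate of \<open>p(q - q') + (p - p')q'\<close> uses.\<close>

lemma PF_mult_diff:
  assumes "p - p' \<in> PF w (i - 1)" "q - q' \<in> PF w (j - 1)" "p \<in> PF w i" "q' \<in> PF w j"
  shows "p * q - p' * q' \<in> PF w (i + j - 1)"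
proof -
  have "p * q - p * q' \<in> PF w (i + j - 1)" "p * q' - p' * q' \<in> PF w (i + j - 1)"
    using PF_mult[OF assms(3,2)] PF_mult[OF assms(1,4)] by (simp_all add: algebra_simps)
  then show ?thesis by (rule PF_trans)
qed

lemma PF_power: "p \<in> PF w i \<Longrightarrow> p ^ n \<in> PF w (int n * i)"
proof (induction n)
  case 0
  show ?case by (simp add: PF_iff wt_def)
next
  case (Suc n)
  then show ?case using PF_mult[of p w i "p ^ n" "int n * i"] by (simp add: algebra_simps)
qed

lemma PF_exists: "\<exists>i. p \<in> PF w i"
proof -
  have "p \<in> PF w (\<Sum>\<alpha>\<in>keys p. int (wt w \<alpha>))"
    unfolding PF_iff by (auto intro: member_le_sum)
  then show ?thesis by blast
qed

lemma hc_add: "hc w i (p + q) = hc w i p + hc w i q"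
  by (rule poly_mapping_eqI) (simp add: lookup_hc lookup_add when_add_distrib)

lemma hc_diff: "hc w i (p - q) = hc w i p - hc w i q"
  by (rule poly_mapping_eqI) (simp add: lookup_hc lookup_minus when_diff_distrib)

lemma hc_0 [simp]: "hc w i 0 = 0"
  by (rule poly_mapping_eqI) (simp add: lookup_hc)

lemma hc_sum: "hc w i (sum f X) = (\<Sum>x\<in>X. hc w i (f x))"
  by (induction X rule: infinite_finite_induct) (auto simp: hc_add)

lemma hc_PF: "hc w i p \<in> PF w i"
  by (simp add: PF_iff_lookup lookup_hc when_def)

lemma hc_eq_0: "p \<in> PF w j \<Longrightarrow> j < i \<Longrightarrow> hc w i p = 0"
  by (rule poly_mapping_eqI) (fastforce simp: lookup_hc when_def PF_iff_lookup)

lemma diff_hc: "p \<in> PF w i \<Longrightarrow> p - hc w i p \<in> PF w (i - 1)"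
  by (fastforce simp: PF_iff_lookup lookup_minus lookup_hc when_def)

lemma PF_minus_1_iff: "p \<in> PF w i \<Longrightarrow> p \<in> PF w (i - 1) \<longleftrightarrow> hc w i p = 0"
  using diff_hc[of p w i] hc_eq_0[of p w "i - 1" i] by auto

lemma hc_hc: "hc w i (hc w j p) = (if i = j then hc w j p else 0)"
  by (rule poly_mapping_eqI) (auto simp: lookup_hc when_def)

lemma hc_comm: "hc w i (hc v j p) = hc v j (hc w i p)"
  by (rule poly_mapping_eqI) (auto simp: lookup_hc when_def)

lemma finite_hc: "finite {i. hc w i p \<noteq> 0}"
proof (rule finite_subset)
  show "{i. hc w i p \<noteq> 0} \<subseteq> (\<lambda>\<alpha>. int (wt w \<alpha>)) ` keys p"
    by (auto simp: poly_mapping_eq_iff fun_eq_iff lookup_hc image_iff in_keys_iff)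
qed simp

lemma sum_hc:
  assumes "finite I" "\<And>i. hc w i p \<noteq> 0 \<Longrightarrow> i \<in> I"
  shows "(\<Sum>i\<in>I. hc w i p) = p"
proof (rule poly_mapping_eqI)
  fix \<alpha>
  have "int (wt w \<alpha>) \<in> I" if "lookup p \<alpha> \<noteq> 0"
    using that by (intro assms(2)) (auto simp: poly_mapping_eq_iff fun_eq_iff lookup_hc)
  then show "lookup (\<Sum>i\<in>I. hc w i p) \<alpha> = lookup p \<alpha>"
    using assms(1) by (auto simp: lookup_sum lookup_hc when_def)
qed

lemma poly_eq_sum_single:
  "p = (\<Sum>\<alpha>\<in>keys p. single \<alpha> (lookup p \<alpha>))"
  by (rule poly_mapping_eqI) (auto simp: lookup_sum lookup_single when_def in_keys_iff)

lemma hc_single: "hc w i (single \<alpha> c) = (if int (wt w \<alpha>) = i then single \<alpha> c else 0)"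
  by (rule poly_mapping_eqI) (auto simp: lookup_hc lookup_single when_def)

lemma hc_mult_hom: "hc w k (hc w i p * q) = hc w i p * hc w (k - i) q"
proof -
  define f where "f \<alpha> = single \<alpha> (lookup p \<alpha>)" for \<alpha>
  define g where "g \<alpha> = single \<alpha> (lookup q \<alpha>)" for \<alpha>
  have p: "p = sum f (keys p)" and q: "q = sum g (keys q)"
    using poly_eq_sum_single[of p] poly_eq_sum_single[of q] by (simp_all add: f_def g_def)
  have *: "hc w k (hc w i (f \<alpha>) * g \<beta>) = hc w i (f \<alpha>) * hc w (k - i) (g \<beta>)" for \<alpha> \<beta>
    by (auto simp: f_def g_def hc_single mult_single wt_add)
  have "hc w k (hc w i (sum f A) * sum g B) = hc w i (sum f A) * hc w (k - i) (sum g B)" for A B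
    by (simp only: hc_sum sum_product *)
  then show ?thesis using p q by metis
qed

lemma hc_mult:
  assumes "finite I" "\<And>i. hc w i p \<noteq> 0 \<Longrightarrow> i \<in> I"
  shows "hc w k (p * q) = (\<Sum>i\<in>I. hc w i p * hc w (k - i) q)"
proof -
  have "hc w k (p * q) = hc w k ((\<Sum>i\<in>I. hc w i p) * q)"
    using sum_hc[of I w p] assms by simp
  then show ?thesis by (simp add: sum_distrib_right hc_sum hc_mult_hom)
qed

lemma hc_mult_top:
  assumes "p \<in> PF w i" "q \<in> PF w j"
  shows "hc w (i + j) (p * q) = hc w i p * hc w j q"
proof -
  have "p * q - hc w i p * q \<in> PF w (i + j - 1)"
    using PF_mult[OF diff_hc[OF assms(1)] assms(2)] by (simp add: algebra_simps)
  then have "hc w (i + j) (p * q - hc w i p * q) = 0"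
    by (rule hc_eq_0) simp
  then show ?thesis by (simp add: hc_diff hc_mult_hom)
qed

lemma hc_power_top: "p \<in> PF w i \<Longrightarrow> hc w (int n * i) (p ^ n) = hc w i p ^ n"
proof (induction n)
  case 0
  show ?case by (simp add: hc_single wt_def flip: single_one)
next
  case (Suc n)
  then show ?case using hc_mult_top[of p w i "p ^ n" "int n * i"] PF_power[of p w i n]
    by (simp add: algebra_simps)
qed

section \<open>Radicals and initial forms in the polynomial ring\<close>

definition is_ideal :: "('n::finite, 'k::field_char_0) polyXY set \<Rightarrow> bool" where
  "is_ideal I \<longleftrightarrow> 0 \<in> I \<and> (\<forall>p\<in>I. \<forall>q\<in>I. p + q \<in> I) \<and> (\<forall>p. \<forall>q\<in>I. p * q \<in> I)"

definition rad :: "('n::finite, 'k::field_char_0) polyXY set \<Rightarrow> ('n, 'k) polyXY set" where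
  "rad I = {p. \<exists>m>0. p ^ m \<in> I}"

text \<open>The ideal spanned by the leading forms of the elements of \<open>I\<close>, described by its homogeneous
  components: each of them is the degree \<open>k\<close> component of an element of degree at most \<open>k\<close>.\<close>

definition initial_ideal :: "'n weight \<Rightarrow> ('n::finite, 'k::field_char_0) polyXY set \<Rightarrow> ('n, 'k) polyXY set" where
  "initial_ideal w I = {p. \<forall>k. \<exists>u\<in>I. u \<in> PF w k \<and> hc w k u = hc w k p}"

lemma rad_subsetI: "(\<And>p. p \<in> I \<Longrightarrow> \<exists>m>0. p ^ m \<in> I') \<Longrightarrow> rad I \<subseteq> rad I'"
proof
  fix p assume *: "\<And>p. p \<in> I \<Longrightarrow> \<exists>m>0. p ^ m \<in> I'" and "p \<in> rad I"
  then obtain m where "m > 0" "p ^ m \<in> I" by (auto simp: rad_def)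
  then obtain l where "l > 0" "(p ^ m) ^ l \<in> I'" using * by blast
  then have "p ^ (m * l) \<in> I'" "m * l > 0" using \<open>m > 0\<close> by (simp_all add: power_mult)
  then show "p \<in> rad I'" unfolding rad_def by blast
qed

lemma subset_rad: "I \<subseteq> rad I"
proof
  fix p assume "p \<in> I"
  then have "p ^ 1 \<in> I" by simp
  then show "p \<in> rad I" unfolding rad_def by blast
qed

lemma rad_mono: "I \<subseteq> I' \<Longrightarrow> rad I \<subseteq> rad I'"
  by (auto simp: rad_def)

lemma is_ideal_sum: "is_ideal I \<Longrightarrow> (\<And>x. x \<in> X \<Longrightarrow> f x \<in> I) \<Longrightarrow> sum f X \<in> I"
  by (induction X rule: infinite_finite_induct) (auto simp: is_ideal_def)

lemma rad_add:
  assumes I: "is_ideal I" and "p \<in> rad I" "q \<in> rad I"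
  shows "p + q \<in> rad I"
proof -
  obtain m l where m: "m > 0" "p ^ m \<in> I" and l: "l > 0" "q ^ l \<in> I"
    using assms(2,3) by (auto simp: rad_def)
  have mult: "x * y \<in> I" if "y \<in> I" for x y
    using I that by (auto simp: is_ideal_def)
  have "of_nat (m + l choose k) * p ^ k * q ^ (m + l - k) \<in> I" if "k \<le> m + l" for k
  proof (cases "m \<le> k")
    case True
    then have "of_nat (m + l choose k) * p ^ k * q ^ (m + l - k)
        = (of_nat (m + l choose k) * p ^ (k - m) * q ^ (m + l - k)) * p ^ m"
      using power_add[of p "k - m" m] by (simp add: mult_ac)
    then show ?thesis using mult[OF m(2)] by simp
  next
    case False
    then have "m + l - k = (m - k) + l" by simp
    then have "of_nat (m + l choose k) * p ^ k * q ^ (m + l - k)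
        = (of_nat (m + l choose k) * p ^ k * q ^ (m - k)) * q ^ l"
      by (simp add: mult_ac power_add)
    then show ?thesis using mult[OF l(2)] by simp
  qed
  then have "(p + q) ^ (m + l) \<in> I"
    unfolding binomial_ring by (intro is_ideal_sum[OF I]) simp
  then show ?thesis using m(1) unfolding rad_def by blast
qed

lemma rad_sum:
  assumes I: "is_ideal I" and "\<And>x. x \<in> X \<Longrightarrow> f x \<in> rad I"
  shows "sum f X \<in> rad I"
  using assms(2)
proof (induction X rule: infinite_finite_induct)
  case (insert x X)
  then show ?case by (simp add: rad_add[OF I])
qed (use I subset_rad[of I] in \<open>auto simp: is_ideal_def\<close>)

text \<open>Membership in a radical may be tested on homogeneous components, because the radical of an
  ideal is closed under sums.\<close>

lemma mem_rad_if_hc: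
  assumes "is_ideal I" "\<And>i. hc w i p \<in> rad I"
  shows "p \<in> rad I"
  using rad_sum[OF assms(1), of "{i. hc w i p \<noteq> 0}" "\<lambda>i. hc w i p"] assms(2)
  by (simp add: sum_hc[OF finite_hc])

lemma is_ideal_initial_ideal:
  assumes I: "is_ideal I"
  shows "is_ideal (initial_ideal w I)"
  unfolding is_ideal_def
proof (intro conjI ballI allI)
  show "0 \<in> initial_ideal w I" using I by (auto simp: initial_ideal_def is_ideal_def intro!: bexI[of _ 0])
next
  fix p q assume pq: "p \<in> initial_ideal w I" "q \<in> initial_ideal w I"
  show "p + q \<in> initial_ideal w I"
    unfolding initial_ideal_def
  proof (intro CollectI allI)
    fix k
    from pq obtain u v where "u \<in> I" "v \<in> I" "u \<in> PF w k" "v \<in> PF w k"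
      "hc w k u = hc w k p" "hc w k v = hc w k q"
      unfolding initial_ideal_def by blast
    then show "\<exists>u\<in>I. u \<in> PF w k \<and> hc w k u = hc w k (p + q)"
      using I by (intro bexI[of _ "u + v"]) (auto simp: hc_add PF_add is_ideal_def)
  qed
next
  fix p q assume q: "q \<in> initial_ideal w I"
  show "p * q \<in> initial_ideal w I"
    unfolding initial_ideal_def
  proof (intro CollectI allI)
    fix k
    from q have "\<forall>i. \<exists>u\<in>I. u \<in> PF w (k - i) \<and> hc w (k - i) u = hc w (k - i) q"
      unfolding initial_ideal_def by blast
    then obtain u where u: "\<And>i. u i \<in> I" "\<And>i. u i \<in> PF w (k - i)"
      "\<And>i. hc w (k - i) (u i) = hc w (k - i) q" by metis
    let ?S = "{i. hc w i p \<noteq> 0}"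
    let ?v = "\<Sum>i\<in>?S. hc w i p * u i"
    have "?v \<in> I" using I u(1) by (intro is_ideal_sum) (auto simp: is_ideal_def)
    moreover have "?v \<in> PF w k"
    proof (rule PF_sum)
      fix i show "hc w i p * u i \<in> PF w k"
        using PF_mult[OF hc_PF[of w i p] u(2)[of i]] by simp
    qed
    moreover have "hc w k ?v = hc w k (p * q)"
      by (simp add: hc_sum hc_mult_hom u(3) hc_mult[OF finite_hc])
    ultimately show "\<exists>u\<in>I. u \<in> PF w k \<and> hc w k u = hc w k (p * q)" by blast
  qed
qed

lemma hc_mem_initial_ideal: "u \<in> I \<Longrightarrow> is_ideal I \<Longrightarrow> u \<in> PF w k \<Longrightarrow> hc w k u \<in> initial_ideal w I"
  unfolding initial_ideal_def
proof (intro CollectI allI)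
  fix l assume *: "u \<in> I" "is_ideal I" "u \<in> PF w k"
  show "\<exists>v\<in>I. v \<in> PF w l \<and> hc w l v = hc w l (hc w k u)"
  proof (cases "l = k")
    case True
    then show ?thesis using * by (intro bexI[of _ u]) (auto simp: hc_hc)
  next
    case False
    then show ?thesis using * by (intro bexI[of _ 0]) (auto simp: hc_hc is_ideal_def)
  qed
qed

text \<open>On elements of degree at most \<open>i\<close>, taking the component of degree \<open>i\<close> is multiplicative, so the
  component of \<open>u\<^sup>m\<close> is the \<open>m\<close>-th power of that of \<open>u\<close>. Hence the radical of the initial ideal
  depends on the radical of the ideal only.\<close>

lemma rad_initial_ideal_mono:
  assumes I': "is_ideal I'" and le: "I \<subseteq> rad I'"
  shows "rad (initial_ideal w I) \<subseteq> rad (initial_ideal w I')"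
proof (rule rad_subsetI)
  fix p assume p: "p \<in> initial_ideal w I"
  have "p \<in> rad (initial_ideal w I')"
  proof (rule mem_rad_if_hc[OF is_ideal_initial_ideal[OF I']])
    fix i
    obtain u where u: "u \<in> I" "u \<in> PF w i" "hc w i u = hc w i p"
      using p unfolding initial_ideal_def by blast
    then obtain m where m: "m > 0" "u ^ m \<in> I'" using le by (auto simp: rad_def)
    have "hc w i p ^ m \<in> initial_ideal w I'"
      using hc_mem_initial_ideal[OF m(2) I' PF_power[OF u(2)]] u(3) by (simp add: hc_power_top[OF u(2)])
    then show "hc w i p \<in> rad (initial_ideal w I')" using m(1) by (auto simp: rad_def)
  qed
  then show "\<exists>m>0. p ^ m \<in> initial_ideal w I'" by (simp add: rad_def)
qed

lemma rad_initial_ideal_cong: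
  assumes "is_ideal I" "is_ideal I'" "rad I = rad I'"
  shows "rad (initial_ideal w I) = rad (initial_ideal w I')"
  using rad_initial_ideal_mono[of I' I w] rad_initial_ideal_mono[of I I' w] subset_rad[of I] subset_rad[of I'] assms
  by blast

section \<open>Submodules of a free module and their initial modules\<close>

type_synonym ('n, 'k) pvec = "nat \<Rightarrow> ('n, 'k) polyXY"

text \<open>Vectors are functions on all natural numbers of which only the entries below \<open>t\<close> matter; the
  last clause makes a submodule insensitive to the others. The product \<open>star\<close> is a parameter because
  both the commutative product and that of the Weyl algebra occur.\<close>

definition submod :: "(('n, 'k) polyXY \<Rightarrow> ('n, 'k) polyXY \<Rightarrow> ('n, 'k) polyXY) \<Rightarrow> nat
    \<Rightarrow> ('n::finite, 'k::field_char_0) pvec set \<Rightarrow> bool" where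
  "submod star t L \<longleftrightarrow> (\<lambda>_. 0) \<in> L \<and> (\<forall>u\<in>L. \<forall>v\<in>L. (\<lambda>j. u j + v j) \<in> L) \<and>
     (\<forall>p. \<forall>v\<in>L. (\<lambda>j. star p (v j)) \<in> L) \<and>
     (\<forall>v\<in>L. \<forall>u. (\<forall>j<t. u j = v j) \<longrightarrow> u \<in> L)"

definition vfilt :: "'n weight \<Rightarrow> (nat \<Rightarrow> int) \<Rightarrow> nat \<Rightarrow> int \<Rightarrow> ('n::finite, 'k::field_char_0) pvec set" where
  "vfilt w q t i = {v. \<forall>j<t. v j \<in> PF w (i - q j)}"

text \<open>The generator with index \<open>j\<close> has degree \<open>q j\<close>.\<close>

definition vhom :: "'n weight \<Rightarrow> (nat \<Rightarrow> int) \<Rightarrow> int \<Rightarrow> ('n, 'k) pvec \<Rightarrow> ('n::finite, 'k::field_char_0) pvec" where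
  "vhom w q i v = (\<lambda>j. hc w (i - q j) (v j))"

definition initial :: "'n weight \<Rightarrow> (nat \<Rightarrow> int) \<Rightarrow> nat
    \<Rightarrow> ('n::finite, 'k::field_char_0) pvec set \<Rightarrow> ('n, 'k) pvec set" where
  "initial w q t L = {v. \<forall>k. \<exists>u\<in>L. u \<in> vfilt w q t k \<and> (\<forall>j<t. vhom w q k u j = vhom w q k v j)}"

text \<open>The annihilator of the quotient of the free module \<open>V\<close> by \<open>J\<close>.\<close>

definition colon :: "('n::finite, 'k::field_char_0) pvec set \<Rightarrow> ('n, 'k) polyXY set" where
  "colon J = {p. \<forall>v. (\<lambda>j. p * v j) \<in> J}"

lemma submod_zero: "submod star t L \<Longrightarrow> (\<lambda>_. 0) \<in> L"
  by (simp add: submod_def)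

lemma submod_add: "submod star t L \<Longrightarrow> u \<in> L \<Longrightarrow> v \<in> L \<Longrightarrow> (\<lambda>j. u j + v j) \<in> L"
  by (simp add: submod_def)

lemma submod_mult: "submod star t L \<Longrightarrow> v \<in> L \<Longrightarrow> (\<lambda>j. star p (v j)) \<in> L"
  by (simp add: submod_def)

lemma submod_cong: "submod star t L \<Longrightarrow> v \<in> L \<Longrightarrow> (\<And>j. j < t \<Longrightarrow> u j = v j) \<Longrightarrow> u \<in> L"
  by (simp add: submod_def)

lemma submod_sum:
  "submod star t L \<Longrightarrow> (\<And>x. x \<in> X \<Longrightarrow> f x \<in> L) \<Longrightarrow> (\<lambda>j. \<Sum>x\<in>X. f x j) \<in> L"
  by (induction X rule: infinite_finite_induct) (auto simp: submod_def)

lemma submod_diff: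
  assumes "submod (*) t J" "u \<in> J" "v \<in> J"
  shows "(\<lambda>j. u j - v j) \<in> J"
proof -
  have "(\<lambda>j. u j + (- 1) * v j) \<in> J"
    by (rule submod_add[OF assms(1,2) submod_mult[OF assms(1,3)]])
  then show ?thesis by simp
qed

lemma is_ideal_colon:
  assumes "submod (*) t J"
  shows "is_ideal (colon J)"
  using assms unfolding is_ideal_def colon_def submod_def
  by (auto simp: distrib_right mult.assoc)

lemma mem_colonI:
  assumes J: "submod (*) t J" and "\<And>k. k < t \<Longrightarrow> (\<lambda>j. if j = k then p else 0) \<in> J"
  shows "p \<in> colon J"
  unfolding colon_def
proof (intro CollectI allI)
  fix v :: "('a, 'b) pvec"
  have "(\<lambda>j. \<Sum>k<t. v k * (if j = k then p else 0)) \<in> J"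
  proof (rule submod_sum[OF J, where X = "{..<t}" and f = "\<lambda>k j. v k * (if j = k then p else 0)"])
    fix k assume "k \<in> {..<t}"
    then show "(\<lambda>j. v k * (if j = k then p else 0)) \<in> J"
      by (intro submod_mult[OF J] assms(2)) simp
  qed
  then show "(\<lambda>j. p * v j) \<in> J"
    by (rule submod_cong[OF J]) (simp add: if_distrib mult.commute cong: if_cong)
qed

lemma vhom_add: "vhom w q i (\<lambda>j. u j + v j) = (\<lambda>j. vhom w q i u j + vhom w q i v j)"
  by (simp add: vhom_def hc_add)

lemma vhom_sum: "vhom w q i (\<lambda>j. \<Sum>x\<in>X. f x j) = (\<lambda>j. \<Sum>x\<in>X. vhom w q i (f x) j)"
  by (simp add: vhom_def hc_sum)

lemma finite_vhom: "finite {i. \<exists>j<t. vhom w q i v j \<noteq> 0}"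
proof -
  have "i \<in> (\<lambda>i. i + q j) ` {i. hc w i (v j) \<noteq> 0}" if "vhom w q i v j \<noteq> 0" for i j
    using that by (intro image_eqI[of _ _ "i - q j"]) (auto simp: vhom_def)
  then have "{i. \<exists>j<t. vhom w q i v j \<noteq> 0} \<subseteq> (\<Union>j<t. (\<lambda>i. i + q j) ` {i. hc w i (v j) \<noteq> 0})"
    by blast
  then show ?thesis by (rule finite_subset) (simp add: finite_hc)
qed

lemma sum_vhom:
  assumes "finite I" "\<And>i j. j < t \<Longrightarrow> vhom w q i v j \<noteq> 0 \<Longrightarrow> i \<in> I" "j < t"
  shows "(\<Sum>i\<in>I. vhom w q i v j) = v j"
proof -
  have "(\<Sum>i\<in>I. vhom w q i v j) = (\<Sum>i\<in>(\<lambda>i. i - q j) ` I. hc w i (v j))"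
    by (subst sum.reindex) (auto simp: inj_on_def vhom_def)
  also have "\<dots> = v j"
  proof (rule sum_hc)
    fix i assume "hc w i (v j) \<noteq> 0"
    then have "i + q j \<in> I" using assms(2)[of j "i + q j"] assms(3) by (simp add: vhom_def)
    then show "i \<in> (\<lambda>i. i - q j) ` I" by (auto simp: image_iff intro!: bexI[of _ "i + q j"])
  qed (use assms in simp)
  finally show ?thesis .
qed

lemma vhom_mult:
  assumes "finite I" "\<And>i. hc w i p \<noteq> 0 \<Longrightarrow> i \<in> I"
  shows "vhom w q k (\<lambda>j. p * v j) j = (\<Sum>i\<in>I. hc w i p * vhom w q (k - i) v j)"
    using hc_mult[of I w p "k - q j" "v j"] assms by (simp add: vhom_def diff_right_commute)

lemma vhom_in_vfilt: "vhom w q k v \<in> vfilt w q t k"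
  by (simp add: vhom_def vfilt_def hc_PF)

lemma vfilt_add: "u \<in> vfilt w q t k \<Longrightarrow> v \<in> vfilt w q t k \<Longrightarrow> (\<lambda>j. u j + v j) \<in> vfilt w q t k"
  by (simp add: vfilt_def PF_add)

lemma vfilt_diff: "u \<in> vfilt w q t k \<Longrightarrow> v \<in> vfilt w q t k \<Longrightarrow> (\<lambda>j. u j - v j) \<in> vfilt w q t k"
  by (simp add: vfilt_def PF_diff)

lemma vfilt_sum: "(\<And>x. x \<in> X \<Longrightarrow> f x \<in> vfilt w q t k) \<Longrightarrow> (\<lambda>j. \<Sum>x\<in>X. f x j) \<in> vfilt w q t k"
  by (simp add: vfilt_def PF_sum)

lemma vfilt_mono: "u \<in> vfilt w q t k \<Longrightarrow> k \<le> l \<Longrightarrow> u \<in> vfilt w q t l"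
  by (auto simp: vfilt_def elim!: PF_mono)

lemma vfilt_mult: "p \<in> PF w i \<Longrightarrow> u \<in> vfilt w q t k \<Longrightarrow> (\<lambda>j. p * u j) \<in> vfilt w q t (i + k)"
  unfolding vfilt_def using PF_mult[of p w i "u j" "k - q j" for j] by (simp add: algebra_simps)

text \<open>The initial module is closed under the ordinary product as soon as \<open>L\<close> is closed under some
  product with the same leading forms. This applies to the product of polynomials and to that of the
  Weyl algebra, for which \<open>L\<close> itself need not be closed under the ordinary product.\<close>

lemma submod_initial:
  assumes add: "(\<lambda>_. 0) \<in> L" "\<And>u v. u \<in> L \<Longrightarrow> v \<in> L \<Longrightarrow> (\<lambda>j. u j + v j) \<in> L"
    and mult: "\<And>p i k v. v \<in> L \<Longrightarrow> v \<in> vfilt w q t k \<Longrightarrow> hc w i p \<noteq> 0 \<Longrightarrow>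
      \<exists>u\<in>L. \<forall>j<t. u j - hc w i p * v j \<in> PF w (k + i - q j - 1)"
  shows "submod (*) t (initial w q t L)"
  unfolding submod_def
proof (intro conjI ballI allI impI)
  show "(\<lambda>_. 0) \<in> initial w q t L"
    using add(1) by (auto simp: initial_def vhom_def vfilt_def intro!: bexI[of _ "\<lambda>_. 0"])
next
  fix u v assume uv: "u \<in> initial w q t L" "v \<in> initial w q t L"
  show "(\<lambda>j. u j + v j) \<in> initial w q t L"
    unfolding initial_def
  proof (intro CollectI allI)
    fix k
    from uv obtain u' v' where "u' \<in> L" "v' \<in> L" "u' \<in> vfilt w q t k" "v' \<in> vfilt w q t k"
      "\<forall>j<t. vhom w q k u' j = vhom w q k u j" "\<forall>j<t. vhom w q k v' j = vhom w q k v j"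
      unfolding initial_def by blast
    then show "\<exists>z\<in>L. z \<in> vfilt w q t k \<and> (\<forall>j<t. vhom w q k z j = vhom w q k (\<lambda>j. u j + v j) j)"
      by (intro bexI[of _ "\<lambda>j. u' j + v' j"] add(2)) (auto simp: vhom_add vfilt_add)
  qed
next
  fix p v assume v: "v \<in> initial w q t L"
  show "(\<lambda>j. p * v j) \<in> initial w q t L"
    unfolding initial_def
  proof (intro CollectI allI)
    fix k
    let ?I = "{i. hc w i p \<noteq> 0}"
    have "\<exists>z\<in>L. z \<in> vfilt w q t k \<and> (\<forall>j<t. vhom w q k z j = hc w i p * vhom w q (k - i) v j)"
      if "i \<in> ?I" for i
    proof -
      from v obtain u where u: "u \<in> L" "u \<in> vfilt w q t (k - i)"
        "\<forall>j<t. vhom w q (k - i) u j = vhom w q (k - i) v j"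
        unfolding initial_def by blast
      have "\<exists>z\<in>L. \<forall>j<t. z j - hc w i p * u j \<in> PF w (k - i + i - q j - 1)"
        using that by (intro mult[OF u(1,2)]) simp
      then obtain z where z: "z \<in> L" "\<And>j. j < t \<Longrightarrow> z j - hc w i p * u j \<in> PF w (k - q j - 1)"
        by auto
      have "z j \<in> PF w (k - q j)" if "j < t" for j
      proof -
        have "hc w i p * u j \<in> PF w (k - q j)"
          using vfilt_mult[OF hc_PF[of w i p] u(2)] that by (simp add: vfilt_def)
        then show ?thesis using PF_cong[OF PF_mono[OF z(2)[OF that], of "k - q j"]] by simp
      qed
      moreover have "vhom w q k z j = hc w i p * vhom w q (k - i) v j" if "j < t" for j
      proof -
        have "hc w (k - q j) (z j) = hc w (k - q j) (hc w i p * u j)"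
          using hc_eq_0[OF z(2)[OF that], of "k - q j"] by (simp add: hc_diff)
        also have "\<dots> = hc w i p * hc w (k - q j - i) (u j)" by (rule hc_mult_hom)
        finally show ?thesis using u(3) that by (simp add: vhom_def algebra_simps)
      qed
      ultimately show ?thesis using z(1) by (auto simp: vfilt_def)
    qed
    then obtain z where z: "\<And>i. i \<in> ?I \<Longrightarrow> z i \<in> L" "\<And>i. i \<in> ?I \<Longrightarrow> z i \<in> vfilt w q t k"
      "\<And>i j. i \<in> ?I \<Longrightarrow> j < t \<Longrightarrow> vhom w q k (z i) j = hc w i p * vhom w q (k - i) v j"
      by metis
    have sumL: "(\<lambda>j. \<Sum>i\<in>A. z i j) \<in> L" if "A \<subseteq> ?I" for A
      using finite_subset[OF that finite_hc] that
      by (induction A rule: finite_induct) (auto intro!: add z(1))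
    have "vhom w q k (\<lambda>j. \<Sum>i\<in>?I. z i j) j = vhom w q k (\<lambda>j. p * v j) j" if "j < t" for j
      by (simp add: vhom_sum vhom_mult[OF finite_hc] z(3) that)
    then show "\<exists>u\<in>L. u \<in> vfilt w q t k \<and> (\<forall>j<t. vhom w q k u j = vhom w q k (\<lambda>j. p * v j) j)"
      using sumL[OF subset_refl] z(2) by (intro bexI[of _ "\<lambda>j. \<Sum>i\<in>?I. z i j"]) (auto intro: vfilt_sum)
  qed
next
  fix v u assume "v \<in> initial w q t L" "\<forall>j<t. u j = v j"
  then show "u \<in> initial w q t L" by (auto simp: initial_def vhom_def)
qed

lemma submod_initial_comm:
  assumes "submod (*) t J"
  shows "submod (*) t (initial w q t J)"
proof (rule submod_initial)
  fix p i k v assume "v \<in> J"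
  then have "(\<lambda>j. hc w i p * v j) \<in> J" by (rule submod_mult[OF assms])
  then show "\<exists>u\<in>J. \<forall>j<t. u j - hc w i p * v j \<in> PF w (k + i - q j - 1)" by (rule bexI[rotated]) simp
qed (use assms in \<open>auto simp: submod_def\<close>)

lemma vhom_mem:
  assumes D: "submod (*) t D" and "\<And>k. vhom w q k x \<in> D"
  shows "x \<in> D"
proof (rule submod_cong[OF D])
  let ?I = "{i. \<exists>j<t. vhom w q i x j \<noteq> 0}"
  show "(\<lambda>j. \<Sum>i\<in>?I. vhom w q i x j) \<in> D" by (rule submod_sum[OF D assms(2)])
  show "x j = (\<Sum>i\<in>?I. vhom w q i x j)" if "j < t" for j
    by (rule sum_vhom[OF finite_vhom _ that, symmetric]) auto
qed

lemma vhom_mem_initial: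
  assumes "(\<lambda>_. 0) \<in> L" "u \<in> L" "u \<in> vfilt w q t k"
  shows "vhom w q k u \<in> initial w q t L"
  unfolding initial_def
proof (intro CollectI allI)
  fix l
  show "\<exists>z\<in>L. z \<in> vfilt w q t l \<and> (\<forall>j<t. vhom w q l z j = vhom w q l (vhom w q k u) j)"
  proof (cases "l = k")
    case True
    then show ?thesis using assms by (intro bexI[of _ u]) (auto simp: vhom_def hc_hc)
  next
    case False
    then show ?thesis using assms(1)
      by (intro bexI[of _ "\<lambda>_. 0"]) (auto simp: vhom_def hc_hc vfilt_def)
  qed
qed

lemma initial_idem:
  assumes J: "submod (*) t J"
  shows "initial w q t (initial w q t J) = initial w q t J"
proof (intro equalityI subsetI)
  fix v assume v: "v \<in> initial w q t (initial w q t J)"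
  show "v \<in> initial w q t J"
    unfolding initial_def
  proof (intro CollectI allI)
    fix k
    obtain u where u: "u \<in> initial w q t J" "\<forall>j<t. vhom w q k u j = vhom w q k v j"
      using v unfolding initial_def[of _ _ _ "initial w q t J"] by blast
    then obtain u' where "u' \<in> J" "u' \<in> vfilt w q t k" "\<forall>j<t. vhom w q k u' j = vhom w q k u j"
      unfolding initial_def by blast
    then show "\<exists>u\<in>J. u \<in> vfilt w q t k \<and> (\<forall>j<t. vhom w q k u j = vhom w q k v j)"
      using u(2) by (intro bexI[of _ u']) auto
  qed
next
  fix v assume v: "v \<in> initial w q t J"
  show "v \<in> initial w q t (initial w q t J)"
    unfolding initial_def[of _ _ _ "initial w q t J"]
  proof (intro CollectI allI)
    fix k
    obtain u where u: "u \<in> J" "u \<in> vfilt w q t k" "\<forall>j<t. vhom w q k u j = vhom w q k v j"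
      using v unfolding initial_def by blast
    show "\<exists>u\<in>initial w q t J. u \<in> vfilt w q t k \<and> (\<forall>j<t. vhom w q k u j = vhom w q k v j)"
    proof (rule bexI[OF _ vhom_mem_initial[OF submod_zero[OF J] u(1,2)]])
      show "vhom w q k u \<in> vfilt w q t k \<and> (\<forall>j<t. vhom w q k (vhom w q k u) j = vhom w q k v j)"
        using u(3) by (simp add: vhom_in_vfilt) (simp add: vhom_def hc_hc)
    qed
  qed
qed

text \<open>A replacement for the Cayley-Hamilton argument. The rows say that multiplication by
  \<open>p\<^sup>N\<close> on the generators of \<open>V/J\<close> agrees with a matrix of strictly smaller weighted degree; the
  conclusion is that a polynomial with leading term a power of \<open>p\<close> annihilates them. Generators are
  eliminated one at a time, which only changes the power of \<open>p\<close>.\<close>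

lemma weighted_elimination:
  assumes J: "submod (*) t J" and "finite S" and p: "p \<in> PF w d" and "N > 0"
    and A: "\<And>k l. k \<in> S \<Longrightarrow> l \<in> S \<Longrightarrow>
        A k l - (if k = l then p ^ N else 0) \<in> PF w (int N * d - 1 + q k - q l)"
    and rows: "\<And>k. k \<in> S \<Longrightarrow> (\<lambda>j. if j \<in> S then A k j else 0) \<in> J"
  shows "\<exists>M>0. \<exists>f. f - p ^ M \<in> PF w (int M * d - 1) \<and>
     (\<forall>k\<in>S. (\<lambda>j. if j = k then f else 0) \<in> J)"
  using \<open>finite S\<close> \<open>N > 0\<close> A rows
proof (induction S arbitrary: N A rule: finite_induct)
  case empty
  show ?case by (auto intro!: exI[of _ "1::nat"] exI[of _ p])
next
  case (insert i S)
  have pN: "p ^ N \<in> PF w (int N * d)" by (rule PF_power[OF p])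
  have A_in: "A k l \<in> PF w (int N * d + q k - q l)" if "k \<in> insert i S" "l \<in> insert i S" for k l
  proof -
    have "(if k = l then p ^ N else 0) \<in> PF w (int N * d + q k - q l)" using pN by simp
    moreover have "A k l - (if k = l then p ^ N else 0) \<in> PF w (int N * d + q k - q l)"
      using insert.prems(2)[OF that] by (rule PF_mono) simp
    ultimately show ?thesis using PF_cong by blast
  qed
  \<comment> \<open>cross-multiplication clears column \<open>i\<close> and squares the leading term \<open>p\<^sup>N\<close>\<close>
  define A' where "A' k l = A i i * A k l - A k i * A i l" for k l
  have "A' k l - (if k = l then p ^ (2 * N) else 0) \<in> PF w (int (2 * N) * d - 1 + q k - q l)"
    if "k \<in> S" "l \<in> S" for k l
  proof -
    have ne: "k \<noteq> i" "l \<noteq> i" using that insert.hyps by auto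
    let ?D = "if k = l then p ^ N else 0"
    have D: "?D \<in> PF w (int N * d + q k - q l)" using pN by simp
    have "A i i * A k l - p ^ N * ?D \<in> PF w (int N * d + (int N * d + q k - q l) - 1)"
    proof (rule PF_mult_diff)
      show "A i i - p ^ N \<in> PF w (int N * d - 1)" using insert.prems(2)[of i i] by simp
      show "A k l - ?D \<in> PF w (int N * d + q k - q l - 1)"
        using insert.prems(2)[of k l] that by (simp add: algebra_simps)
    qed (use A_in[of i i] D in simp_all)
    moreover have "A k i * A i l \<in> PF w (int N * d + (int N * d + q k - q l) - 1)"
    proof -
      have "A k i * A i l \<in> PF w ((int N * d - 1 + q k - q i) + (int N * d - 1 + q i - q l))"
        using insert.prems(2)[of k i] insert.prems(2)[of i l] that ne by (intro PF_mult) auto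
      then show ?thesis by (rule PF_mono) simp
    qed
    ultimately have "A i i * A k l - p ^ N * ?D - A k i * A i l
        \<in> PF w (int N * d + (int N * d + q k - q l) - 1)" by (rule PF_diff)
    moreover have "A i i * A k l - p ^ N * ?D - A k i * A i l = A' k l - (if k = l then p ^ (2 * N) else 0)"
      by (auto simp: A'_def algebra_simps mult_2_right power_add)
    moreover have "int N * d + (int N * d + q k - q l) - 1 = int (2 * N) * d - 1 + q k - q l"
      by (simp add: algebra_simps)
    ultimately show ?thesis by (simp only:)
  qed
  moreover have "(\<lambda>j. if j \<in> S then A' k j else 0) \<in> J" if "k \<in> S" for k
  proof -
    let ?r = "\<lambda>k j. if j \<in> insert i S then A k j else 0"
    note mult = submod_mult[OF J]
    have "(\<lambda>j. A i i * ?r k j - A k i * ?r i j) \<in> J"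
      using that by (intro submod_diff[OF J] mult insert.prems(3)) auto
    moreover have "(\<lambda>j. A i i * ?r k j - A k i * ?r i j) = (\<lambda>j. if j \<in> S then A' k j else 0)"
      using insert.hyps by (auto simp: A'_def)
    ultimately show ?thesis by simp
  qed
  ultimately have "\<exists>M>0. \<exists>f. f - p ^ M \<in> PF w (int M * d - 1) \<and>
      (\<forall>k\<in>S. (\<lambda>j. if j = k then f else 0) \<in> J)"
    using insert.prems(1) by (intro insert.IH[of "2 * N" A']) simp_all
  then obtain M f where M: "M > 0" and f: "f - p ^ M \<in> PF w (int M * d - 1)"
    and fJ: "\<And>k. k \<in> S \<Longrightarrow> (\<lambda>j. if j = k then f else 0) \<in> J"
    by blast
  \<comment> \<open>row \<open>i\<close> expresses \<open>A i i e\<^sub>i\<close> by the other generators, which \<open>f\<close> annihilates\<close>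
  let ?g = "f * A i i"
  note mult = submod_mult[OF J]
  have "?g - p ^ M * p ^ N \<in> PF w (int M * d + int N * d - 1)"
  proof (rule PF_mult_diff[OF f])
    show "f \<in> PF w (int M * d)"
      using PF_cong[OF PF_mono[OF f]] PF_power[OF p, of M] by simp
  qed (use insert.prems(2)[of i i] pN in simp_all)
  then have "?g - p ^ (M + N) \<in> PF w (int (M + N) * d - 1)"
    by (simp add: power_add algebra_simps)
  moreover have "(\<lambda>j. if j = k then ?g else 0) \<in> J" if k: "k \<in> insert i S" for k
  proof (cases "k = i")
    case False
    then have "k \<in> S" using k by simp
    then have "(\<lambda>j. A i i * (if j = k then f else 0)) \<in> J" by (intro mult fJ)
    moreover have "(\<lambda>j. A i i * (if j = k then f else 0)) = (\<lambda>j. if j = k then ?g else 0)"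
      by (auto simp: mult.commute)
    ultimately show ?thesis by simp
  next
    case True
    let ?r = "\<lambda>j. if j \<in> insert i S then A i j else 0"
    have "(\<lambda>j. f * ?r j - (\<Sum>l\<in>S. A i l * (if j = l then f else 0))) \<in> J"
    proof (rule submod_diff[OF J])
      show "(\<lambda>j. \<Sum>l\<in>S. A i l * (if j = l then f else 0)) \<in> J"
        by (rule submod_sum[OF J, where X = S and f = "\<lambda>l j. A i l * (if j = l then f else 0)"])
          (intro mult fJ)
    qed (intro mult insert.prems(3), simp)
    moreover have "(\<lambda>j. f * ?r j - (\<Sum>l\<in>S. A i l * (if j = l then f else 0))) = (\<lambda>j. if j = k then ?g else 0)"
      using insert.hyps True by (auto simp: fun_eq_iff if_distrib mult.commute cong: if_cong)
    ultimately show ?thesis by simp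
  qed
  ultimately show ?case using M by (intro exI[of _ "M + N"]) auto
qed

text \<open>The annihilator of the associated graded module of \<open>V/J\<close> has the same radical as the initial
  ideal of the annihilator of \<open>V/J\<close>. The inclusion from left to right is formal. Conversely, if a
  homogeneous \<open>p\<close> annihilates the graded module then \<open>p e\<^sub>k\<close> is congruent modulo \<open>J\<close> to a vector
  of smaller degree for every \<open>k\<close>, and \<open>weighted_elimination\<close> produces an annihilator of \<open>V/J\<close>
  with leading form a power of \<open>p\<close>. In particular the radical on the right is determined by that of
  \<open>colon J\<close>, whatever the shifts \<open>q\<close>.\<close>

lemma rad_initial_ideal_colon:
  assumes J: "submod (*) t J"
  shows "rad (initial_ideal w (colon J)) = rad (colon (initial w q t J))"
proof
  have I: "is_ideal (colon J)" and I': "is_ideal (colon (initial w q t J))"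
    using is_ideal_colon[OF J] is_ideal_colon[OF submod_initial_comm[OF J]] by auto
  show "rad (initial_ideal w (colon J)) \<subseteq> rad (colon (initial w q t J))"
  proof (rule rad_mono, rule subsetI)
    fix p assume p: "p \<in> initial_ideal w (colon J)"
    have "(\<lambda>j. p * v j) \<in> initial w q t J" for v
      unfolding initial_def
    proof (intro CollectI allI)
      fix k
      from p have "\<forall>i. \<exists>u\<in>colon J. u \<in> PF w i \<and> hc w i u = hc w i p"
        unfolding initial_ideal_def by blast
      then obtain u where u: "\<And>i. u i \<in> colon J" "\<And>i. u i \<in> PF w i" "\<And>i. hc w i (u i) = hc w i p"
        by metis
      let ?I = "{i. hc w i p \<noteq> 0}"
      let ?z = "\<lambda>j. \<Sum>i\<in>?I. u i * vhom w q (k - i) v j"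
      have "?z \<in> J"
        using u(1) by (intro submod_sum[OF J, where f = "\<lambda>i j. u i * vhom w q (k - i) v j"]) (auto simp: colon_def)
      moreover have "?z \<in> vfilt w q t k"
      proof (rule vfilt_sum[where f = "\<lambda>i j. u i * vhom w q (k - i) v j"])
        fix i show "(\<lambda>j. u i * vhom w q (k - i) v j) \<in> vfilt w q t k"
          using vfilt_mult[OF u(2)[of i] vhom_in_vfilt[of w q "k - i" v t]] by simp
      qed
      moreover have "vhom w q k ?z j = vhom w q k (\<lambda>j. p * v j) j" for j
      proof -
        have "hc w (k - q j) (u i * hc w (k - i - q j) (v j)) = hc w i p * hc w (k - i - q j) (v j)" for i
          using hc_mult_top[OF u(2)[of i] hc_PF[of w "k - i - q j" "v j"]] by (simp add: u(3) hc_hc)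
        then have "vhom w q k ?z j = (\<Sum>i\<in>?I. hc w i p * vhom w q (k - i) v j)"
          by (simp only: vhom_def hc_sum)
        then show ?thesis by (simp only: vhom_mult[OF finite_hc] mem_Collect_eq)
      qed
      ultimately show "\<exists>u\<in>J. u \<in> vfilt w q t k \<and> (\<forall>j<t. vhom w q k u j = vhom w q k (\<lambda>j. p * v j) j)"
        by blast
    qed
    then show "p \<in> colon (initial w q t J)" by (simp add: colon_def)
  qed
  show "rad (colon (initial w q t J)) \<subseteq> rad (initial_ideal w (colon J))"
  proof (rule rad_subsetI)
    fix p assume p: "p \<in> colon (initial w q t J)"
    have "p \<in> rad (initial_ideal w (colon J))"
    proof (rule mem_rad_if_hc[OF is_ideal_initial_ideal[OF I]])
      fix d
      have "\<exists>a\<in>J. a \<in> vfilt w q t (d + q k) \<and>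
          (\<forall>j<t. hc w (d + q k - q j) (a j) = (if j = k then hc w d p else 0))" for k
      proof -
        have "(\<lambda>j. p * (if j = k then 1 else 0)) \<in> initial w q t J"
          using p by (auto simp: colon_def)
        then obtain a where "a \<in> J" "a \<in> vfilt w q t (d + q k)"
          "\<forall>j<t. vhom w q (d + q k) a j = vhom w q (d + q k) (\<lambda>j. p * (if j = k then 1 else 0)) j"
          unfolding initial_def by blast
        then show ?thesis by (intro bexI[of _ a]) (auto simp: vhom_def)
      qed
      then obtain a where a: "\<And>k. a k \<in> J" "\<And>k. a k \<in> vfilt w q t (d + q k)"
        "\<And>k j. j < t \<Longrightarrow> hc w (d + q k - q j) (a k j) = (if j = k then hc w d p else 0)"
        by metis
      have "\<exists>M>0. \<exists>f. f - hc w d p ^ M \<in> PF w (int M * d - 1) \<and>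
          (\<forall>k\<in>{..<t}. (\<lambda>j. if j = k then f else 0) \<in> J)"
      proof (rule weighted_elimination[where N = 1 and A = a and q = q and S = "{..<t}"])
        fix k l assume "k \<in> {..<t}" "l \<in> {..<t}"
        then show "a k l - (if k = l then hc w d p ^ 1 else 0) \<in> PF w (int 1 * d - 1 + q k - q l)"
          using diff_hc[of "a k l" w "d + q k - q l"] a(2)[of k] a(3)[of l k]
          by (auto simp: vfilt_def algebra_simps split: if_splits)
      next
        fix k assume "k \<in> {..<t}"
        show "(\<lambda>j. if j \<in> {..<t} then a k j else 0) \<in> J"
          by (rule submod_cong[OF J a(1)[of k]]) simp
      qed (use J hc_PF in auto)
      then obtain M f where M: "M > 0" "f - hc w d p ^ M \<in> PF w (int M * d - 1)"
        and "\<And>k. k < t \<Longrightarrow> (\<lambda>j. if j = k then f else 0) \<in> J" by auto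
      then have f: "f \<in> colon J" using mem_colonI[OF J] by blast
      have fd: "f \<in> PF w (int M * d)"
        using PF_cong[OF PF_mono[OF M(2)]] PF_power[OF hc_PF[of w d p], of M] by simp
      have "hc w (int M * d) f = hc w (int M * d) (hc w d p ^ M)"
        using hc_eq_0[OF M(2), of "int M * d"] by (simp add: hc_diff)
      also have "\<dots> = hc w d p ^ M"
        using hc_power_top[OF hc_PF[of w d p], of M] by (simp add: hc_hc)
      finally have "hc w d p ^ M \<in> initial_ideal w (colon J)"
        using hc_mem_initial_ideal[OF f I fd] by simp
      then show "hc w d p \<in> rad (initial_ideal w (colon J))" using M(1) by (auto simp: rad_def)
    qed
    then show "\<exists>m>0. p ^ m \<in> initial_ideal w (colon J)" by (simp add: rad_def)
  qed
qed

section \<open>The product of the Weyl algebra in terms of polynomials\<close>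

text \<open>The product of the Weyl algebra, transported to polynomials along the normally ordered basis.\<close>

definition wmul :: "('n, 'k) polyXY \<Rightarrow> ('n, 'k) polyXY \<Rightarrow> ('n::finite, 'k::field_char_0) polyXY" where
  "wmul p q = the_inv weyl_of_poly (weyl_of_poly p \<circ> weyl_of_poly q)"

text \<open>The exponents that arise from \<open>\<gamma>\<close> by cancelling factors \<open>X\<^sub>i Y\<^sub>i\<close>, at least one.\<close>

definition lower :: "('n::finite + 'n \<Rightarrow>\<^sub>0 nat) \<Rightarrow> ('n + 'n \<Rightarrow>\<^sub>0 nat) set" where
  "lower \<gamma> = {\<rho>. \<exists>\<delta>. \<delta> \<noteq> 0 \<and>
     (\<forall>i. lookup \<delta> (Inl i) = lookup \<delta> (Inr i)) \<and> \<rho> + \<delta> = \<gamma>}"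

lemma weyl_monomial_0: "weyl_monomial 0 = (id :: ('n::finite, 'k::field_char_0) diffop)"
  by (rule additive_eqI)
     (auto simp: weyl_ops_add [OF weyl_monomial_in] weyl_monomial_single
       trunc_ffact_def lpart_def rpart_def)

lemma weyl_of_poly_wmul: "weyl_of_poly (wmul p q) = weyl_of_poly p \<circ> weyl_of_poly q"
  unfolding wmul_def
  by (rule f_the_inv_into_f[OF inj_weyl_of_poly])
     (rule weyl_ops_range[OF weyl_ops.comp[OF weyl_of_poly_in weyl_of_poly_in]])

lemma wmul_eqI: "weyl_of_poly r = weyl_of_poly p \<circ> weyl_of_poly q \<Longrightarrow> wmul p q = r"
  using weyl_of_poly_wmul[of p q] inj_weyl_of_poly by (metis injD)

lemma wmul_add_left: "wmul (p + p') q = wmul p q + wmul p' q"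
  by (rule wmul_eqI) (simp add: fun_eq_iff weyl_of_poly_add weyl_of_poly_wmul)

lemma wmul_add_right: "wmul p (q + q') = wmul p q + wmul p q'"
  by (rule wmul_eqI)
     (simp add: fun_eq_iff weyl_of_poly_add weyl_of_poly_wmul weyl_ops_add[OF weyl_of_poly_in])

lemma wmul_0 [simp]: "wmul 0 q = 0" "wmul p 0 = 0"
  using wmul_add_left[of 0 0 q] wmul_add_right[of p 0 0] by simp_all

lemma wmul_sum_left: "wmul (sum f X) q = (\<Sum>x\<in>X. wmul (f x) q)"
  by (induction X rule: infinite_finite_induct) (auto simp: wmul_add_left)

lemma wmul_sum_right: "wmul p (sum f X) = (\<Sum>x\<in>X. wmul p (f x))"
  by (induction X rule: infinite_finite_induct) (auto simp: wmul_add_right)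

lemma weyl_ops_scalar: "w \<in> weyl_ops \<Longrightarrow> w (scalar c f) = scalar c (w f)"
proof (induction arbitrary: f rule: weyl_ops.induct)
  case (pd i)
  have "pd i \<circ> scalar c = scalar c \<circ> (pd i :: ('a, 'b) diffop)"
    by (rule additive_eqI) (simp_all add: scalar_add pd_add pd_single scalar_single mult_ac)
  then show ?case by (metis comp_apply)
qed (simp_all add: scalar_def xi_def mult.left_commute distrib_left)

lemma weyl_of_poly_single_mult:
  "weyl_of_poly (single 0 c * p) f = scalar c (weyl_of_poly p f)"
proof -
  have lk: "lookup (single 0 c * p) \<alpha> = c * lookup p \<alpha>" for \<alpha>
    by (simp add: Poly_Mapping.map.rep_eq when_def flip: mult_map_scale_conv_mult)
  have ss: "scalar (c * d) g = scalar c (scalar d g)" for d and g :: "('a, 'b) polyX"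
    by (simp add: scalar_def mult_single flip: mult.assoc)
  have sum: "scalar c (sum h A) = (\<Sum>a\<in>A. scalar c (h a))" for h and A :: "('a + 'a \<Rightarrow>\<^sub>0 nat) set"
    by (simp add: scalar_def sum_distrib_left)
  have "keys (single 0 c * p) \<subseteq> keys p"
    by (auto simp: in_keys_iff lk)
  then show ?thesis
    by (simp add: weyl_of_poly_superset[where A = "keys p"] lk ss sum)
qed

lemma wmul_single:
  "wmul (single \<alpha> c) (single \<beta> d) =
   single 0 (c * d) * wmul (single \<alpha> 1) (single \<beta> 1)"
proof (rule wmul_eqI)
  have 1: "scalar 1 f = f" for f :: "('a, 'b) polyX" by (simp add: scalar_def)
  have ss: "scalar (c * d) g = scalar c (scalar d g)" for g :: "('a, 'b) polyX"
    by (simp add: scalar_def mult_single flip: mult.assoc)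
  show "weyl_of_poly (single 0 (c * d) *
      wmul (single \<alpha> 1) (single \<beta> 1)) =
    weyl_of_poly (single \<alpha> c) \<circ> (weyl_of_poly (single \<beta> d) :: ('a, 'b) diffop)"
    by (simp add: fun_eq_iff weyl_of_poly_single_mult weyl_of_poly_wmul weyl_of_poly_single
        weyl_ops_scalar[OF weyl_monomial_in] 1 ss)
qed

lemma xi_weyl_of_poly:
  "xi i \<circ> weyl_of_poly p = weyl_of_poly (single (single (Inl i) 1) 1 * p)"
proof -
  have *: "xi i \<circ> weyl_of_poly (sum f A) = weyl_of_poly (single (single (Inl i) 1) 1 * sum f A)"
    if f: "\<And>\<alpha>. f \<alpha> = single \<alpha> (lookup p \<alpha>)" for f A
  proof (induction A rule: infinite_finite_induct)
    case (insert \<alpha> A)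
    have "xi i (weyl_of_poly (f \<alpha>) g) = weyl_of_poly (single (single (Inl i) 1) 1 * f \<alpha>) g" for g
      using fun_cong[OF xi_weyl_monomial[of i \<alpha>], of g]
      by (simp add: f mult_single weyl_of_poly_single weyl_ops_scalar[OF weyl_ops.xi] add.commute)
    then show ?case
      using insert by (simp add: fun_eq_iff weyl_of_poly_add xi_add distrib_left)
  qed (simp_all add: fun_eq_iff weyl_of_poly_def xi_def)
  show ?thesis
    using *[of "\<lambda>\<alpha>. single \<alpha> (lookup p \<alpha>)" "keys p"]
    by (simp flip: poly_eq_sum_single)
qed

text \<open>The second summand is the derivative with respect to \<open>X\<^sub>i\<close>, by the Leibniz rule.\<close>

lemma pd_weyl_of_poly:
  "pd i \<circ> weyl_of_poly p = weyl_of_poly (single (single (Inr i) 1) 1 * p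
     + (\<Sum>\<alpha>\<in>keys p. single (\<alpha> - single (Inl i) 1)
          (of_nat (lookup \<alpha> (Inl i)) * lookup p \<alpha>)))"
proof -
  let ?D = "\<lambda>\<alpha>. single (\<alpha> - single (Inl i) 1)
          (of_nat (lookup \<alpha> (Inl i)) * lookup p \<alpha>)"
  have *: "pd i \<circ> weyl_of_poly (sum f A) =
      weyl_of_poly (single (single (Inr i) 1) 1 * sum f A + (\<Sum>\<alpha>\<in>A. ?D \<alpha>))"
    if f: "\<And>\<alpha>. f \<alpha> = single \<alpha> (lookup p \<alpha>)" for f A
  proof (induction A rule: infinite_finite_induct)
    case (insert \<alpha> A)
    have ss: "scalar (c * d) g = scalar c (scalar d g)" for c d :: 'b and g :: "('a, 'b) polyX"
      by (simp add: scalar_def mult_single flip: mult.assoc)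
    have "pd i (weyl_of_poly (f \<alpha>) g) =
        weyl_of_poly (single (single (Inr i) 1) 1 * f \<alpha>) g + weyl_of_poly (?D \<alpha>) g" for g
      using fun_cong[OF pd_weyl_monomial[of i \<alpha>], of g]
      by (simp add: f mult_single weyl_of_poly_single weyl_ops_scalar[OF weyl_ops.pd] scalar_add
          add.commute mult.commute[of "of_nat _"] ss)
    then show ?case
      using insert by (simp add: fun_eq_iff weyl_of_poly_add pd_add distrib_left add_ac)
  qed (simp_all add: fun_eq_iff weyl_of_poly_def pd_def)
  show ?thesis
    using *[of "\<lambda>\<alpha>. single \<alpha> (lookup p \<alpha>)" "keys p"]
    by (simp flip: poly_eq_sum_single)
qed

lemma lowerI: 
  assumes "\<rho> = \<gamma> \<or> \<rho> \<in> lower \<gamma>" "\<rho>' + \<epsilon> = \<rho> + \<eta>" "\<epsilon> \<noteq> 0"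
    "\<And>i. lookup \<epsilon> (Inl i) = lookup \<epsilon> (Inr i)"
  shows "\<rho>' \<in> lower (\<gamma> + \<eta>)"
proof -
  obtain \<delta> where d: "\<And>i. lookup \<delta> (Inl i) = lookup \<delta> (Inr i)" "\<rho> + \<delta> = \<gamma>"
  proof (cases "\<rho> = \<gamma>")
    case True
    then show ?thesis using that[of 0] by simp
  next
    case False
    then show ?thesis using assms(1) that unfolding lower_def by blast
  qed
  obtain k where "lookup \<epsilon> k \<noteq> 0" 
    using assms(3) by (auto simp: poly_mapping_eq_iff fun_eq_iff)
  then have "lookup (\<delta> + \<epsilon>) k \<noteq> 0" by (simp add: lookup_add)
  then have "\<delta> + \<epsilon> \<noteq> 0" by auto
  moreover have "\<rho>' + (\<delta> + \<epsilon>) = \<gamma> + \<eta>" 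
    using assms(2) d(2) by (metis add.assoc add.commute)
  ultimately show ?thesis using d(1) assms(4) unfolding lower_def by (auto simp: lookup_add)
qed

lemma lower_add:
  assumes "\<rho> \<in> lower \<gamma>"
  shows "\<rho> + \<eta> \<in> lower (\<gamma> + \<eta>)"
proof -
  obtain \<delta> where "\<delta> \<noteq> 0" "\<And>i. lookup \<delta> (Inl i) = lookup \<delta> (Inr i)" "\<rho> + \<delta> = \<gamma>"
    using assms unfolding lower_def by blast
  moreover from this have "\<rho> + \<eta> + \<delta> = \<gamma> + \<eta>" by (metis add.assoc add.commute)
  ultimately show ?thesis unfolding lower_def by blast
qed

lemma keys_single_mult:
  "keys (single \<alpha> c * p) \<subseteq> (\<lambda>\<beta>. \<beta> + \<alpha>) ` keys p"
  for p :: "('n::finite, 'k::field_char_0) polyXY"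
proof
  fix \<rho> assume "\<rho> \<in> keys (single \<alpha> c * p)"
  then obtain a b where "\<rho> = a + b" "a \<in> keys (single \<alpha> c)" "b \<in> keys p"
    using keys_mult by blast
  moreover from this(2) have "a = \<alpha>" by (simp split: if_splits)
  ultimately show "\<rho> \<in> (\<lambda>\<beta>. \<beta> + \<alpha>) ` keys p" by (simp add: add.commute)
qed

text \<open>Multiplying by \<open>\<xi>\<^sub>i\<close> from the left creates no lower terms, and each application of
  \<open>\<partial>\<^sub>i \<xi>\<^sub>i = \<xi>\<^sub>i \<partial>\<^sub>i + 1\<close> removes one \<open>X\<^sub>i\<close> and one \<open>Y\<^sub>i\<close> simultaneously, so that the
  exponents of the correction differ from \<open>\<alpha> + \<beta>\<close> by a nonzero symmetric vector. The induction peels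
  off the factors of \<open>\<xi>\<^sup>\<alpha>\<close> on the left first, and a factor \<open>\<partial>\<^sub>i\<close> only once no \<open>\<xi>\<close> is left, when it
  is the leftmost factor of the monomial.\<close>

lemma wmul_monomial:
  "\<exists>r. wmul (single \<alpha> 1) (single \<beta> 1) =
      single (\<alpha> + \<beta>) (1 :: 'k::field_char_0) + r \<and> keys r \<subseteq> lower (\<alpha> + \<beta>)"
proof -
  have "\<exists>r. weyl_monomial \<alpha> \<circ> weyl_monomial \<beta> =
      (weyl_of_poly (single (\<alpha> + \<beta>) 1 + r) :: ('a, 'k) diffop) \<and>
      keys r \<subseteq> lower (\<alpha> + \<beta>)"
  proof (induction "\<Sum>k\<in>UNIV. lookup \<alpha> k" arbitrary: \<alpha> rule: less_induct)
    case less
    have dec: "(\<Sum>k\<in>UNIV. lookup (\<alpha> - single k0 1) k) <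
        (\<Sum>k\<in>UNIV. lookup \<alpha> k)" "\<alpha> = \<alpha> - single k0 1 + single k0 1"
      if "lookup \<alpha> k0 \<noteq> 0" for k0
    proof -
      show "(\<Sum>k\<in>UNIV. lookup (\<alpha> - single k0 1) k) <
        (\<Sum>k\<in>UNIV. lookup \<alpha> k)"
        using that by (intro sum_strict_mono_ex1)
          (auto simp: lookup_minus lookup_single when_def intro!: bexI[of _ k0])
      show "\<alpha> = \<alpha> - single k0 1 + single k0 1"
        using that by (intro poly_mapping_eqI) (auto simp: lookup_minus lookup_add lookup_single when_def)
    qed
    show ?case
    proof (cases "\<exists>i. lookup \<alpha> (Inl i) \<noteq> 0")
      case True
      then obtain i where i: "lookup \<alpha> (Inl i) \<noteq> 0" by blast
      let ?e = "single (Inl i) 1 :: 'a + 'a \<Rightarrow>\<^sub>0 nat"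
      define \<alpha>' where "\<alpha>' = \<alpha> - ?e"
      have \<alpha>: "\<alpha> = \<alpha>' + ?e" using dec(2)[OF i] by (simp add: \<alpha>'_def)
      obtain r where r: "weyl_monomial \<alpha>' \<circ> weyl_monomial \<beta> =
          (weyl_of_poly (single (\<alpha>' + \<beta>) 1 + r) :: ('a, 'k) diffop)"
        "keys r \<subseteq> lower (\<alpha>' + \<beta>)"
        using less[OF dec(1)[OF i]] unfolding \<alpha>'_def by blast
      have "weyl_monomial \<alpha> \<circ> weyl_monomial \<beta> = xi i \<circ> (weyl_monomial \<alpha>' \<circ> weyl_monomial \<beta> :: ('a, 'k) diffop)"
        unfolding \<alpha> xi_weyl_monomial[symmetric] by (simp add: comp_assoc)
      also have "\<dots> = weyl_of_poly (single (\<alpha> + \<beta>) 1 + single ?e 1 * r)"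
        unfolding r(1) xi_weyl_of_poly by (simp add: distrib_left mult_single \<alpha> add_ac)
      moreover have "keys (single ?e 1 * r) \<subseteq> lower (\<alpha> + \<beta>)"
      proof
        fix \<rho> assume "\<rho> \<in> keys (single ?e 1 * r)"
        then obtain \<rho>' where "\<rho>' \<in> keys r" "\<rho> = \<rho>' + ?e" using keys_single_mult by blast
        then show "\<rho> \<in> lower (\<alpha> + \<beta>)" 
          using lower_add[of \<rho>' "\<alpha>' + \<beta>" ?e] r(2) by (auto simp: \<alpha> add_ac)
      qed
      ultimately show ?thesis by auto
    next
      case False
      show ?thesis
      proof (cases "\<alpha> = 0")
        case True
        have "weyl_monomial \<alpha> \<circ> weyl_monomial \<beta> =
          (weyl_of_poly (single (\<alpha> + \<beta>) 1 + 0) :: ('a, 'k) diffop)"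
          using True by (auto simp: fun_eq_iff weyl_of_poly_single scalar_def weyl_monomial_0)
        then show ?thesis by (intro exI[of _ 0]) simp
      next
        case n0: False
        then obtain k where "lookup \<alpha> k \<noteq> 0" by (auto simp: poly_mapping_eq_iff fun_eq_iff)
        then obtain i where i: "lookup \<alpha> (Inr i) \<noteq> 0" using False by (cases k) auto
        let ?e = "single (Inr i) 1 :: 'a + 'a \<Rightarrow>\<^sub>0 nat"
        let ?f = "single (Inl i) 1 :: 'a + 'a \<Rightarrow>\<^sub>0 nat"
        define \<alpha>' where "\<alpha>' = \<alpha> - ?e"
        have \<alpha>: "\<alpha> = \<alpha>' + ?e" using dec(2)[OF i] by (simp add: \<alpha>'_def)
        obtain r where r: "weyl_monomial \<alpha>' \<circ> weyl_monomial \<beta> =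
            (weyl_of_poly (single (\<alpha>' + \<beta>) 1 + r) :: ('a, 'k) diffop)"
          "keys r \<subseteq> lower (\<alpha>' + \<beta>)"
          using less[OF dec(1)[OF i]] unfolding \<alpha>'_def by blast
        have "weyl_monomial \<alpha> = pd i \<circ> (weyl_monomial \<alpha>' :: ('a, 'k) diffop)"
          unfolding pd_weyl_monomial \<alpha>[symmetric]
          using False by (auto simp: \<alpha>'_def lookup_minus scalar_def fun_eq_iff)
        then have "weyl_monomial \<alpha> \<circ> weyl_monomial \<beta> = pd i \<circ> (weyl_monomial \<alpha>' \<circ> weyl_monomial \<beta> :: ('a, 'k) diffop)"
          by (simp add: comp_assoc)
        moreover define p where "p = single (\<alpha>' + \<beta>) (1::'k) + r"
        moreover define s where "s = single ?e 1 * r + (\<Sum>\<alpha>\<in>keys p. 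
            single (\<alpha> - single (Inl i) 1)
              (of_nat (lookup \<alpha> (Inl i)) * lookup p \<alpha>))"
        moreover have "single ?e 1 * p = single (\<alpha> + \<beta>) 1 + single ?e 1 * r"
          by (simp add: p_def distrib_left mult_single \<alpha> add_ac)
        moreover have "weyl_monomial \<alpha>' \<circ> weyl_monomial \<beta> = (weyl_of_poly p :: ('a, 'k) diffop)"
          unfolding r(1) p_def ..
        ultimately have eq: "weyl_monomial \<alpha> \<circ> weyl_monomial \<beta> = 
            (weyl_of_poly (single (\<alpha> + \<beta>) 1 + s) :: ('a, 'k) diffop)"
          by (simp only: pd_weyl_of_poly add.assoc)
        have p_keys: "\<rho> = \<alpha>' + \<beta> \<or> \<rho> \<in> lower (\<alpha>' + \<beta>)" if "\<rho> \<in> keys p" for \<rho>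
          using that keys_add[of "single (\<alpha>' + \<beta>) (1::'k)" r] r(2) by (auto simp: p_def)
        have "keys s \<subseteq> lower (\<alpha> + \<beta>)"
        proof
          fix \<rho> assume "\<rho> \<in> keys s"
          then have "\<rho> \<in> keys (single ?e 1 * r) \<union>
            keys (\<Sum>\<alpha>\<in>keys p. single (\<alpha> - ?f)
              (of_nat (lookup \<alpha> (Inl i)) * lookup p \<alpha>))"
            unfolding s_def by (rule subsetD[OF keys_add])
          then consider "\<rho> \<in> keys (single ?e 1 * r)"
            | "\<rho> \<in> keys (\<Sum>\<alpha>\<in>keys p. single (\<alpha> - ?f)
              (of_nat (lookup \<alpha> (Inl i)) * lookup p \<alpha>))"
            by blast
          then show "\<rho> \<in> lower (\<alpha> + \<beta>)"
          proof cases
            case 1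
            then obtain \<rho>' where "\<rho>' \<in> keys r" "\<rho> = \<rho>' + ?e" using keys_single_mult by blast
            then show "\<rho> \<in> lower (\<alpha> + \<beta>)" 
              using lower_add[of \<rho>' "\<alpha>' + \<beta>" ?e] r(2) by (auto simp: \<alpha> add_ac)
          next
            case 2
            then have "lookup (\<Sum>\<alpha>\<in>keys p. single (\<alpha> - ?f)
              (of_nat (lookup \<alpha> (Inl i)) * lookup p \<alpha>)) \<rho> \<noteq> 0"
              by (simp only: in_keys_iff not_False_eq_True)
            then obtain \<rho>' where \<rho>': "\<rho>' \<in> keys p"
              "lookup (single (\<rho>' - ?f)
              (of_nat (lookup \<rho>' (Inl i)) * lookup p \<rho>')) \<rho> \<noteq> 0"
              unfolding lookup_sum by (rule sum.not_neutral_contains_not_neutral)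
            then have \<rho>: "\<rho> = \<rho>' - ?f" "lookup \<rho>' (Inl i) \<noteq> 0"
              by (auto simp: lookup_single when_def split: if_splits)
            have "\<rho> + (?e + ?f) = \<rho>' + ?e"
              using \<rho> by (intro poly_mapping_eqI) (auto simp: lookup_add lookup_minus lookup_single when_def)
            moreover have "lookup (?e + ?f) (Inl i) \<noteq> 0" by (simp add: lookup_add lookup_single)
            then have "?e + ?f \<noteq> 0" by auto
            moreover have "lookup (?e + ?f) (Inl j) = lookup (?e + ?f) (Inr j)" for j
              by (simp add: lookup_add lookup_single when_def)
            ultimately have "\<rho> \<in> lower (\<alpha>' + \<beta> + ?e)"
              using lowerI[OF p_keys[OF \<rho>'(1)]] by blast
            then show ?thesis by (simp add: \<alpha> add_ac)
          qed
        qed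
        then show ?thesis using eq by blast
      qed
    qed
  qed
  then obtain r where r: "weyl_monomial \<alpha> \<circ> weyl_monomial \<beta> =
      (weyl_of_poly (single (\<alpha> + \<beta>) 1 + r) :: ('a, 'k) diffop)"
      "keys r \<subseteq> lower (\<alpha> + \<beta>)" by blast
  have "wmul (single \<alpha> 1) (single \<beta> 1) = single (\<alpha> + \<beta>) 1 + r"
    by (rule wmul_eqI) (simp add: r(1)[symmetric] fun_eq_iff weyl_of_poly_single scalar_def)
  then show ?thesis using r(2) by blast
qed

text \<open>The correction is lower for every monomial order and for every weight in \<open>Omega\<close>. This is why
  leading monomials and leading forms of Weyl products are the commutative ones.\<close>

lemma keys_wmul_diff:
  "keys (wmul p q - p * q) \<subseteq>
     (\<Union>\<alpha>\<in>keys p. \<Union>\<beta>\<in>keys q. lower (\<alpha> + \<beta>))"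
proof -
  define f where "f \<alpha> = single \<alpha> (lookup p \<alpha>)" for \<alpha>
  define g where "g \<beta> = single \<beta> (lookup q \<beta>)" for \<beta>
  have p: "p = sum f (keys p)" and q: "q = sum g (keys q)"
    using poly_eq_sum_single[of p] poly_eq_sum_single[of q] by (simp_all add: f_def g_def)
  have fg: "keys (wmul (f \<alpha>) (g \<beta>) - f \<alpha> * g \<beta>) \<subseteq> lower (\<alpha> + \<beta>)" for \<alpha> \<beta>
  proof -
    let ?c = "lookup p \<alpha>" and ?d = "lookup q \<beta>"
    obtain r where r: "wmul (single \<alpha> 1) (single \<beta> 1) =
      single (\<alpha> + \<beta>) (1 :: 'b) + r" "keys r \<subseteq> lower (\<alpha> + \<beta>)"
      using wmul_monomial by blast
    have "wmul (f \<alpha>) (g \<beta>) - f \<alpha> * g \<beta> = single 0 (?c * ?d) * r"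
      unfolding f_def g_def wmul_single[of \<alpha> ?c \<beta> ?d] r(1) by (simp add: distrib_left mult_single)
    then show ?thesis using keys_single_mult[of 0 "?c * ?d" r] r(2) by auto
  qed
  have "wmul (sum f A) (sum g B) - sum f A * sum g B = (\<Sum>\<alpha>\<in>A. \<Sum>\<beta>\<in>B. wmul (f \<alpha>) (g \<beta>) - f \<alpha> * g \<beta>)" for A B
    by (simp add: wmul_sum_left wmul_sum_right sum_product sum_subtractf) (rule sum.swap)
  then have eq: "wmul p q - p * q = (\<Sum>\<alpha>\<in>keys p. \<Sum>\<beta>\<in>keys q. wmul (f \<alpha>) (g \<beta>) - f \<alpha> * g \<beta>)"
    using p q by metis
  show ?thesis
  proof
    fix \<rho> assume "\<rho> \<in> keys (wmul p q - p * q)"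
    then have "(\<Sum>\<alpha>\<in>keys p. lookup (\<Sum>\<beta>\<in>keys q. wmul (f \<alpha>) (g \<beta>) - f \<alpha> * g \<beta>) \<rho>) \<noteq> 0"
      unfolding eq by (simp only: in_keys_iff lookup_sum not_False_eq_True)
    then obtain \<alpha> where "\<alpha> \<in> keys p" 
      "(\<Sum>\<beta>\<in>keys q. lookup (wmul (f \<alpha>) (g \<beta>) - f \<alpha> * g \<beta>) \<rho>) \<noteq> 0"
      unfolding lookup_sum by (rule sum.not_neutral_contains_not_neutral)
    moreover from this(2) obtain \<beta> where "\<beta> \<in> keys q"
      "lookup (wmul (f \<alpha>) (g \<beta>) - f \<alpha> * g \<beta>) \<rho> \<noteq> 0"
      by (rule sum.not_neutral_contains_not_neutral)
    moreover from this(2) have "\<rho> \<in> lower (\<alpha> + \<beta>)"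
      using subsetD[OF fg[of \<alpha> \<beta>], of \<rho>] by (simp add: in_keys_iff)
    ultimately show "\<rho> \<in> (\<Union>\<alpha>\<in>keys p. \<Union>\<beta>\<in>keys q. lower (\<alpha> + \<beta>))"
      by blast
  qed
qed

text \<open>This is where the definition of \<open>Omega\<close> enters: removing \<open>X\<^sub>i Y\<^sub>i\<close> lowers the weight.\<close>

lemma wt_less_if_lower:
  assumes "w \<in> Omega" "\<rho> \<in> lower \<gamma>"
  shows "wt w \<rho> < wt w \<gamma>"
proof -
  obtain \<delta> where d: "\<delta> \<noteq> 0" "\<And>i. lookup \<delta> (Inl i) = lookup \<delta> (Inr i)" "\<rho> + \<delta> = \<gamma>"
    using assms(2) unfolding lower_def by blast
  obtain k where k: "lookup \<delta> k \<noteq> 0" 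
    using d(1) by (auto simp: poly_mapping_eq_iff fun_eq_iff)
  then obtain i where i: "lookup \<delta> (Inl i) \<noteq> 0" "lookup \<delta> (Inr i) \<noteq> 0"
    using d(2) by (cases k) auto
  have "w (Inl i) > 0 \<or> w (Inr i) > 0" using assms(1) by (auto simp: Omega_def)
  then obtain l where "w l * lookup \<delta> l > 0" using i by (metis nat_0_less_mult_iff gr0I)
  then have "wt w \<delta> > 0" unfolding wt_def by (intro sum_pos2[of _ l]) auto
  then show ?thesis using d(3) wt_add[of w \<rho> \<delta>] by simp
qed

lemma wmul_leading:
  assumes "w \<in> Omega" "p \<in> PF w i" "q \<in> PF w j"
  shows "wmul p q - p * q \<in> PF w (i + j - 1)"
  unfolding PF_iff
proof
  fix \<rho> assume "\<rho> \<in> keys (wmul p q - p * q)"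
  then obtain \<alpha> \<beta> where "\<alpha> \<in> keys p" "\<beta> \<in> keys q" "\<rho> \<in> lower (\<alpha> + \<beta>)"
    using keys_wmul_diff by blast
  moreover from this have "int (wt w \<alpha>) \<le> i" "int (wt w \<beta>) \<le> j" "wt w \<rho> < wt w \<alpha> + wt w \<beta>"
    using assms wt_less_if_lower[OF assms(1), of \<rho> "\<alpha> + \<beta>"] by (auto simp: PF_iff wt_add)
  ultimately show "int (wt w \<rho>) \<le> i + j - 1" by linarith
qed

section \<open>Monomial orders on free modules\<close>

type_synonym 'n vmon = "('n + 'n \<Rightarrow>\<^sub>0 nat) \<times> nat"

definition pkey :: "'n::finite weight list \<Rightarrow> ('n + 'n \<Rightarrow>\<^sub>0 nat) \<Rightarrow> nat list" where
  "pkey ws \<alpha> = map (\<lambda>w. wt w \<alpha>) ws"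

text \<open>Monomial orders are given by lists of weights, compared lexicographically; the position in the
  free module comes last. The order is total when the weights separate exponents.\<close>

definition key :: "'n::finite weight list \<Rightarrow> 'n vmon \<Rightarrow> nat list" where
  "key ws m = pkey ws (fst m) @ [snd m]"

definition supp :: "nat \<Rightarrow> ('n::finite, 'k::field_char_0) pvec \<Rightarrow> 'n vmon set" where
  "supp t v = {(\<alpha>, j). j < t \<and> \<alpha> \<in> keys (v j)}"

definition is_lm :: "nat \<Rightarrow> 'n::finite weight list \<Rightarrow> ('n, 'k::field_char_0) pvec \<Rightarrow> 'n vmon \<Rightarrow> bool" where
  "is_lm t ws v m \<longleftrightarrow> m \<in> supp t v \<and> (\<forall>m'\<in>supp t v. key ws m' \<le> key ws m)"

definition LM :: "nat \<Rightarrow> 'n::finite weight list \<Rightarrow> ('n, 'k::field_char_0) pvec set \<Rightarrow> 'n vmon set" where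
  "LM t ws L = {m. \<exists>v\<in>L. is_lm t ws v m}"

definition divides :: "'n::finite vmon \<Rightarrow> 'n vmon \<Rightarrow> bool" where
  "divides m m' \<longleftrightarrow> snd m = snd m' \<and> (\<exists>\<gamma>. fst m' = \<gamma> + fst m)"

lemma mem_supp: "(\<alpha>, j) \<in> supp t v \<longleftrightarrow> j < t \<and> lookup (v j) \<alpha> \<noteq> 0"
  by (simp add: supp_def in_keys_iff)

lemma finite_supp: "finite (supp t v)"
proof (rule finite_subset)
  show "supp t v \<subseteq> (\<Union>j<t. (\<lambda>\<alpha>. (\<alpha>, j)) ` keys (v j))" by (auto simp: supp_def)
qed simp

lemma supp_empty: "supp t v = {} \<Longrightarrow> j < t \<Longrightarrow> v j = 0"
  using mem_supp[of _ j t v] by (intro poly_mapping_eqI) auto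

lemma ex_lm: "supp t v \<noteq> {} \<Longrightarrow> \<exists>m. is_lm t ws v m"
proof -
  assume "supp t v \<noteq> {}"
  then have "Max (key ws ` supp t v) \<in> key ws ` supp t v" by (intro Max_in) (auto simp: finite_supp)
  then obtain m where "m \<in> supp t v" "key ws m = Max (key ws ` supp t v)" by auto
  then have "is_lm t ws v m" unfolding is_lm_def by (simp add: finite_supp)
  then show ?thesis ..
qed

lemma key_add_mono: "key ws (\<alpha>, i) < key ws (\<beta>, j) \<Longrightarrow> key ws (\<gamma> + \<alpha>, i) < key ws (\<gamma> + \<beta>, j)"
  by (induction ws) (auto simp: key_def pkey_def wt_add)

lemma pkey_add_mono: "pkey ws \<alpha> \<le> pkey ws \<beta> \<Longrightarrow> pkey ws (\<gamma> + \<alpha>) \<le> pkey ws (\<gamma> + \<beta>)"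
  by (induction ws) (auto simp: pkey_def wt_add)

lemma pkey_add_eq: "pkey ws (\<gamma> + \<alpha>) = pkey ws (\<gamma> + \<beta>) \<longleftrightarrow> pkey ws \<alpha> = pkey ws \<beta>"
  by (induction ws) (auto simp: pkey_def wt_add)

lemma key_le_add: "key ws (\<alpha>, j) \<le> key ws (\<gamma> + \<alpha>, j)"
  by (induction ws) (auto simp: key_def pkey_def wt_add)

lemma inj_key: "inj (pkey ws) \<Longrightarrow> key ws m = key ws m' \<Longrightarrow> m = m'"
  by (cases m; cases m') (auto simp: key_def inj_def)

lemma key_lower:
  assumes "inj (pkey ws)" "\<rho> \<in> lower \<gamma>"
  shows "key ws (\<rho>, j) < key ws (\<gamma>, j)"
proof -
  obtain \<delta> where d: "\<delta> \<noteq> 0" "\<gamma> = \<delta> + \<rho>" using assms(2) unfolding lower_def by (auto simp: add.commute)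
  then have "(\<rho>, j) \<noteq> (\<gamma>, j)" by auto
  then have "key ws (\<rho>, j) \<noteq> key ws (\<gamma>, j)" using inj_key[OF assms(1)] by blast
  then show ?thesis using key_le_add[of ws \<rho> j \<delta>] d(2) by simp
qed

lemma append_le_prefix:
  fixes a :: "nat list"
  assumes "a @ b \<le> a' @ b'" "length a = length a'"
  shows "a \<le> a'"
  using assms(2,1) by (induction a a' rule: list_induct2) auto

lemma key_append_pkey: "key (pre @ us) m \<le> key (pre @ us) m' \<Longrightarrow> pkey pre (fst m) \<le> pkey pre (fst m')"
  by (auto simp: key_def pkey_def intro: append_le_prefix)

lemma inj_pkey_append: "inj (pkey us) \<Longrightarrow> inj (pkey (pre @ us))"
  by (auto simp: inj_def pkey_def)

text \<open>The unit weights separate monomials; they serve as a tie-breaker behind any list of weights.\<close>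

lemma ex_inj_pkey: "\<exists>us :: 'n::finite weight list. inj (pkey us)"
proof -
  obtain cs :: "('n + 'n) list" where "set cs = UNIV" using finite_list[of "UNIV :: ('n + 'n) set"] by auto
  define us where "us = map (\<lambda>i j. if j = i then 1 else 0 :: nat) cs"
  have wt: "wt (\<lambda>j. if j = i then 1 else 0) \<alpha> = lookup \<alpha> i" for i and \<alpha> :: "'n + 'n \<Rightarrow>\<^sub>0 nat"
    by (simp add: wt_def if_distrib[of "\<lambda>x. x * _"] cong: if_cong)
  have "inj (pkey us)"
  proof (rule injI)
    fix \<alpha> \<beta> assume "pkey us \<alpha> = pkey us \<beta>"
    then have "\<forall>i\<in>set cs. lookup \<alpha> i = lookup \<beta> i"
      by (simp add: pkey_def us_def wt)
    then show "\<alpha> = \<beta>" using \<open>set cs = UNIV\<close> by (intro poly_mapping_eqI) simp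
  qed
  then show ?thesis ..
qed

text \<open>Keys have a fixed length, so this is the lexicographic order on tuples of natural numbers.\<close>

lemma wf_key: "wf {(m, m'). key ws m < key ws m'}"
proof -
  have "{(m, m'). key ws m < key ws m'} \<subseteq> inv_image (lex {(u, v). u < v}) (key ws)"
    by (auto simp: list_less_def lexord_lex key_def pkey_def)
  moreover have "wf (lex {(u, v :: nat). u < v})" by (rule wf_lex[OF wf])
  ultimately show ?thesis by (meson wf_inv_image wf_subset)
qed

lemma lookup_single_mult:
  "lookup (single \<gamma> c * q) (\<gamma> + \<beta>) = c * lookup q \<beta>"
  for q :: "('n::finite, 'k::field_char_0) polyXY"
proof -
  define g where "g \<beta> = single \<beta> (lookup q \<beta>)" for \<beta>
  have q: "q = sum g (keys q)"
    using poly_eq_sum_single[of q] by (simp add: g_def)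
  have "lookup (single \<gamma> c * sum g A) (\<gamma> + \<beta>) = c * lookup (sum g A) \<beta>" for A
    by (simp add: sum_distrib_left lookup_sum g_def mult_single lookup_single when_def if_distrib cong: if_cong)
  then show ?thesis using q by metis
qed

text \<open>Leading monomials are multiplicative for the Weyl product because the corrections in
  \<open>keys_wmul_diff\<close> are strictly smaller.\<close>

lemma is_lm_wmul:
  assumes inj: "inj (pkey ws)" and lm: "is_lm t ws v (\<beta>, k)" and c: "c \<noteq> 0"
  shows "is_lm t ws (\<lambda>j. wmul (single \<gamma> c) (v j)) (\<gamma> + \<beta>, k)"
    and "lookup (wmul (single \<gamma> c) (v k)) (\<gamma> + \<beta>) = c * lookup (v k) \<beta>"
proof -
  let ?u = "\<lambda>j. wmul (single \<gamma> c) (v j)"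
  let ?r = "\<lambda>j. wmul (single \<gamma> c) (v j) - single \<gamma> c * v j"
  have k: "k < t" "lookup (v k) \<beta> \<noteq> 0" using lm by (auto simp: is_lm_def mem_supp)
  have le: "key ws (\<gamma> + \<beta>', j) \<le> key ws (\<gamma> + \<beta>, k)" if "\<beta>' \<in> keys (v j)" "j < t" for \<beta>' j
  proof -
    have "key ws (\<beta>', j) \<le> key ws (\<beta>, k)" using lm that by (auto simp: is_lm_def supp_def)
    then show ?thesis using key_add_mono[of ws \<beta>' j \<beta> k \<gamma>] inj_key[OF inj, of "(\<beta>', j)" "(\<beta>, k)"]
      by (auto simp: order_le_less)
  qed
  have r: "key ws (\<rho>, j) < key ws (\<gamma> + \<beta>, k)" if "\<rho> \<in> keys (?r j)" "j < t" for \<rho> j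
  proof -
    have "\<rho> \<in> (\<Union>\<alpha>\<in>keys (single \<gamma> c). \<Union>\<beta>'\<in>keys (v j). lower (\<alpha> + \<beta>'))"
      by (rule subsetD[OF keys_wmul_diff that(1)])
    then obtain \<beta>' where "\<beta>' \<in> keys (v j)" "\<rho> \<in> lower (\<gamma> + \<beta>')"
      using c by auto
    then show ?thesis
      using order_less_le_trans[OF key_lower[OF inj] le] that(2) by blast
  qed
  have "\<gamma> + \<beta> \<notin> keys (?r k)" using r[of "\<gamma> + \<beta>" k] k by auto
  then show eq: "lookup (?u k) (\<gamma> + \<beta>) = c * lookup (v k) \<beta>"
    by (simp add: in_keys_iff lookup_minus lookup_single_mult)
  show "is_lm t ws ?u (\<gamma> + \<beta>, k)"
    unfolding is_lm_def
  proof (intro conjI ballI)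
    show "(\<gamma> + \<beta>, k) \<in> supp t ?u" using eq k c by (simp add: mem_supp)
  next
    fix m assume m: "m \<in> supp t ?u"
    obtain \<rho> j where mj: "m = (\<rho>, j)" by (cases m)
    have j: "j < t" "lookup (?r j + single \<gamma> c * v j) \<rho> \<noteq> 0"
      using m by (simp_all add: mj mem_supp)
    then consider "\<rho> \<in> keys (?r j)" | "\<rho> \<in> keys (single \<gamma> c * v j)"
      unfolding lookup_add in_keys_iff by fastforce
    then show "key ws m \<le> key ws (\<gamma> + \<beta>, k)"
    proof cases
      case 1
      then show ?thesis using r j(1) mj by (auto intro: less_imp_le)
    next
      case 2
      then obtain \<beta>' where "\<beta>' \<in> keys (v j)" "\<rho> = \<gamma> + \<beta>'"
        using keys_single_mult[of \<gamma> c "v j"] by (auto simp: add.commute)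
      then show ?thesis using le j(1) mj by simp
    qed
  qed
qed

lemma wmul_scalar: "wmul (single 0 c) q = single 0 c * q"
  by (rule wmul_eqI)
     (simp add: fun_eq_iff weyl_of_poly_single_mult weyl_of_poly_single weyl_monomial_0)

lemma submod_wmul_diff:
  assumes "submod wmul t L" "u \<in> L" "v \<in> L"
  shows "(\<lambda>j. u j - v j) \<in> L"
proof -
  have "(\<lambda>j. u j + wmul (single 0 (- 1)) (v j)) \<in> L"
    by (rule submod_add[OF assms(1,2) submod_mult[OF assms(1,3)]])
  moreover have "wmul (single 0 (- 1)) q = - q" for q :: "('a, 'b) polyXY"
    unfolding wmul_scalar by (simp add: single_uminus)
  ultimately show ?thesis by simp
qed

section \<open>Universal Groebner bases\<close>

definition vterm :: "'k \<Rightarrow> 'n::finite vmon \<Rightarrow> ('n, 'k::field_char_0) pvec" where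
  "vterm c m = (\<lambda>j. if j = snd m then single (fst m) c else 0)"

lemma vec_eq_sum_vterm:
  assumes "j < t"
  shows "v j = (\<Sum>m\<in>supp t v. vterm (lookup (v (snd m)) (fst m)) m j)"
proof (rule poly_mapping_eqI)
  fix \<alpha>
  have "lookup (vterm (lookup (v (snd m)) (fst m)) m j) \<alpha> =
      (if m = (\<alpha>, j) then lookup (v j) \<alpha> else 0)" for m
    by (cases m) (auto simp: vterm_def lookup_single when_def)
  then show "lookup (v j) \<alpha> =
      lookup (\<Sum>m\<in>supp t v. vterm (lookup (v (snd m)) (fst m)) m j) \<alpha>"
    using assms by (simp add: lookup_sum finite_supp mem_supp)
qed

lemma supp_sum: "supp t (\<lambda>j. \<Sum>x\<in>X. f x j) \<subseteq> (\<Union>x\<in>X. supp t (f x))"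
proof
  fix m assume "m \<in> supp t (\<lambda>j. \<Sum>x\<in>X. f x j)"
  then have "snd m < t" "(\<Sum>x\<in>X. lookup (f x (snd m)) (fst m)) \<noteq> 0"
    by (cases m, simp add: mem_supp lookup_sum)+
  moreover from this(2) obtain x where "x \<in> X" "lookup (f x (snd m)) (fst m) \<noteq> 0"
    by (rule sum.not_neutral_contains_not_neutral)
  ultimately show "m \<in> (\<Union>x\<in>X. supp t (f x))" by (cases m) (auto simp: mem_supp)
qed

lemma cancel_lm:
  assumes inj: "inj (pkey ws)" and lm: "is_lm t ws v m" and lm': "is_lm t ws u m"
    and eq: "lookup (u (snd m)) (fst m) = lookup (v (snd m)) (fst m)"
    and m': "m' \<in> supp t (\<lambda>j. v j - u j)"
  shows "key ws m' < key ws m"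
proof -
  have "m' \<in> supp t v \<or> m' \<in> supp t u"
    using m' by (cases m') (auto simp: mem_supp lookup_minus)
  then have "key ws m' \<le> key ws m" using lm lm' by (auto simp: is_lm_def)
  moreover have "m' \<noteq> m" using m' eq by (cases m') (auto simp: mem_supp lookup_minus)
  ultimately show ?thesis using inj_key[OF inj, of m' m] by (metis order_le_less)
qed

lemma is_lm_vterm: "c \<noteq> 0 \<Longrightarrow> k < t \<Longrightarrow> is_lm t ws (vterm c (\<alpha>, k)) (\<alpha>, k)"
  by (auto simp: is_lm_def mem_supp vterm_def lookup_single when_def split: if_splits)

text \<open>Division with respect to the whole of \<open>L\<close>: a term is subtracted whenever it is a leading
  term, and the recursion ends by well-foundedness of the order.\<close>

lemma normal_form:
  assumes L: "submod wmul t L" and inj: "inj (pkey ws)"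
  shows "snd m < t \<Longrightarrow> \<exists>v. supp t v \<inter> LM t ws L = {} \<and> (\<lambda>j. vterm c m j - v j) \<in> L"
proof (induction m arbitrary: c rule: wf_induct_rule[OF wf_key[of ws]])
  case (1 m)
  obtain \<alpha> k where m: "m = (\<alpha>, k)" by (cases m)
  then have k: "k < t" using 1 by simp
  show ?case
  proof (cases "c \<noteq> 0 \<and> m \<in> LM t ws L")
    case False
    have "supp t (vterm c m) \<subseteq> (if c = 0 then {} else {m})"
      by (auto simp: mem_supp vterm_def lookup_single when_def m split: if_splits)
    then have "supp t (vterm c m) \<inter> LM t ws L = {}" using False by (auto split: if_splits)
    moreover have "(\<lambda>j. vterm c m j - vterm c m j) \<in> L" using submod_zero[OF L] by simp
    ultimately show ?thesis by blast
  next
    case True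
    then obtain g where g: "g \<in> L" "is_lm t ws g (\<alpha>, k)" by (auto simp: LM_def m)
    \<comment> \<open>normalize the coefficient of \<open>m\<close> in \<open>g\<close> to \<open>c\<close>\<close>
    define a where "a = lookup (g k) \<alpha>"
    have a: "a \<noteq> 0" using g(2) by (simp add: is_lm_def mem_supp a_def)
    define g' where "g' = (\<lambda>j. wmul (single 0 (c / a)) (g j))"
    have g': "g' \<in> L" unfolding g'_def by (rule submod_mult[OF L g(1)])
    have lm: "is_lm t ws g' m" "lookup (g' k) \<alpha> = c"
      using is_lm_wmul[OF inj g(2), of "c / a" 0] True a by (auto simp: g'_def m a_def)
    define u where "u = (\<lambda>j. vterm c m j - g' j)"
    have vt: "is_lm t ws (vterm c m) m" using True k by (simp add: m is_lm_vterm)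
    have less: "key ws m' < key ws m" if "m' \<in> supp t u" for m'
      by (rule cancel_lm[OF inj vt lm(1) _ that[unfolded u_def]]) (simp add: lm(2) m vterm_def)
    let ?c = "\<lambda>m'. lookup (u (snd m')) (fst m')"
    have "\<forall>m'\<in>supp t u. \<exists>v. supp t v \<inter> LM t ws L = {} \<and> (\<lambda>j. vterm (?c m') m' j - v j) \<in> L"
      using 1(1) less by (auto simp: supp_def)
    from bchoice[OF this] obtain v where "\<forall>m'\<in>supp t u. supp t (v m') \<inter> LM t ws L = {} \<and>
      (\<lambda>j. vterm (?c m') m' j - v m' j) \<in> L" ..
    then have v: "\<And>m'. m' \<in> supp t u \<Longrightarrow> supp t (v m') \<inter> LM t ws L = {}"
      "\<And>m'. m' \<in> supp t u \<Longrightarrow> (\<lambda>j. vterm (?c m') m' j - v m' j) \<in> L" by simp_all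
    let ?V = "\<lambda>j. \<Sum>m'\<in>supp t u. v m' j"
    have "supp t ?V \<inter> LM t ws L = {}" using supp_sum[of t v "supp t u"] v(1) by blast
    moreover have "(\<lambda>j. g' j + (\<Sum>m'\<in>supp t u. vterm (?c m') m' j - v m' j)) \<in> L"
      by (intro submod_add[OF L g'] submod_sum[OF L, where f = "\<lambda>m' j. vterm (?c m') m' j - v m' j"] v(2))
    then have "(\<lambda>j. vterm c m j - ?V j) \<in> L"
    proof (rule submod_cong[OF L])
      fix j assume "j < t"
      then have "u j = (\<Sum>m'\<in>supp t u. vterm (?c m') m' j)" by (rule vec_eq_sum_vterm)
      moreover have "vterm c m j = g' j + u j" by (simp add: u_def)
      ultimately show "vterm c m j - ?V j = g' j + (\<Sum>m'\<in>supp t u. vterm (?c m') m' j - v m' j)"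
        unfolding sum_subtractf by (simp only: add_diff_eq)
    qed
    ultimately show ?thesis by blast
  qed
qed

text \<open>A monotone subsequence exists; if it is decreasing, it is constant from its minimum on.\<close>

lemma nat_incseq_subseq: "\<exists>r :: nat \<Rightarrow> nat. strict_mono r \<and> incseq (\<lambda>n. f (r n))" for f :: "nat \<Rightarrow> nat"
proof -
  obtain r :: "nat \<Rightarrow> nat" where r: "strict_mono r" "monoseq (\<lambda>n. f (r n))" using seq_monosub by blast
  show ?thesis
  proof (cases "incseq (\<lambda>n. f (r n))")
    case False
    then have dec: "decseq (\<lambda>n. f (r n))" using r(2) by (auto simp: monoseq_iff)
    obtain N where N: "\<And>n. f (r N) \<le> f (r n)" 
      using ex_has_least_nat[of "\<lambda>_. True" _ "\<lambda>n. f (r n)"] by blast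
    have "f (r (N + n)) = f (r N)" for n using N[of "N + n"] decseqD[OF dec, of N "N + n"] by simp
    then have "incseq (\<lambda>n. f (r (N + n)))" by (simp add: incseq_def)
    moreover have "strict_mono (\<lambda>n. r (N + n))" using r(1) by (simp add: strict_mono_def)
    ultimately show ?thesis by blast
  qed (use r in blast)
qed

lemma dickson_subseq:
  fixes f :: "nat \<Rightarrow> 'b \<Rightarrow> nat"
  assumes "finite S"
  shows "\<exists>r :: nat \<Rightarrow> nat. strict_mono r \<and> (\<forall>k\<in>S. incseq (\<lambda>n. f (r n) k))"
  using assms
proof (induction S rule: finite_induct)
  case empty
  show ?case by (auto intro!: exI[of _ id] simp: strict_mono_def)
next
  case (insert x S)
  then obtain r :: "nat \<Rightarrow> nat" where r: "strict_mono r" "\<forall>k\<in>S. incseq (\<lambda>n. f (r n) k)" by blast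
  obtain s :: "nat \<Rightarrow> nat" where s: "strict_mono s" "incseq (\<lambda>n. f (r (s n)) x)" 
    using nat_incseq_subseq[of "\<lambda>n. f (r n) x"] by blast
  have "strict_mono (\<lambda>n. r (s n))" using r(1) s(1) by (simp add: strict_mono_def)
  moreover have "incseq (\<lambda>n. f (r (s n)) k)" if "k \<in> S" for k
  proof (rule incseq_SucI)
    fix n
    have "s n \<le> s (Suc n)" using s(1) by (simp add: strict_mono_less_eq)
    then show "f (r (s n)) k \<le> f (r (s (Suc n))) k" using incseqD[of "\<lambda>n. f (r n) k"] r(2) that by blast
  qed
  ultimately show ?case using s(2) by (intro exI[of _ "\<lambda>n. r (s n)"]) auto
qed

text \<open>Dickson's lemma, with the position of the monomial in the free module as two further
  coordinates, \<open>j\<close> and \<open>t - j\<close>: a simultaneous increase of both forces equality.\<close>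

lemma dickson:
  fixes f :: "nat \<Rightarrow> 'n::finite vmon"
  assumes "\<And>n. snd (f n) < t"
  shows "\<exists>i j. i < j \<and> divides (f i) (f j)"
proof -
  define F where "F n k = (case k of Inl i \<Rightarrow> lookup (fst (f n)) i
     | Inr b \<Rightarrow> if b then snd (f n) else t - snd (f n))" for n and k :: "('n + 'n) + bool"
  obtain r :: "nat \<Rightarrow> nat" where r: "strict_mono r" "\<And>k. incseq (\<lambda>n. F (r n) k)"
    using dickson_subseq[of UNIV F] by auto
  have le: "F (r 0) k \<le> F (r 1) k" for k using incseqD[OF r(2), of 0 1 k] by simp
  have "snd (f (r 0)) = snd (f (r 1))"
    using le[of "Inr True"] le[of "Inr False"] assms[of "r 0"] assms[of "r 1"] by (simp add: F_def)
  moreover have "fst (f (r 1)) = (fst (f (r 1)) - fst (f (r 0))) + fst (f (r 0))"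
    using le[of "Inl _"] by (intro poly_mapping_eqI) (simp add: F_def lookup_add lookup_minus)
  ultimately have "divides (f (r 0)) (f (r 1))" unfolding divides_def by blast
  moreover have "r 0 < r 1" using r(1) by (simp add: strict_mono_def)
  ultimately show ?thesis by blast
qed

definition monideal :: "nat \<Rightarrow> 'n::finite vmon set \<Rightarrow> bool" where
  "monideal t I \<longleftrightarrow> (\<forall>m\<in>I. snd m < t \<and> (\<forall>m'. divides m m' \<longrightarrow> m' \<in> I))"

text \<open>The ascending chain condition for monomial submodules.\<close>

lemma wf_monideal: "wf {(I', I). monideal t I \<and> monideal t I' \<and> I \<subset> (I' :: 'n::finite vmon set)}"
proof (rule ccontr)
  assume "\<not> ?thesis"
  then obtain I where I: "\<And>n. monideal t (I n :: 'n vmon set)" "\<And>n. I n \<subset> I (Suc n)"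
    unfolding wf_iff_no_infinite_down_chain by blast
  then have "\<forall>n. \<exists>m. m \<in> I (Suc n) \<and> m \<notin> I n" by blast
  then obtain m where m: "\<And>n. m n \<in> I (Suc n)" "\<And>n. m n \<notin> I n" by metis
  have "\<And>n. snd (m n) < t" using m(1) I(1) unfolding monideal_def by blast
  then obtain i j where ij: "i < j" "divides (m i) (m j)" using dickson by blast
  have "incseq I" using I(2) by (intro incseq_SucI) auto
  then have "m i \<in> I j" using m(1)[of i] ij(1) incseqD[of I "Suc i" j] by auto
  then show False using ij(2) I(1) m(2) unfolding monideal_def by blast
qed

lemma divides_trans: "divides a b \<Longrightarrow> divides b c \<Longrightarrow> divides a c"
  by (auto simp: divides_def) (metis add.assoc)

lemma divides_refl: "divides a a"
  by (auto simp: divides_def intro: exI[of _ 0])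

lemma LM_divides:
  assumes L: "submod wmul t L" and inj: "inj (pkey ws)" and "m \<in> LM t ws L" "divides m m'"
  shows "m' \<in> LM t ws L"
proof -
  obtain \<alpha> k \<gamma> where m: "m = (\<alpha>, k)" "m' = (\<gamma> + \<alpha>, k)" 
    using assms(4) by (cases m; cases m') (auto simp: divides_def)
  obtain v where v: "v \<in> L" "is_lm t ws v (\<alpha>, k)" using assms(3) m by (auto simp: LM_def)
  have "is_lm t ws (\<lambda>j. wmul (single \<gamma> 1) (v j)) (\<gamma> + \<alpha>, k)"
    by (rule is_lm_wmul(1)[OF inj v(2)]) simp
  then show ?thesis
    unfolding LM_def m(2) by (intro CollectI bexI[OF _ submod_mult[OF L v(1)]])
qed

definition leads :: "nat \<Rightarrow> 'n::finite weight list \<Rightarrow> ('n, 'k::field_char_0) pvec set \<Rightarrow> 'n vmon set \<Rightarrow> bool" where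
  "leads t ws U I \<longleftrightarrow> (\<forall>m\<in>I. \<exists>u\<in>U. \<exists>m'. is_lm t ws u m' \<and> divides m' m)"

lemma leads_mono: "leads t ws U I \<Longrightarrow> U \<subseteq> U' \<Longrightarrow> leads t ws U' I"
  unfolding leads_def by blast

text \<open>A finite subset of \<open>L\<close> is a Groebner basis for all orders at once. By Noetherian
  induction on a monomial module \<open>I\<close> that is known to be generated by leading monomials of \<open>U\<close>: if
  for some order there is a leading monomial \<open>m\<close> outside \<open>I\<close>, then \<open>m\<close> minus its normal form is an
  element \<open>f\<close> of \<open>L\<close> without any monomial in \<open>I\<close>. Whatever order is considered, \<open>f\<close> therefore
  contributes a new leading monomial, and it is one of the finitely many monomials of \<open>f\<close>. The
  induction hypothesis applies to each of these enlargements of \<open>I\<close>, and the union of the resulting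
  finite sets works.\<close>

lemma universal_groebner_basis:
  fixes L :: "('n::finite, 'k::field_char_0) pvec set"
  assumes L: "submod wmul t L"
  shows "\<exists>U. finite U \<and> U \<subseteq> L \<and> (\<forall>ws. inj (pkey ws) \<longrightarrow> leads t ws U (LM t ws L))"
proof -
  have "\<forall>U. monideal t I \<and> finite U \<and> U \<subseteq> L \<longrightarrow> (\<exists>U'. finite U' \<and> U' \<subseteq> L \<and>
      (\<forall>ws. inj (pkey ws) \<and> leads t ws U I \<longrightarrow> leads t ws U' (LM t ws L)))" for I
  proof (induction I rule: wf_induct_rule[OF wf_monideal[of t]])
    case (1 I)
    show ?case
    proof (intro allI impI)
      fix U assume U: "monideal t I \<and> finite U \<and> U \<subseteq> L"
      show "\<exists>U'. finite U' \<and> U' \<subseteq> L \<and>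
          (\<forall>ws. inj (pkey ws) \<and> leads t ws U I \<longrightarrow> leads t ws U' (LM t ws L))"
      proof (cases "\<forall>ws. inj (pkey ws) \<and> leads t ws U I \<longrightarrow> LM t ws L \<subseteq> I")
        case True
        then show ?thesis using U by (intro exI[of _ U]) (simp add: leads_def, blast)
      next
        case False
        then obtain ws m where ws: "inj (pkey ws)" "leads t ws U I" and m: "m \<in> LM t ws L" "m \<notin> I" by blast
        have I_LM: "I \<subseteq> LM t ws L"
        proof
          fix x assume "x \<in> I"
          then obtain u m' where "u \<in> U" "is_lm t ws u m'" "divides m' x"
            using ws(2) unfolding leads_def by blast
          moreover from this have "m' \<in> LM t ws L" using U unfolding LM_def by blast
          ultimately show "x \<in> LM t ws L" using LM_divides[OF L ws(1)] by blast
        qed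
        have mt: "snd m < t" using m(1) by (auto simp: LM_def is_lm_def supp_def)
        obtain v where v: "supp t v \<inter> LM t ws L = {}" "(\<lambda>j. vterm 1 m j - v j) \<in> L"
          using normal_form[OF L ws(1) mt] by blast
        define f where "f = (\<lambda>j. vterm 1 m j - v j)"
        have "m \<notin> supp t v" using v(1) m(1) by blast
        then have mf: "m \<in> supp t f"
          using mt by (cases m) (simp add: f_def mem_supp vterm_def lookup_minus)
        have fI: "n \<notin> I" if "n \<in> supp t f" for n
        proof -
          have "n = m \<or> n \<in> supp t v"
            using that by (cases n; cases m) (auto simp: f_def mem_supp vterm_def lookup_minus lookup_single when_def split: if_splits)
          then show ?thesis using v(1) I_LM m(2) by blast
        qed
        define I' where "I' n = I \<union> {x. divides n x}" for n :: "'n vmon"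
        define Q where "Q n U' \<longleftrightarrow> finite U' \<and> U' \<subseteq> L \<and>
            (\<forall>ws. inj (pkey ws) \<and> leads t ws (insert f U) (I' n) \<longrightarrow> leads t ws U' (LM t ws L))" for n U'
        have "\<forall>n\<in>supp t f. \<exists>U'. Q n U'"
        proof
          fix n assume n: "n \<in> supp t f"
          \<comment> \<open>the hypothesis for the larger module in which \<open>n\<close> is a leading monomial of \<open>f\<close>\<close>
          have "snd n < t" using n by (auto simp: supp_def)
          then have "snd x < t" if "divides n x" for x using that by (simp add: divides_def)
          then have I': "monideal t (I' n)"
            using U divides_trans[of n] unfolding monideal_def I'_def by blast
          moreover have "I \<subset> I' n" using fI[OF n] divides_refl[of n] by (auto simp: I'_def)
          ultimately have "(I' n, I) \<in> {(I', I). monideal t I \<and> monideal t I' \<and> I \<subset> I'}"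
            using U by simp
          moreover have "insert f U \<subseteq> L" using U v(2) by (simp add: f_def)
          ultimately show "\<exists>U'. Q n U'"
            using 1[rule_format, of "I' n" "insert f U"] I' U by (simp add: Q_def)
        qed
        then obtain U' where Q: "\<forall>n\<in>supp t f. Q n (U' n)" using bchoice by blast
        then have U': "\<And>n. n \<in> supp t f \<Longrightarrow> finite (U' n) \<and> U' n \<subseteq> L"
          "\<And>n ws. n \<in> supp t f \<Longrightarrow> inj (pkey ws) \<Longrightarrow> leads t ws (insert f U) (I' n) \<Longrightarrow> leads t ws (U' n) (LM t ws L)"
          by (simp_all add: Q_def)
        let ?U = "\<Union>n\<in>supp t f. U' n"
        have "leads t ws ?U (LM t ws L)" if ws: "inj (pkey ws)" "leads t ws U I" for ws
        proof -
          obtain n where n: "is_lm t ws f n" using mf ex_lm by blast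
          then have nf: "n \<in> supp t f" by (simp add: is_lm_def)
          have "leads t ws (insert f U) (I' n)"
            using ws(2) n unfolding leads_def I'_def by blast
          then show ?thesis using U'(2)[OF nf ws(1)] nf by (auto intro: leads_mono)
        qed
        moreover have "finite ?U" "?U \<subseteq> L" using U'(1) by (auto simp: finite_supp)
        ultimately show ?thesis by (intro exI[of _ ?U]) blast
      qed
    qed
  qed
  from this[of "{}", rule_format, of "{}"] have "\<exists>U'. finite U' \<and> U' \<subseteq> L \<and>
      (\<forall>ws. inj (pkey ws) \<and> leads t ws ({} :: ('n, 'k) pvec set) {} \<longrightarrow> leads t ws U' (LM t ws L))"
    by (simp add: monideal_def)
  moreover have "leads t ws ({} :: ('n, 'k) pvec set) {}" for ws :: "'n weight list"
    by (simp add: leads_def)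
  ultimately show ?thesis by simp
qed

section \<open>Initial modules for all large multiples of a weight\<close>

text \<open>The component with respect to several weights at once. For the lists \<open>[w]\<close> and \<open>[\<omega>, \<nu>]\<close> it is
  \<open>hc w\<close> and the iterated \<open>hc \<nu>\<close> of \<open>hc \<omega>\<close>, so that both sides of the comparison become instances
  of a single statement.\<close>

definition kcomp :: "'n weight list \<Rightarrow> nat list \<Rightarrow> ('n, 'k) polyXY \<Rightarrow> ('n::finite, 'k::field_char_0) polyXY" where
  "kcomp ws \<kappa> p = (\<Sum>\<alpha> | \<alpha> \<in> keys p \<and> pkey ws \<alpha> = \<kappa>.
     single \<alpha> (lookup p \<alpha>))"

lemma lookup_kcomp: "lookup (kcomp ws \<kappa> p) \<alpha> = (lookup p \<alpha> when pkey ws \<alpha> = \<kappa>)"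
  by (auto simp: kcomp_def lookup_sum lookup_single when_def in_keys_iff)

lemma kcomp_add: "kcomp ws \<kappa> (p + q) = kcomp ws \<kappa> p + kcomp ws \<kappa> q"
  by (rule poly_mapping_eqI) (simp add: lookup_kcomp lookup_add when_add_distrib)

lemma kcomp_eq_0: "(\<And>\<alpha>. \<alpha> \<in> keys p \<Longrightarrow> pkey ws \<alpha> \<noteq> \<kappa>) \<Longrightarrow> kcomp ws \<kappa> p = 0"
  by (rule poly_mapping_eqI) (auto simp: lookup_kcomp when_def in_keys_iff)

lemma kcomp_0 [simp]: "kcomp ws \<kappa> 0 = 0"
  by (rule kcomp_eq_0) simp

lemma kcomp_single_mult:
  "kcomp ws (pkey ws (\<gamma> + \<beta>)) (single \<gamma> c * q) = single \<gamma> c * kcomp ws (pkey ws \<beta>) q"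
proof -
  define g where "g \<alpha> = single \<alpha> (lookup q \<alpha>)" for \<alpha>
  have q: "q = sum g (keys q)"
    using poly_eq_sum_single[of q] by (simp add: g_def)
  have single: "kcomp ws \<kappa> (single \<alpha> d) = (if pkey ws \<alpha> = \<kappa> then single \<alpha> d else 0)" for \<kappa> \<alpha> d
    by (rule poly_mapping_eqI) (auto simp: lookup_kcomp lookup_single when_def)
  have "kcomp ws (pkey ws (\<gamma> + \<beta>)) (single \<gamma> c * sum g A) =
      single \<gamma> c * kcomp ws (pkey ws \<beta>) (sum g A)" for A
    by (induction A rule: infinite_finite_induct)
       (auto simp: kcomp_add distrib_left single g_def mult_single pkey_add_eq)
  then show ?thesis using q by metis
qed

text \<open>Leading components of all elements of \<open>L\<close> lie in a submodule \<open>D\<close> once those of a Groebner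
  basis \<open>U\<close> do. The order refines the one given by the prefix \<open>pre\<close>, so that a division step subtracts a
  multiple of an element of \<open>U\<close> whose component is either zero or a monomial times a leading component.\<close>

lemma kcomp_mem_by_division:
  fixes L :: "('n::finite, 'k::field_char_0) pvec set"
  assumes L: "submod wmul t L" and "U \<subseteq> L" and inj: "inj (pkey us)"
    and U: "leads t (pre @ us) U (LM t (pre @ us) L)"
    and low: "\<And>\<rho> \<gamma>. \<rho> \<in> lower \<gamma> \<Longrightarrow> pkey pre \<rho> < pkey pre \<gamma>"
    and D: "submod (*) t D"
    and tops: "\<And>u m. u \<in> U \<Longrightarrow> is_lm t (pre @ us) u m \<Longrightarrow> (\<lambda>j. kcomp pre (pkey pre (fst m)) (u j)) \<in> D"
    and v: "v \<in> L" "\<And>m. m \<in> supp t v \<Longrightarrow> pkey pre (fst m) \<le> \<kappa>"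
  shows "(\<lambda>j. kcomp pre \<kappa> (v j)) \<in> D"
proof -
  let ?ws = "pre @ us"
  have inj': "inj (pkey ?ws)" by (rule inj_pkey_append[OF inj])
  have empty: "(\<lambda>j. kcomp pre \<kappa> (v j)) \<in> D" if "supp t v = {}" for v
  proof (rule submod_cong[OF D submod_zero[OF D]])
    fix j assume "j < t"
    then have "v j = 0" by (rule supp_empty[OF that])
    then show "kcomp pre \<kappa> (v j) = 0" by simp
  qed
  have "\<forall>v\<in>L. (\<forall>m\<in>supp t v. pkey pre (fst m) \<le> \<kappa>) \<longrightarrow> is_lm t ?ws v m \<longrightarrow> (\<lambda>j. kcomp pre \<kappa> (v j)) \<in> D" for m
  proof (induction m rule: wf_induct_rule[OF wf_key[of ?ws]])
    case (1 m)
    show ?case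
    proof (intro ballI impI)
      fix v assume v: "v \<in> L" "\<forall>m\<in>supp t v. pkey pre (fst m) \<le> \<kappa>" "is_lm t ?ws v m"
      then have "m \<in> LM t ?ws L" by (auto simp: LM_def)
      then obtain u m' where u: "u \<in> U" "is_lm t ?ws u m'" "divides m' m"
        using U unfolding leads_def by blast
      obtain \<beta> k where m': "m' = (\<beta>, k)" by (cases m')
      obtain \<gamma> where m: "m = (\<gamma> + \<beta>, k)" using u(3) m' by (cases m) (auto simp: divides_def)
      \<comment> \<open>\<open>b / a\<close> is the quotient of the leading coefficients of \<open>v\<close> and \<open>u\<close>\<close>
      define a where "a = lookup (u k) \<beta>"
      define b where "b = lookup (v k) (\<gamma> + \<beta>)"
      have a: "a \<noteq> 0" and k: "k < t" and b: "b \<noteq> 0"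
        using u(2) v(3) by (simp_all add: is_lm_def m' m mem_supp a_def b_def)
      define g where "g = (\<lambda>j. wmul (single \<gamma> (b / a)) (u j))"
      have gL: "g \<in> L" unfolding g_def using u(1) \<open>U \<subseteq> L\<close> by (blast intro: submod_mult[OF L])
      have "is_lm t ?ws u (\<beta>, k)" using u(2) m' by simp
      note lm = is_lm_wmul[OF inj' this, of "b / a" \<gamma>]
      have lmg: "is_lm t ?ws g m" "lookup (g k) (\<gamma> + \<beta>) = b"
        using lm a b by (simp_all add: g_def m flip: a_def)
      define v' where "v' = (\<lambda>j. v j - g j)"
      have v'L: "v' \<in> L" unfolding v'_def by (rule submod_wmul_diff[OF L v(1) gL])
      have less: "key ?ws m'' < key ?ws m" if "m'' \<in> supp t v'" for m''
        by (rule cancel_lm[OF inj' v(3) lmg(1) _ that[unfolded v'_def]]) (simp add: lmg(2) m b_def)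
      have m_le: "pkey pre (fst m) \<le> \<kappa>" using v(2,3) by (simp add: is_lm_def)
      have v'_le: "\<forall>m''\<in>supp t v'. pkey pre (fst m'') \<le> \<kappa>"
        using less m_le by (meson key_append_pkey less_imp_le order_trans)
      have "(\<lambda>j. kcomp pre \<kappa> (v' j)) \<in> D"
      proof (cases "supp t v' = {}")
        case False
        then obtain m'' where m'': "is_lm t ?ws v' m''" using ex_lm by blast
        then have "(m'', m) \<in> {(m, m'). key ?ws m < key ?ws m'}" using less by (simp add: is_lm_def)
        then show ?thesis using 1 v'L v'_le m'' by blast
      qed (rule empty)
      moreover have "(\<lambda>j. kcomp pre \<kappa> (g j)) \<in> D"
      proof -
        let ?s = "single \<gamma> (b / a)"
        have le: "pkey pre (\<gamma> + \<beta>') \<le> pkey pre (\<gamma> + \<beta>)" if "\<beta>' \<in> keys (u j)" "j < t" for \<beta>' j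
        proof -
          have "key ?ws (\<beta>', j) \<le> key ?ws (\<beta>, k)" using u(2) that by (auto simp: is_lm_def supp_def m')
          then show ?thesis using key_append_pkey[of pre us "(\<beta>', j)" "(\<beta>, k)"] by (auto intro: pkey_add_mono)
        qed
        have \<kappa>: "pkey pre (\<gamma> + \<beta>) \<le> \<kappa>" using m_le m by simp
        have g: "kcomp pre \<kappa> (g j) = kcomp pre \<kappa> (?s * u j)" if j: "j < t" for j
        proof -
          have "kcomp pre \<kappa> (g j - ?s * u j) = 0"
          proof (rule kcomp_eq_0)
            fix \<rho> assume "\<rho> \<in> keys (g j - ?s * u j)"
            then have "\<rho> \<in> (\<Union>\<alpha>\<in>keys ?s. \<Union>\<beta>'\<in>keys (u j). lower (\<alpha> + \<beta>'))"
              unfolding g_def by (rule subsetD[OF keys_wmul_diff])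
            then obtain \<beta>' where "\<beta>' \<in> keys (u j)" "\<rho> \<in> lower (\<gamma> + \<beta>')"
              using a b by auto
            then have "pkey pre \<rho> < \<kappa>"
              using low le[OF _ j] \<kappa> by (meson order_less_le_trans order_trans)
            then show "pkey pre \<rho> \<noteq> \<kappa>" by simp
          qed
          then show ?thesis using kcomp_add[of pre \<kappa> "g j - ?s * u j" "?s * u j"] by simp
        qed
        show ?thesis
        proof (cases "pkey pre (\<gamma> + \<beta>) = \<kappa>")
          case True
          have "(\<lambda>j. ?s * kcomp pre (pkey pre \<beta>) (u j)) \<in> D"
            using tops[OF u(1,2)] by (intro submod_mult[OF D]) (simp add: m')
          then show ?thesis
            by (rule submod_cong[OF D])
               (use kcomp_single_mult[of pre \<gamma> \<beta> "b / a"] in \<open>simp add: g True\<close>)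
        next
          case False
          show ?thesis
          proof (rule submod_cong[OF D submod_zero[OF D]])
            fix j assume j: "j < t"
            show "kcomp pre \<kappa> (g j) = 0"
              unfolding g[OF j]
            proof (rule kcomp_eq_0)
              fix \<rho> assume "\<rho> \<in> keys (?s * u j)"
              then obtain \<beta>' where "\<beta>' \<in> keys (u j)" "\<rho> = \<gamma> + \<beta>'"
                using keys_single_mult[of \<gamma> "b / a" "u j"] by (auto simp: add.commute)
              then show "pkey pre \<rho> \<noteq> \<kappa>" using le[OF _ j] \<kappa> False by force
            qed
          qed
        qed
      qed
      ultimately have "(\<lambda>j. kcomp pre \<kappa> (v' j) + kcomp pre \<kappa> (g j)) \<in> D" by (rule submod_add[OF D])
      moreover have "kcomp pre \<kappa> (v' j) + kcomp pre \<kappa> (g j) = kcomp pre \<kappa> (v j)" for j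
        by (simp add: v'_def flip: kcomp_add)
      ultimately show "(\<lambda>j. kcomp pre \<kappa> (v j)) \<in> D" by simp
    qed
  qed
  then show ?thesis using empty[of v] ex_lm[of t v ?ws] v by (cases "supp t v = {}") blast+
qed

lemma Omega_add_mult:
  assumes "\<omega> \<in> Omega" "s > 0"
  shows "(\<lambda>i. \<nu> i + s * \<omega> i) \<in> Omega"
  unfolding Omega_def
proof (intro CollectI allI)
  fix i
  have "\<omega> (Inl i) > 0 \<or> \<omega> (Inr i) > 0" using assms(1) by (simp add: Omega_def)
  then show "0 < \<nu> (Inl i) + s * \<omega> (Inl i) + (\<nu> (Inr i) + s * \<omega> (Inr i))" using assms(2) by auto
qed

lemma wt_add_mult: "wt (\<lambda>i. \<nu> i + s * \<omega> i) \<alpha> = wt \<nu> \<alpha> + s * wt \<omega> \<alpha>"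
  by (simp add: wt_def distrib_right sum.distrib sum_distrib_left mult.assoc)

lemma submod_initial_wmul:
  assumes w: "w \<in> Omega" and L: "submod wmul t L"
  shows "submod (*) t (initial w q t L)"
proof (rule submod_initial)
  fix p i k v assume v: "v \<in> L" "v \<in> vfilt w q t k"
  show "\<exists>u\<in>L. \<forall>j<t. u j - hc w i p * v j \<in> PF w (k + i - q j - 1)"
  proof (rule bexI[OF _ submod_mult[OF L v(1)]])
    show "\<forall>j<t. wmul (hc w i p) (v j) - hc w i p * v j \<in> PF w (k + i - q j - 1)"
    proof (intro allI impI)
      fix j assume "j < t"
      then have "v j \<in> PF w (k - q j)" using v(2) by (simp add: vfilt_def)
      from wmul_leading[OF w hc_PF[of w i p] this]
      show "wmul (hc w i p) (v j) - hc w i p * v j \<in> PF w (k + i - q j - 1)"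
        by (simp only: add_diff_eq add.commute[of i k])
    qed
  qed
qed (use submod_zero[OF L] submod_add[OF L] in auto)

text \<open>If \<open>s\<close> exceeds the \<open>\<nu>\<close>-weights of two monomials, then the weight \<open>\<nu> + s\<omega>\<close> orders them
  like \<open>\<omega>\<close> followed by \<open>\<nu>\<close>: the \<open>\<omega>\<close>-weights are integers, so a difference between them
  contributes at least \<open>s\<close>. The bound does not involve \<open>\<omega>\<close>.\<close>

lemma pkey_sum_weight_cong:
  fixes \<nu> \<omega> :: "'n::finite weight"
  assumes s: "wt \<nu> \<alpha> < s" "wt \<nu> \<beta> < s"
    and ge: "pkey [\<lambda>i. \<nu> i + s * \<omega> i] \<alpha> \<ge> pkey [\<lambda>i. \<nu> i + s * \<omega> i] \<beta> \<or> pkey [\<omega>, \<nu>] \<alpha> \<ge> pkey [\<omega>, \<nu>] \<beta>"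
  shows "pkey [\<omega>, \<nu>] \<alpha> \<ge> pkey [\<omega>, \<nu>] \<beta> \<and> pkey [\<lambda>i. \<nu> i + s * \<omega> i] \<alpha> \<ge> pkey [\<lambda>i. \<nu> i + s * \<omega> i] \<beta>
     \<and> (pkey [\<omega>, \<nu>] \<alpha> = pkey [\<omega>, \<nu>] \<beta> \<longleftrightarrow> pkey [\<lambda>i. \<nu> i + s * \<omega> i] \<alpha> = pkey [\<lambda>i. \<nu> i + s * \<omega> i] \<beta>)"
proof -
  have cmp: "pkey [\<lambda>i. \<nu> i + s * \<omega> i] x < pkey [\<lambda>i. \<nu> i + s * \<omega> i] y" 
    if x: "wt \<nu> x < s" "pkey [\<omega>, \<nu>] x < pkey [\<omega>, \<nu>] y" for x y
  proof -
    consider "wt \<omega> x < wt \<omega> y" | "wt \<omega> x = wt \<omega> y" "wt \<nu> x < wt \<nu> y"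
      using x(2) by (auto simp: pkey_def)
    then show ?thesis
    proof cases
      case 1
      then have "s * Suc (wt \<omega> x) \<le> s * wt \<omega> y" by (intro mult_le_mono2) simp
      then show ?thesis using x(1) by (simp add: pkey_def wt_add_mult)
    qed (simp add: pkey_def wt_add_mult)
  qed
  have eq: "pkey [\<lambda>i. \<nu> i + s * \<omega> i] \<alpha> = pkey [\<lambda>i. \<nu> i + s * \<omega> i] \<beta>" if "pkey [\<omega>, \<nu>] \<alpha> = pkey [\<omega>, \<nu>] \<beta>"
    using that by (simp add: pkey_def wt_add_mult)
  consider "pkey [\<omega>, \<nu>] \<alpha> < pkey [\<omega>, \<nu>] \<beta>" | "pkey [\<omega>, \<nu>] \<alpha> = pkey [\<omega>, \<nu>] \<beta>"
    | "pkey [\<omega>, \<nu>] \<beta> < pkey [\<omega>, \<nu>] \<alpha>" by (rule linorder_cases)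
  then show ?thesis
  proof cases
    case 1
    then show ?thesis using cmp[OF s(1)] ge by (meson not_le)
  next
    case 2
    then show ?thesis using eq by simp
  next
    case 3
    then show ?thesis using cmp[OF s(2) 3] less_imp_le less_imp_not_eq2 by blast
  qed
qed

lemma hc_eq_kcomp: "hc w (int d) p = kcomp [w] [d] p"
  by (rule poly_mapping_eqI) (auto simp: lookup_hc lookup_kcomp pkey_def when_def)

lemma hc_hc_eq_kcomp: "hc \<nu> (int e) (hc \<omega> (int d) p) = kcomp [\<omega>, \<nu>] [d, e] p"
  by (rule poly_mapping_eqI) (auto simp: lookup_hc lookup_kcomp pkey_def when_def)

lemma hc_neg: "i < 0 \<Longrightarrow> hc w i p = 0"
  by (rule poly_mapping_eqI) (auto simp: lookup_hc when_def)

text \<open>For a fixed finite universal Groebner basis \<open>U\<close> of \<open>L\<close> and large \<open>s\<close>, every element of \<open>U\<close>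
  has the same leading form for \<open>\<nu> + s\<omega>\<close> as for \<open>\<omega>\<close> followed by \<open>\<nu>\<close>. Both initial modules are
  generated by these leading forms. Since \<open>U\<close> serves all orders, \<open>s0\<close> is independent of \<open>\<omega>\<close>.\<close>

lemma initial_of_initial:
  fixes L :: "('n::finite, 'k::field_char_0) pvec set"
  assumes L: "submod wmul t L"
  shows "\<exists>s0. \<forall>\<omega>\<in>Omega. \<forall>s>s0.
    initial (\<lambda>i. \<nu> i + s * \<omega> i) (\<lambda>_. 0) t L = initial \<nu> (\<lambda>_. 0) t (initial \<omega> (\<lambda>_. 0) t L)"
proof -
  obtain U where U: "finite U" "U \<subseteq> L" and lead: "\<And>ws. inj (pkey ws) \<Longrightarrow> leads t ws U (LM t ws L)"
    using universal_groebner_basis[OF L] by blast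
  obtain us :: "'n weight list" where us: "inj (pkey us)" using ex_inj_pkey by blast
  \<comment> \<open>any bound for the \<open>\<nu>\<close>-weights of all monomials in \<open>U\<close> will do\<close>
  define s0 where "s0 = (\<Sum>u\<in>U. \<Sum>m\<in>supp t u. wt \<nu> (fst m))"
  have s0: "wt \<nu> (fst m) \<le> s0" if "u \<in> U" "m \<in> supp t u" for u m
  proof -
    have "wt \<nu> (fst m) \<le> (\<Sum>m\<in>supp t u. wt \<nu> (fst m))"
      using that(2) by (intro member_le_sum) (auto simp: finite_supp)
    also have "\<dots> \<le> s0" unfolding s0_def using that(1) U(1) 
      by (intro member_le_sum[where f = "\<lambda>u. \<Sum>m\<in>supp t u. wt \<nu> (fst m)"]) auto
    finally show ?thesis .
  qed
  show ?thesis
  proof (intro exI[of _ s0] ballI allI impI)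
    fix \<omega> :: "'n weight" and s assume \<omega>: "\<omega> \<in> Omega" and s: "s0 < s"
    let ?w = "\<lambda>i. \<nu> i + s * \<omega> i" and ?q = "\<lambda>_ :: nat. 0 :: int"
    let ?J = "initial \<omega> ?q t L"
    have w: "?w \<in> Omega" using Omega_add_mult[OF \<omega>] s by simp
    have J: "submod (*) t ?J" and D2: "submod (*) t (initial ?w ?q t L)"
      by (rule submod_initial_wmul[OF \<omega> L] submod_initial_wmul[OF w L])+
    have D1: "submod (*) t (initial \<nu> ?q t ?J)" by (rule submod_initial_comm[OF J])
    have low1: "pkey [\<omega>, \<nu>] \<rho> < pkey [\<omega>, \<nu>] \<gamma>" "pkey [?w] \<rho> < pkey [?w] \<gamma>" if "\<rho> \<in> lower \<gamma>" for \<rho> \<gamma>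
      using wt_less_if_lower[OF \<omega> that] wt_less_if_lower[OF w that] by (simp_all add: pkey_def)
    have small: "wt \<nu> (fst m) < s" if "u \<in> U" "m \<in> supp t u" for u m using s0[OF that] s by simp
    \<comment> \<open>the maximality may refer to either of the two orders, which agree on \<open>u\<close>\<close>
    have tops: "(\<lambda>j. kcomp [?w] (pkey [?w] (fst m)) (u j)) \<in> initial ?w ?q t L"
      "(\<lambda>j. kcomp [\<omega>, \<nu>] (pkey [\<omega>, \<nu>] (fst m)) (u j)) \<in> initial \<nu> ?q t ?J"
      "\<And>j. j < t \<Longrightarrow> kcomp [?w] (pkey [?w] (fst m)) (u j) = kcomp [\<omega>, \<nu>] (pkey [\<omega>, \<nu>] (fst m)) (u j)"
      if u: "u \<in> U" and "m \<in> supp t u" "\<forall>m'\<in>supp t u. pkey [?w] (fst m') \<le> pkey [?w] (fst m) \<or> pkey [\<omega>, \<nu>] (fst m') \<le> pkey [\<omega>, \<nu>] (fst m)" for u m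
    proof -
      have cmp: "pkey [\<omega>, \<nu>] (fst m') \<le> pkey [\<omega>, \<nu>] (fst m)" "pkey [?w] (fst m') \<le> pkey [?w] (fst m)"
        "pkey [\<omega>, \<nu>] (fst m) = pkey [\<omega>, \<nu>] (fst m') \<longleftrightarrow> pkey [?w] (fst m) = pkey [?w] (fst m')"
        if m': "m' \<in> supp t u" for m'
        using pkey_sum_weight_cong[OF small[OF u \<open>m \<in> supp t u\<close>] small[OF u m']] \<open>\<forall>m'\<in>supp t u. _\<close> m' by blast+
      have uL: "u \<in> L" using u U(2) by blast
      have mem: "\<alpha> \<in> keys (u j) \<Longrightarrow> j < t \<Longrightarrow> (\<alpha>, j) \<in> supp t u" for \<alpha> j by (simp add: supp_def)
      have "u \<in> vfilt ?w ?q t (int (wt ?w (fst m)))"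
        using cmp(2) mem by (fastforce simp: vfilt_def PF_iff pkey_def)
      from vhom_mem_initial[OF submod_zero[OF L] uL this]
      show "(\<lambda>j. kcomp [?w] (pkey [?w] (fst m)) (u j)) \<in> initial ?w ?q t L"
        by (simp add: vhom_def hc_eq_kcomp pkey_def)
      have "u \<in> vfilt \<omega> ?q t (int (wt \<omega> (fst m)))"
        using cmp(1) mem by (fastforce simp: vfilt_def PF_iff pkey_def)
      from vhom_mem_initial[OF submod_zero[OF L] uL this]
      have "vhom \<omega> ?q (int (wt \<omega> (fst m))) u \<in> ?J" .
      moreover have "vhom \<omega> ?q (int (wt \<omega> (fst m))) u \<in> vfilt \<nu> ?q t (int (wt \<nu> (fst m)))"
        using cmp(1) mem by (fastforce simp: vfilt_def vhom_def PF_iff_lookup pkey_def lookup_hc in_keys_iff)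
      ultimately have "vhom \<nu> ?q (int (wt \<nu> (fst m))) (vhom \<omega> ?q (int (wt \<omega> (fst m))) u) \<in> initial \<nu> ?q t ?J"
        by (rule vhom_mem_initial[OF submod_zero[OF J]])
      then show "(\<lambda>j. kcomp [\<omega>, \<nu>] (pkey [\<omega>, \<nu>] (fst m)) (u j)) \<in> initial \<nu> ?q t ?J"
        by (simp add: vhom_def hc_hc_eq_kcomp pkey_def)
      show "kcomp [?w] (pkey [?w] (fst m)) (u j) = kcomp [\<omega>, \<nu>] (pkey [\<omega>, \<nu>] (fst m)) (u j)" if "j < t" for j
      proof (rule poly_mapping_eqI)
        fix \<alpha>
        show "lookup (kcomp [?w] (pkey [?w] (fst m)) (u j)) \<alpha> =
          lookup (kcomp [\<omega>, \<nu>] (pkey [\<omega>, \<nu>] (fst m)) (u j)) \<alpha>"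
          using cmp(3)[of "(\<alpha>, j)"] mem[of \<alpha> j] that
          by (cases "\<alpha> \<in> keys (u j)") (auto simp: lookup_kcomp when_def in_keys_iff)
      qed
    qed
    have A: "(\<lambda>j. kcomp [?w] \<kappa> (v j)) \<in> initial \<nu> ?q t ?J"
      if "v \<in> L" "\<And>m. m \<in> supp t v \<Longrightarrow> pkey [?w] (fst m) \<le> \<kappa>" for v \<kappa>
    proof (rule kcomp_mem_by_division[OF L U(2) us lead[OF inj_pkey_append[OF us]] low1(2) D1 _ that])
      fix u m assume u: "u \<in> U" and lm: "is_lm t ([?w] @ us) u m"
      then have "m \<in> supp t u" "\<forall>m'\<in>supp t u. pkey [?w] (fst m') \<le> pkey [?w] (fst m) \<or> pkey [\<omega>, \<nu>] (fst m') \<le> pkey [\<omega>, \<nu>] (fst m)"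
        unfolding is_lm_def by (blast dest: key_append_pkey)+
      note t = tops(2,3)[OF u this]
      show "(\<lambda>j. kcomp [?w] (pkey [?w] (fst m)) (u j)) \<in> initial \<nu> ?q t ?J"
        using t by (intro submod_cong[OF D1 t(1)])
    qed
    have B: "(\<lambda>j. kcomp [\<omega>, \<nu>] \<kappa> (v j)) \<in> initial ?w ?q t L"
      if "v \<in> L" "\<And>m. m \<in> supp t v \<Longrightarrow> pkey [\<omega>, \<nu>] (fst m) \<le> \<kappa>" for v \<kappa>
    proof (rule kcomp_mem_by_division[OF L U(2) us lead[OF inj_pkey_append[OF us]] low1(1) D2 _ that])
      fix u m assume u: "u \<in> U" and lm: "is_lm t ([\<omega>, \<nu>] @ us) u m"
      then have "m \<in> supp t u" "\<forall>m'\<in>supp t u. pkey [?w] (fst m') \<le> pkey [?w] (fst m) \<or> pkey [\<omega>, \<nu>] (fst m') \<le> pkey [\<omega>, \<nu>] (fst m)"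
        unfolding is_lm_def by (blast dest: key_append_pkey)+
      note t = tops(1,3)[OF u this]
      show "(\<lambda>j. kcomp [\<omega>, \<nu>] (pkey [\<omega>, \<nu>] (fst m)) (u j)) \<in> initial ?w ?q t L"
        using t by (intro submod_cong[OF D2 t(1)]) simp
    qed
    show "initial ?w ?q t L = initial \<nu> ?q t ?J"
    proof
      show "initial ?w ?q t L \<subseteq> initial \<nu> ?q t ?J"
      proof
        fix x assume x: "x \<in> initial ?w ?q t L"
        show "x \<in> initial \<nu> ?q t ?J"
        proof (rule vhom_mem[OF D1, of ?w ?q])
          fix k
          obtain u where u: "u \<in> L" "u \<in> vfilt ?w ?q t k" "\<forall>j<t. vhom ?w ?q k u j = vhom ?w ?q k x j"
            using x unfolding initial_def by blast
          show "vhom ?w ?q k x \<in> initial \<nu> ?q t ?J"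
          proof (cases "k < 0")
            case True
            then have "vhom ?w ?q k x = (\<lambda>_. 0)" by (simp add: vhom_def hc_neg)
            then show ?thesis using submod_zero[OF D1] by simp
          next
            case False
            then obtain d where d: "k = int d" using nonneg_int_cases[of k] by (metis not_less)
            have "(\<lambda>j. kcomp [?w] [d] (u j)) \<in> initial \<nu> ?q t ?J"
              using u(2) by (intro A[OF u(1)]) (fastforce simp: supp_def vfilt_def PF_iff pkey_def d)
            then show ?thesis
              by (rule submod_cong[OF D1]) (use u(3) in \<open>simp add: vhom_def d hc_eq_kcomp\<close>)
          qed
        qed
      qed
      show "initial \<nu> ?q t ?J \<subseteq> initial ?w ?q t L"
      proof
        fix x assume x: "x \<in> initial \<nu> ?q t ?J"
        show "x \<in> initial ?w ?q t L"
        proof (rule vhom_mem[OF D2, of \<nu> ?q])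
          fix e
          obtain y where y: "y \<in> ?J" "y \<in> vfilt \<nu> ?q t e" "\<forall>j<t. vhom \<nu> ?q e y j = vhom \<nu> ?q e x j"
            using x unfolding initial_def by blast
          have "vhom \<nu> ?q e y \<in> initial ?w ?q t L"
          proof (rule vhom_mem[OF D2, of \<omega> ?q])
            fix d
            obtain v where v: "v \<in> L" "v \<in> vfilt \<omega> ?q t d" "\<forall>j<t. vhom \<omega> ?q d v j = vhom \<omega> ?q d y j"
              using y(1) unfolding initial_def by blast
            have eq: "vhom \<omega> ?q d (vhom \<nu> ?q e y) j = hc \<nu> e (hc \<omega> d (v j))" if "j < t" for j
              using v(3) that by (simp add: vhom_def hc_comm[of \<omega>])
            show "vhom \<omega> ?q d (vhom \<nu> ?q e y) \<in> initial ?w ?q t L"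
            proof (cases "d < 0 \<or> e < 0")
              case True
              then have "vhom \<omega> ?q d (vhom \<nu> ?q e y) = (\<lambda>_. 0)" by (auto simp: vhom_def hc_neg)
              then show ?thesis using submod_zero[OF D2] by simp
            next
              case False
              then obtain d' e' where de: "d = int d'" "e = int e'" using nonneg_int_cases by (metis not_less)
              have "(\<lambda>j. kcomp [\<omega>, \<nu>] [d', e'] (v j)) \<in> initial ?w ?q t L"
              proof (rule B[OF v(1)])
                fix m assume m: "m \<in> supp t v"
                obtain \<alpha> j where aj: "m = (\<alpha>, j)" "j < t" "lookup (v j) \<alpha> \<noteq> 0"
                  using m by (cases m) (auto simp: mem_supp)
                have le: "wt \<omega> \<alpha> \<le> d'" using v(2) aj de by (auto simp: vfilt_def PF_iff_lookup)
                moreover have "wt \<nu> \<alpha> \<le> e'" if "wt \<omega> \<alpha> = d'"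
                proof -
                  have "lookup (hc \<omega> d (y j)) \<alpha> = lookup (hc \<omega> d (v j)) \<alpha>"
                    using v(3) aj(2) by (simp add: vhom_def)
                  then have "lookup (y j) \<alpha> \<noteq> 0" using aj(3) that by (simp add: lookup_hc de)
                  then show ?thesis using y(2) aj(2) de by (auto simp: vfilt_def PF_iff_lookup)
                qed
                ultimately show "pkey [\<omega>, \<nu>] (fst m) \<le> [d', e']" by (auto simp: pkey_def aj(1))
              qed
              then show ?thesis
                by (rule submod_cong[OF D2]) (simp only: eq, simp add: de hc_hc_eq_kcomp)
            qed
          qed
          then show "vhom \<nu> ?q e x \<in> initial ?w ?q t L"
            by (rule submod_cong[OF D2]) (use y(3) in simp)
        qed
      qed
    qed
  qed
qed

section \<open>Good filtrations and their associated graded modules\<close>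

text \<open>The common features of modules over the Weyl algebra and over the polynomial ring: the ring is
  identified with the polynomials as an additive group, and its product \<open>star\<close> has the same leading
  forms as the commutative one for the weight \<open>w\<close>.\<close>

locale symbol_module = left_module R M
  for R :: "'r ring" (structure) and M :: "('r, 'm) module" (structure) +
  fixes b :: "('n::finite, 'k::field_char_0) polyXY \<Rightarrow> 'r"
    and star :: "('n, 'k) polyXY \<Rightarrow> ('n, 'k) polyXY \<Rightarrow> ('n, 'k) polyXY"
    and w :: "'n weight"
  assumes b_bij: "bij_betw b UNIV (carrier R)"
    and b_add: "b (p + q) = b p \<oplus>\<^bsub>R\<^esub> b q"
    and b_star: "b (star p q) = b p \<otimes>\<^bsub>R\<^esub> b q"
    and b_one: "b 1 = \<one>\<^bsub>R\<^esub>"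
    and star_leading: "p \<in> PF w i \<Longrightarrow> q \<in> PF w j \<Longrightarrow> star p q - p * q \<in> PF w (i + j - 1)"
begin

abbreviation FR :: "int \<Rightarrow> 'r set" where "FR i \<equiv> b ` PF w i"

definition symbol :: "('n, 'k) polyXY \<Rightarrow> int \<Rightarrow> 'r set" where
  "symbol p i = FR (i - 1) +>\<^bsub>R\<^esub> b (hc w i p)"

definition Phi :: "nat \<Rightarrow> (nat \<Rightarrow> 'm) \<Rightarrow> ('n, 'k) pvec \<Rightarrow> 'm" where
  "Phi t x v = (\<Oplus>\<^bsub>M\<^esub>j\<in>{..<t}. b (v j) \<odot>\<^bsub>M\<^esub> x j)"

definition relations :: "nat \<Rightarrow> (nat \<Rightarrow> 'm) \<Rightarrow> ('n, 'k) pvec set" where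
  "relations t x = {v. Phi t x v = \<zero>\<^bsub>M\<^esub>}"

lemma b_closed [simp]: "b p \<in> carrier R"
  using b_bij by (auto simp: bij_betw_def)

lemma b_inj: "b p = b q \<longleftrightarrow> p = q"
  using b_bij by (auto simp: bij_betw_def inj_on_def)

lemma b_surj: "r \<in> carrier R \<Longrightarrow> \<exists>p. r = b p"
  using b_bij by (auto simp: bij_betw_def)

lemma b_0: "b 0 = \<zero>\<^bsub>R\<^esub>"
  using b_add[of 0 0] R.add.l_cancel_one'[of "b 0" "b 0"] by simp

lemma smult_0_left [simp]: "m \<in> carrier M \<Longrightarrow> \<zero>\<^bsub>R\<^esub> \<odot>\<^bsub>M\<^esub> m = \<zero>\<^bsub>M\<^esub>"
  using smult_l_distr[of "\<zero>\<^bsub>R\<^esub>" "\<zero>\<^bsub>R\<^esub>" m] M.add.l_cancel_one'[of "\<zero>\<^bsub>R\<^esub> \<odot>\<^bsub>M\<^esub> m" "\<zero>\<^bsub>R\<^esub> \<odot>\<^bsub>M\<^esub> m"] by simp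

lemma smult_0_right [simp]: "r \<in> carrier R \<Longrightarrow> r \<odot>\<^bsub>M\<^esub> \<zero>\<^bsub>M\<^esub> = \<zero>\<^bsub>M\<^esub>"
  using smult_r_distr[of r "\<zero>\<^bsub>M\<^esub>" "\<zero>\<^bsub>M\<^esub>"] M.add.l_cancel_one'[of "r \<odot>\<^bsub>M\<^esub> \<zero>\<^bsub>M\<^esub>" "r \<odot>\<^bsub>M\<^esub> \<zero>\<^bsub>M\<^esub>"] by simp

context
  fixes t :: nat and x :: "nat \<Rightarrow> 'm"
  assumes x: "\<And>j. j < t \<Longrightarrow> x j \<in> carrier M"
begin

lemma Phi_closed: "Phi t x v \<in> carrier M"
  unfolding Phi_def by (rule M.finsum_closed) (auto simp: x)

lemma Phi_add: "Phi t x (\<lambda>j. u j + v j) = Phi t x u \<oplus>\<^bsub>M\<^esub> Phi t x v"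
proof -
  have "Phi t x (\<lambda>j. u j + v j) =
      (\<Oplus>\<^bsub>M\<^esub>j\<in>{..<t}. b (u j) \<odot>\<^bsub>M\<^esub> x j \<oplus>\<^bsub>M\<^esub> b (v j) \<odot>\<^bsub>M\<^esub> x j)"
    unfolding Phi_def by (rule M.finsum_cong') (auto simp: x b_add smult_l_distr)
  also have "\<dots> = Phi t x u \<oplus>\<^bsub>M\<^esub> Phi t x v"
    unfolding Phi_def by (rule M.finsum_addf) (auto simp: x)
  finally show ?thesis .
qed

lemma Phi_cong: "(\<And>j. j < t \<Longrightarrow> u j = v j) \<Longrightarrow> Phi t x u = Phi t x v"
  unfolding Phi_def by (rule M.finsum_cong') (auto simp: x)

lemma Phi_0: "Phi t x (\<lambda>_. 0) = \<zero>\<^bsub>M\<^esub>"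
  using Phi_add[of "\<lambda>_. 0" "\<lambda>_. 0"] M.add.l_cancel_one'[of "Phi t x (\<lambda>_. 0)" "Phi t x (\<lambda>_. 0)"]
    Phi_closed by simp

lemma Phi_diff: "Phi t x u = Phi t x v \<oplus>\<^bsub>M\<^esub> Phi t x (\<lambda>j. u j - v j)"
  using Phi_add[of v "\<lambda>j. u j - v j"] by simp

lemma Phi_star: "Phi t x (\<lambda>j. star p (v j)) = b p \<odot>\<^bsub>M\<^esub> Phi t x v"
proof -
  have *: "b p \<odot>\<^bsub>M\<^esub> (\<Oplus>\<^bsub>M\<^esub>j\<in>A. f j) = (\<Oplus>\<^bsub>M\<^esub>j\<in>A. b p \<odot>\<^bsub>M\<^esub> f j)"
    if "finite A" "\<And>j. j \<in> A \<Longrightarrow> f j \<in> carrier M" for f and A :: "nat set"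
    using that by (induction A rule: finite_induct) (auto simp: smult_r_distr Pi_def)
  have "Phi t x (\<lambda>j. star p (v j)) = (\<Oplus>\<^bsub>M\<^esub>j\<in>{..<t}. b p \<odot>\<^bsub>M\<^esub> (b (v j) \<odot>\<^bsub>M\<^esub> x j))"
    unfolding Phi_def by (rule M.finsum_cong') (auto simp: x b_star smult_assoc1)
  also have "\<dots> = b p \<odot>\<^bsub>M\<^esub> Phi t x v" unfolding Phi_def by (rule *[symmetric]) (auto simp: x)
  finally show ?thesis .
qed

lemma submod_relations: "submod star t (relations t x)"
  unfolding submod_def relations_def
  by (auto simp: Phi_0 Phi_add Phi_star cong: Phi_cong)

lemma Phi_eq_iff: "Phi t x u = Phi t x v \<longleftrightarrow> (\<lambda>j. u j - v j) \<in> relations t x"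
proof -
  have "Phi t x v \<oplus>\<^bsub>M\<^esub> Phi t x (\<lambda>j. u j - v j) = Phi t x v \<longleftrightarrow> Phi t x (\<lambda>j. u j - v j) = \<zero>\<^bsub>M\<^esub>"
    by (rule M.add.l_cancel_one) (auto intro: Phi_closed)
  then show ?thesis by (simp add: relations_def Phi_diff[of u v])
qed

end

end

text \<open>A good filtration together with a choice of generators \<open>x\<close> in degrees \<open>q\<close>.\<close>

locale good_filtered = symbol_module R M b star w
  for R :: "'r ring" (structure) and M :: "('r, 'm) module" (structure)
    and b :: "('n::finite, 'k::field_char_0) polyXY \<Rightarrow> 'r" and star and w +
  fixes F :: "int \<Rightarrow> 'm set" and t :: nat and x :: "nat \<Rightarrow> 'm" and q :: "nat \<Rightarrow> int"
  assumes x: "\<And>j. j < t \<Longrightarrow> x j \<in> carrier M"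
    and F_eq: "F i = Phi t x ` vfilt w q t i"
    and filt: "module_filtration R FR M F"
begin

abbreviation L :: "('n, 'k) pvec set" where "L \<equiv> relations t x"

abbreviation \<Phi> :: "('n, 'k) pvec \<Rightarrow> 'm" where "\<Phi> \<equiv> Phi t x"

lemmas Phi_rules = Phi_closed[of t x, OF x] Phi_add[of t x, OF x] Phi_0[of t x, OF x] Phi_star[of t x, OF x]

lemma F_subgroup: "additive_subgroup (F i) M"
  using filt by (auto simp: module_filtration_def)

lemma F_abelian_subgroup: "abelian_subgroup (F i) M"
  by (rule abelian_subgroupI3[OF F_subgroup M.abelian_group_axioms])

lemma F_mono: "i \<le> j \<Longrightarrow> F i \<subseteq> F j"
  using filt by (auto simp: module_filtration_def)

lemma F_union: "(\<Union>i. F i) = carrier M"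
  using filt by (auto simp: module_filtration_def)

lemma F_smult: "p \<in> PF w i \<Longrightarrow> m \<in> F j \<Longrightarrow> b p \<odot>\<^bsub>M\<^esub> m \<in> F (i + j)"
  using filt by (auto simp: module_filtration_def)

lemma F_carrier: "m \<in> F i \<Longrightarrow> m \<in> carrier M"
  using F_union by blast

lemma F_add: "m \<in> F i \<Longrightarrow> m' \<in> F i \<Longrightarrow> m \<oplus>\<^bsub>M\<^esub> m' \<in> F i"
  using additive_subgroup.a_closed[OF F_subgroup] .

lemma F_0: "\<zero>\<^bsub>M\<^esub> \<in> F i"
  using additive_subgroup.zero_closed[OF F_subgroup] .

lemma F_Phi: "v \<in> vfilt w q t i \<Longrightarrow> \<Phi> v \<in> F i"
  unfolding F_eq by blast

lemma carrier_Phi: "m \<in> carrier M \<Longrightarrow> \<exists>v. m = \<Phi> v"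
  using F_union unfolding F_eq by blast

definition cls :: "int \<Rightarrow> 'm \<Rightarrow> 'm set" where
  "cls i m = F (i - 1) +>\<^bsub>M\<^esub> m"

lemma cls_self: "m \<in> carrier M \<Longrightarrow> m \<in> cls i m"
  unfolding cls_def by (rule abelian_subgroup.a_rcos_self[OF F_abelian_subgroup])

lemma cls_add_F: "m \<in> carrier M \<Longrightarrow> f \<in> F (i - 1) \<Longrightarrow> cls i (m \<oplus>\<^bsub>M\<^esub> f) = cls i m"
  unfolding cls_def
  by (rule abelian_subgroup.a_repr_independence'[OF F_abelian_subgroup, symmetric])
     (auto simp: a_r_coset_def' M.a_comm[of m] F_carrier)

lemma mem_cls: "m' \<in> cls i m \<longleftrightarrow> (\<exists>f\<in>F (i - 1). m' = f \<oplus>\<^bsub>M\<^esub> m)"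
  by (auto simp: cls_def a_r_coset_def')

lemma cls_eq_one: "m \<in> carrier M \<Longrightarrow> cls i m = F (i - 1) \<longleftrightarrow> m \<in> F (i - 1)"
  using cls_self[of m i] M.a_coset_join2[OF _ additive_subgroup.a_subgroup[OF F_subgroup], of m "i - 1"]
  unfolding cls_def by auto

lemma one_gr_piece: "\<one>\<^bsub>gr_piece M F i\<^esub> = F (i - 1)"
  by (simp add: gr_piece_def A_FactGroup_def FactGroup_def)

lemma carrier_gr_piece: "carrier (gr_piece M F i) = cls i ` F i"
  by (auto simp: gr_piece_def A_FactGroup_def FactGroup_def RCOSETS_def cls_def a_r_coset_def' r_coset_def)

lemma mult_gr_piece:
  "m \<in> F i \<Longrightarrow> m' \<in> F i \<Longrightarrow> cls i m \<otimes>\<^bsub>gr_piece M F i\<^esub> cls i m' = cls i (m \<oplus>\<^bsub>M\<^esub> m')"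
  using abelian_subgroup.a_rcos_sum[OF F_abelian_subgroup, of m m' "i - 1"]
  by (simp add: gr_piece_def A_FactGroup_def FactGroup_def set_add_def' set_mult_def cls_def F_carrier)

lemma cls_0: "cls i \<zero>\<^bsub>M\<^esub> = F (i - 1)"
  using cls_eq_one[of "\<zero>\<^bsub>M\<^esub>" i] F_0 by simp

lemma comm_group_gr_piece: "comm_group (gr_piece M F i)"
proof (rule comm_groupI)
  fix X assume "X \<in> carrier (gr_piece M F i)"
  then obtain m where m: "m \<in> F i" "X = cls i m" by (auto simp: carrier_gr_piece)
  have "\<ominus>\<^bsub>M\<^esub> m \<in> F i" by (rule additive_subgroup.a_inv_closed[OF F_subgroup m(1)])
  then show "\<exists>Y\<in>carrier (gr_piece M F i). Y \<otimes>\<^bsub>gr_piece M F i\<^esub> X = \<one>\<^bsub>gr_piece M F i\<^esub>"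
    using m by (intro bexI[of _ "cls i (\<ominus>\<^bsub>M\<^esub> m)"])
      (auto simp: mult_gr_piece one_gr_piece carrier_gr_piece F_carrier M.l_neg cls_0)
next
  show "\<one>\<^bsub>gr_piece M F i\<^esub> \<in> carrier (gr_piece M F i)"
    unfolding one_gr_piece carrier_gr_piece cls_0[symmetric] by (intro imageI F_0)
next
  fix X assume "X \<in> carrier (gr_piece M F i)"
  then obtain m where m: "m \<in> F i" "X = cls i m" by (auto simp: carrier_gr_piece)
  then have "cls i \<zero>\<^bsub>M\<^esub> \<otimes>\<^bsub>gr_piece M F i\<^esub> X = X"
    by (simp add: mult_gr_piece F_0 F_carrier)
  then show "\<one>\<^bsub>gr_piece M F i\<^esub> \<otimes>\<^bsub>gr_piece M F i\<^esub> X = X" by (simp add: one_gr_piece cls_0)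
qed (auto simp: carrier_gr_piece mult_gr_piece F_add M.a_ac F_carrier)

subsection \<open>The symbol map on generators\<close>

text \<open>The surjection of the free module onto the associated graded module that sends the basis
  vectors to the classes of the generators.\<close>

definition \<phi> :: "('n, 'k) pvec \<Rightarrow> int \<Rightarrow> 'm set" where
  "\<phi> v = (\<lambda>i. cls i (\<Phi> (vhom w q i v)))"

definition gr :: "(('n, 'k) polyXY, int \<Rightarrow> 'm set) module" where
  "gr = restrict_scalars symbol (gr_module R FR M F)"

lemma Phi_vhom_F: "\<Phi> (vhom w q i v) \<in> F i"
  by (intro F_Phi vhom_in_vfilt)

lemma cls_Phi_cong:
  assumes "(\<lambda>j. u j - v j) \<in> vfilt w q t (i - 1)"
  shows "cls i (\<Phi> u) = cls i (\<Phi> v)"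
  using cls_add_F[of "\<Phi> v" "\<Phi> (\<lambda>j. u j - v j)" i] F_Phi[OF assms] Phi_diff[of t x u v, OF x]
  by (simp add: Phi_rules)

lemma group_gr_piece: "group (gr_piece M F i)"
  using comm_group_gr_piece by (simp add: comm_group_def)

text \<open>Every element has only finitely many nonzero components; representatives of these, cut down to
  the right degree, add up to a vector.\<close>

lemma carrier_gr: "carrier gr = range \<phi>"
proof -
  have carr: "carrier gr = {X. (\<forall>i. X i \<in> cls i ` F i) \<and> finite {i. X i \<noteq> F (i - 1)}}"
    unfolding gr_def restrict_scalars_def gr_module_def
    by (simp add: carrier_sum_group[OF group_gr_piece] one_gr_piece carrier_gr_piece)
       (auto simp: PiE_iff carrier_gr_piece)
  show ?thesis
  proof (intro equalityI subsetI)
    fix X assume "X \<in> range \<phi>"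
    then obtain v where X: "X = \<phi> v" by blast
    have "X i = F (i - 1)" if "i \<notin> {i. \<exists>j<t. vhom w q i v j \<noteq> 0}" for i
    proof -
      have "\<Phi> (vhom w q i v) = \<Phi> (\<lambda>_. 0)" using that by (intro Phi_cong[of t x, OF x]) auto
      then show ?thesis by (simp add: X \<phi>_def Phi_rules cls_0)
    qed
    then have "{i. X i \<noteq> F (i - 1)} \<subseteq> {i. \<exists>j<t. vhom w q i v j \<noteq> 0}" by blast
    then have "finite {i. X i \<noteq> F (i - 1)}" by (rule finite_subset) (rule finite_vhom)
    then show "X \<in> carrier gr" by (auto simp: carr X \<phi>_def Phi_vhom_F)
  next
    fix X assume X: "X \<in> carrier gr"
    have "\<forall>i. \<exists>v. v \<in> vfilt w q t i \<and> X i = cls i (\<Phi> v)"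
    proof
      fix i
      have "X i \<in> cls i ` F i" using X carr by blast
      then show "\<exists>v. v \<in> vfilt w q t i \<and> X i = cls i (\<Phi> v)" unfolding F_eq by blast
    qed
    from choice[OF this] obtain v where v: "\<And>i. v i \<in> vfilt w q t i" "\<And>i. X i = cls i (\<Phi> (v i))" by blast
    let ?I = "{i. X i \<noteq> F (i - 1)}"
    let ?V = "\<lambda>j. \<Sum>i\<in>?I. vhom w q i (v i) j"
    have fin: "finite ?I" using X carr by blast
    have "X k = \<phi> ?V k" for k
    proof -
      have V: "vhom w q k ?V = (\<lambda>j. if k \<in> ?I then vhom w q k (v k) j else 0)"
      proof
        fix j
        have "vhom w q k ?V j = (\<Sum>i\<in>?I. if i = k then vhom w q k (v k) j else 0)"
          unfolding vhom_sum by (rule sum.cong) (auto simp: vhom_def hc_hc)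
        then show "vhom w q k ?V j = (if k \<in> ?I then vhom w q k (v k) j else 0)" using fin by simp
      qed
      show ?thesis
      proof (cases "k \<in> ?I")
        case True
        have "v k j - hc w (k - q j) (v k j) \<in> PF w (k - 1 - q j)" if "j < t" for j
          using v(1)[of k] that diff_hc[of "v k j" w "k - q j"] by (simp add: vfilt_def algebra_simps)
        then have "cls k (\<Phi> (v k)) = cls k (\<Phi> (vhom w q k (v k)))"
          by (intro cls_Phi_cong) (simp add: vfilt_def vhom_def)
        then show ?thesis using True unfolding \<phi>_def V by (simp add: v(2))
      next
        case False
        then show ?thesis unfolding \<phi>_def V by (simp add: Phi_rules cls_0)
      qed
    qed
    then show "X \<in> range \<phi>" by blast
  qed
qed

lemma add_gr: "\<phi> u \<oplus>\<^bsub>gr\<^esub> \<phi> v = \<phi> (\<lambda>j. u j + v j)"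
  unfolding gr_def restrict_scalars_def gr_module_def
  by (simp add: \<phi>_def mult_gr_piece Phi_vhom_F vhom_add Phi_rules fun_eq_iff)

lemma zero_gr: "\<zero>\<^bsub>gr\<^esub> = \<phi> (\<lambda>_. 0)"
  unfolding gr_def restrict_scalars_def gr_module_def
  by (simp add: \<phi>_def one_gr_piece vhom_def Phi_rules cls_0 fun_eq_iff)

lemma symbol_eq_one: "symbol p i = \<one>\<^bsub>gr_piece R FR i\<^esub> \<longleftrightarrow> hc w i p = 0"
proof -
  have "symbol p i = b ` ((\<lambda>c. c + hc w i p) ` PF w (i - 1))"
    by (simp add: symbol_def a_r_coset_def' image_image b_add UNION_singleton_eq_range)
  moreover have "\<one>\<^bsub>gr_piece R FR i\<^esub> = b ` PF w (i - 1)"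
    by (simp add: gr_piece_def A_FactGroup_def FactGroup_def)
  moreover have "inj b" using b_inj by (auto simp: inj_def)
  ultimately have "symbol p i = \<one>\<^bsub>gr_piece R FR i\<^esub> \<longleftrightarrow> (\<lambda>c. c + hc w i p) ` PF w (i - 1) = PF w (i - 1)"
    by (simp add: inj_image_eq_iff)
  also have "\<dots> \<longleftrightarrow> hc w i p \<in> PF w (i - 1)"
  proof
    assume "(\<lambda>c. c + hc w i p) ` PF w (i - 1) = PF w (i - 1)"
    moreover have "hc w i p \<in> (\<lambda>c. c + hc w i p) ` PF w (i - 1)"
      by (rule image_eqI[of _ _ 0]) simp_all
    ultimately show "hc w i p \<in> PF w (i - 1)" by blast
  next
    assume h: "hc w i p \<in> PF w (i - 1)"
    show "(\<lambda>c. c + hc w i p) ` PF w (i - 1) = PF w (i - 1)"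
    proof (intro equalityI subsetI)
      fix c :: "('n, 'k) polyXY" assume "c \<in> PF w (i - 1)"
      then show "c \<in> (\<lambda>c. c + hc w i p) ` PF w (i - 1)"
        using h by (intro image_eqI[of _ _ "c - hc w i p"]) (auto intro: PF_diff)
    qed (use h in \<open>auto intro: PF_add\<close>)
  qed
  also have "\<dots> \<longleftrightarrow> hc w i p = 0"
    using PF_minus_1_iff[OF hc_PF[of w i p]] by (simp add: hc_hc)
  finally show ?thesis .
qed

lemma coset_smult_symbol:
  assumes m: "m \<in> F (k - i)"
  shows "coset_smult M (F (k - 1)) (symbol p i) (cls (k - i) m) = cls k (b (hc w i p) \<odot>\<^bsub>M\<^esub> m)"
proof -
  let ?h = "hc w i p"
  have carr: "m' \<in> carrier M" if "m' \<in> cls (k - i) m" for m'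
    using that m by (auto simp: mem_cls F_carrier)
  have "F (k - 1) +>\<^bsub>M\<^esub> (r \<odot>\<^bsub>M\<^esub> m') = cls k (b ?h \<odot>\<^bsub>M\<^esub> m)"
    if r: "r \<in> symbol p i" and m': "m' \<in> cls (k - i) m" for r m'
  proof -
    obtain c where c: "c \<in> PF w (i - 1)" "r = b c \<oplus>\<^bsub>R\<^esub> b ?h"
      using r by (auto simp: symbol_def a_r_coset_def')
    obtain f where f: "f \<in> F (k - i - 1)" "m' = f \<oplus>\<^bsub>M\<^esub> m" using m' by (auto simp: mem_cls)
    have m'F: "m' \<in> F (k - i)" using f m F_mono[of "k - i - 1" "k - i"] by (auto intro: F_add)
    have e1: "b c \<odot>\<^bsub>M\<^esub> m' \<in> F (k - 1)" using F_smult[OF c(1) m'F] by simp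
    have e2: "b ?h \<odot>\<^bsub>M\<^esub> f \<in> F (k - 1)" using F_smult[OF hc_PF[of w i p] f(1)] by simp
    have "r \<odot>\<^bsub>M\<^esub> m' = b c \<odot>\<^bsub>M\<^esub> m' \<oplus>\<^bsub>M\<^esub> (b ?h \<odot>\<^bsub>M\<^esub> f \<oplus>\<^bsub>M\<^esub> b ?h \<odot>\<^bsub>M\<^esub> m)"
      using F_carrier[OF m] F_carrier[OF f(1)] F_carrier[OF m'F]
      by (simp add: c(2) smult_l_distr) (simp add: f(2) smult_r_distr)
    also have "\<dots> = b ?h \<odot>\<^bsub>M\<^esub> m \<oplus>\<^bsub>M\<^esub> (b c \<odot>\<^bsub>M\<^esub> m' \<oplus>\<^bsub>M\<^esub> b ?h \<odot>\<^bsub>M\<^esub> f)"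
      using F_carrier[OF m] F_carrier[OF e1] F_carrier[OF e2] by (simp add: M.a_ac)
    finally show ?thesis
      using cls_add_F[OF _ F_add[OF e1 e2], of "b ?h \<odot>\<^bsub>M\<^esub> m"] F_carrier[OF m] by (simp add: cls_def)
  qed
  moreover have "b ?h \<in> symbol p i"
    unfolding symbol_def a_r_coset_def' by (intro UN_I[of "b 0"] imageI) (simp_all add: b_0)
  moreover have "m \<in> cls (k - i) m" using cls_self F_carrier[OF m] by blast
  ultimately show ?thesis unfolding coset_smult_def by blast
qed

text \<open>The sum of the products of components with respect to \<open>star\<close> and the component of the
  commutative product differ by a vector of lower degree.\<close>

lemma smult_gr: "p \<odot>\<^bsub>gr\<^esub> \<phi> v = \<phi> (\<lambda>j. p * v j)"
proof
  fix k
  let ?I = "{i. hc w i p \<noteq> 0}"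
  interpret G: comm_group "gr_piece M F k" by (rule comm_group_gr_piece)
  have F: "\<Phi> (\<lambda>j. star (hc w i p) (vhom w q (k - i) v j)) \<in> F k" for i
    using F_smult[OF hc_PF[of w i p] Phi_vhom_F[of "k - i" v]] by (simp add: Phi_rules)
  have "(p \<odot>\<^bsub>gr\<^esub> \<phi> v) k = (\<Otimes>\<^bsub>gr_piece M F k\<^esub>i\<in>?I. coset_smult M (F (k - 1)) (symbol p i) (\<phi> v (k - i)))"
    unfolding gr_def restrict_scalars_def gr_module_def by (simp add: symbol_eq_one)
  also have "\<dots> = (\<Otimes>\<^bsub>gr_piece M F k\<^esub>i\<in>?I. cls k (\<Phi> (\<lambda>j. star (hc w i p) (vhom w q (k - i) v j))))"
    using F by (intro G.finprod_cong')
      (auto simp: \<phi>_def coset_smult_symbol Phi_vhom_F Phi_rules carrier_gr_piece)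
  also have "\<dots> = cls k (\<Phi> (\<lambda>j. \<Sum>i\<in>?I. star (hc w i p) (vhom w q (k - i) v j)))"
  proof -
    have "(\<Otimes>\<^bsub>gr_piece M F k\<^esub>i\<in>I. cls k (\<Phi> (\<lambda>j. star (hc w i p) (vhom w q (k - i) v j)))) =
        cls k (\<Phi> (\<lambda>j. \<Sum>i\<in>I. star (hc w i p) (vhom w q (k - i) v j))) \<and>
        \<Phi> (\<lambda>j. \<Sum>i\<in>I. star (hc w i p) (vhom w q (k - i) v j)) \<in> F k" if "finite I" for I
      using that
    proof (induction I rule: finite_induct)
      case empty
      then show ?case by (simp add: Phi_rules cls_0 one_gr_piece F_0)
    next
      case (insert i I)
      then show ?case using F
        by (simp add: carrier_gr_piece mult_gr_piece F_add Phi_rules(2))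
    qed
    then show ?thesis using finite_hc by blast
  qed
  also have "\<dots> = cls k (\<Phi> (vhom w q k (\<lambda>j. p * v j)))"
  proof (rule cls_Phi_cong)
    have "star (hc w i p) (vhom w q (k - i) v j) - hc w i p * vhom w q (k - i) v j \<in> PF w (k - 1 - q j)" for i j
      using star_leading[OF hc_PF[of w i p] hc_PF[of w "k - i - q j" "v j"]] by (simp add: vhom_def algebra_simps)
    then have "(\<lambda>j. \<Sum>i\<in>?I. star (hc w i p) (vhom w q (k - i) v j) - hc w i p * vhom w q (k - i) v j) \<in> vfilt w q t (k - 1)"
      by (auto simp: vfilt_def intro!: PF_sum)
    moreover have "vhom w q k (\<lambda>j. p * v j) j = (\<Sum>i\<in>?I. hc w i p * vhom w q (k - i) v j)" for j
      by (rule vhom_mult[OF finite_hc]) simp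
    ultimately show "(\<lambda>j. (\<Sum>i\<in>?I. star (hc w i p) (vhom w q (k - i) v j)) - vhom w q k (\<lambda>j. p * v j) j) \<in> vfilt w q t (k - 1)"
      by (simp add: sum_subtractf)
  qed
  finally show "(p \<odot>\<^bsub>gr\<^esub> \<phi> v) k = \<phi> (\<lambda>j. p * v j) k" by (simp add: \<phi>_def)
qed

text \<open>The module axioms are transported along the surjection \<open>\<phi>\<close> from the free module.\<close>

lemma left_module_gr: "left_module polyXY_ring gr"
proof -
  have neg: "\<exists>y\<in>carrier gr. y \<oplus>\<^bsub>gr\<^esub> \<phi> v = \<zero>\<^bsub>gr\<^esub>" for v
    by (rule bexI[of _ "\<phi> (\<lambda>j. - v j)"]) (auto simp: add_gr zero_gr carrier_gr)
  have "abelian_group gr"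
  proof (rule abelian_groupI)
    show "\<exists>y\<in>carrier gr. y \<oplus>\<^bsub>gr\<^esub> X = \<zero>\<^bsub>gr\<^esub>" if "X \<in> carrier gr" for X
      using that neg by (auto simp: carrier_gr)
  qed (auto simp: carrier_gr add_gr zero_gr add_ac)
  moreover have "ring (polyXY_ring :: ('n, 'k) polyXY ring)"
    using cring_polyXY_ring by (rule cring.axioms(1))
  ultimately show ?thesis
    by (intro left_module.intro left_module_axioms.intro)
       (auto simp: carrier_gr smult_gr add_gr polyXY_ring_def distrib_left distrib_right mult.assoc)
qed

subsection \<open>The annihilator of the associated graded module\<close>

text \<open>Thus the associated graded module is the quotient of the free module by the initial module
  of the relations.\<close>

lemma phi_eq_0_iff: "\<phi> v = \<phi> (\<lambda>_. 0) \<longleftrightarrow> v \<in> initial w q t L"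
proof -
  have "\<phi> v = \<phi> (\<lambda>_. 0) \<longleftrightarrow> (\<forall>k. cls k (\<Phi> (vhom w q k v)) = F (k - 1))"
    by (simp add: fun_eq_iff \<phi>_def vhom_def Phi_rules cls_0)
  also have "\<dots> \<longleftrightarrow> (\<forall>k. \<Phi> (vhom w q k v) \<in> F (k - 1))"
    by (simp add: cls_eq_one Phi_rules)
  also have "\<dots> \<longleftrightarrow> v \<in> initial w q t L"
  proof -
    have "\<Phi> (vhom w q k v) \<in> F (k - 1) \<longleftrightarrow> (\<exists>u\<in>L. u \<in> vfilt w q t k \<and> (\<forall>j<t. vhom w q k u j = vhom w q k v j))" for k
    proof
      assume "\<Phi> (vhom w q k v) \<in> F (k - 1)"
      then obtain y where y: "y \<in> vfilt w q t (k - 1)" "\<Phi> (vhom w q k v) = \<Phi> y" unfolding F_eq by blast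
      let ?u = "\<lambda>j. vhom w q k v j - y j"
      have "?u \<in> L" using y(2) Phi_eq_iff[of t x, OF x] by blast
      moreover have "?u \<in> vfilt w q t k"
        using y(1) by (intro vfilt_diff vhom_in_vfilt) (auto elim: vfilt_mono)
      moreover have "vhom w q k ?u j = vhom w q k v j" if "j < t" for j
        using y(1) that hc_eq_0[of "y j" w "k - 1 - q j" "k - q j"] by (simp add: vhom_def hc_diff hc_hc vfilt_def)
      ultimately show "\<exists>u\<in>L. u \<in> vfilt w q t k \<and> (\<forall>j<t. vhom w q k u j = vhom w q k v j)" by blast
    next
      assume "\<exists>u\<in>L. u \<in> vfilt w q t k \<and> (\<forall>j<t. vhom w q k u j = vhom w q k v j)"
      then obtain u where u: "u \<in> L" "u \<in> vfilt w q t k" "\<And>j. j < t \<Longrightarrow> vhom w q k u j = vhom w q k v j" by blast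
      let ?y = "\<lambda>j. vhom w q k v j - u j"
      have "?y \<in> vfilt w q t (k - 1)"
      proof -
        have *: "u j - hc w (k - q j) (u j) \<in> PF w (k - 1 - q j)" if "j < t" for j
          using u(2) that diff_hc[of "u j" w "k - q j"] by (simp add: vfilt_def algebra_simps)
        have "- (u j - hc w (k - q j) (u j)) \<in> PF w (k - 1 - q j)" if "j < t" for j
          using *[OF that] by (subst PF_uminus_iff)
        then show ?thesis using u(3) by (simp add: vfilt_def vhom_def)
      qed
      moreover have "\<Phi> (vhom w q k v) = \<Phi> ?y"
        using u(1) by (simp add: Phi_eq_iff[of t x, OF x])
      ultimately show "\<Phi> (vhom w q k v) \<in> F (k - 1)" using F_Phi by simp
    qed
    then show ?thesis by (simp add: initial_def)
  qed
  finally show ?thesis .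
qed

lemma annihilator_gr: "annihilator polyXY_ring gr = colon (initial w q t L)"
  by (auto simp: annihilator_def carrier_gr smult_gr zero_gr phi_eq_0_iff colon_def polyXY_ring_def)

lemma is_ideal_annihilator_gr: "is_ideal (colon (initial w q t L))"
proof (rule is_ideal_colon)
  show "submod (*) t (initial w q t L)"
  proof (rule submod_initial)
    note S = submod_relations[of t x, OF x]
    fix p i k v assume v: "v \<in> L" "v \<in> vfilt w q t k"
    have "star (hc w i p) (v j) - hc w i p * v j \<in> PF w (k + i - q j - 1)" if "j < t" for j
      using star_leading[OF hc_PF[of w i p], of "v j" "k - q j"] v(2) that by (simp add: vfilt_def algebra_simps)
    then show "\<exists>u\<in>L. \<forall>j<t. u j - hc w i p * v j \<in> PF w (k + i - q j - 1)"
      by (intro bexI[OF _ submod_mult[OF S v(1)]]) blast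
  qed (use submod_zero[OF submod_relations[of t x, OF x]] submod_add[OF submod_relations[of t x, OF x]] in auto)
qed

text \<open>In contrast to \<open>colon (initial w q t L)\<close>, this description of the annihilator mentions the
  filtration only, and not the generators; it allows filtrations to be compared.\<close>

lemma annihilates_iff:
  "p \<in> colon (initial w q t L) \<longleftrightarrow> (\<forall>d i. \<forall>m\<in>F i. b (hc w d p) \<odot>\<^bsub>M\<^esub> m \<in> F (i + d - 1))"
proof
  assume p: "p \<in> colon (initial w q t L)"
  show "\<forall>d i. \<forall>m\<in>F i. b (hc w d p) \<odot>\<^bsub>M\<^esub> m \<in> F (i + d - 1)"
  proof (intro allI ballI)
    fix d i m assume "m \<in> F i"
    then obtain v where v: "v \<in> vfilt w q t i" "m = \<Phi> v" unfolding F_eq by blast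
    let ?v = "vhom w q i v"
    have "(\<lambda>j. p * ?v j) \<in> initial w q t L" using p by (simp add: colon_def)
    then have "\<phi> (\<lambda>j. p * ?v j) = \<phi> (\<lambda>_. 0)" by (rule phi_eq_0_iff[THEN iffD2])
    then have "\<phi> (\<lambda>j. p * ?v j) (i + d) = \<phi> (\<lambda>_. 0) (i + d)" by (rule fun_cong)
    then have "cls (i + d) (\<Phi> (vhom w q (i + d) (\<lambda>j. p * ?v j))) = F (i + d - 1)"
      by (simp add: \<phi>_def vhom_def Phi_rules cls_0)
    moreover have "cls (i + d) (\<Phi> (\<lambda>j. star (hc w d p) (v j))) = cls (i + d) (\<Phi> (vhom w q (i + d) (\<lambda>j. p * ?v j)))"
    proof (rule cls_Phi_cong)
      have "star (hc w d p) (v j) - vhom w q (i + d) (\<lambda>j. p * ?v j) j \<in> PF w (i + d - 1 - q j)" if "j < t" for j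
      proof -
        have vj: "v j \<in> PF w (i - q j)" using v(1) that by (simp add: vfilt_def)
        have "hc w (i + d - q j) (p * hc w (i - q j) (v j)) = hc w (i + d - q j) (hc w (i - q j) (v j) * p)"
          by (simp add: mult.commute)
        also have "\<dots> = hc w (i - q j) (v j) * hc w (i + d - q j - (i - q j)) p" by (rule hc_mult_hom)
        finally have eq: "vhom w q (i + d) (\<lambda>j. p * ?v j) j = hc w d p * hc w (i - q j) (v j)"
          by (simp add: vhom_def mult.commute)
        have "star (hc w d p) (v j) - hc w d p * v j \<in> PF w (i + d - 1 - q j)"
          using star_leading[OF hc_PF[of w d p] vj] by (simp add: algebra_simps)
        moreover have "hc w d p * v j - hc w d p * hc w (i - q j) (v j) \<in> PF w (i + d - 1 - q j)"
          using PF_mult[OF hc_PF[of w d p] diff_hc[OF vj]] by (simp add: algebra_simps)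
        ultimately show ?thesis unfolding eq by (rule PF_trans)
      qed
      then show "(\<lambda>j. star (hc w d p) (v j) - vhom w q (i + d) (\<lambda>j. p * ?v j) j) \<in> vfilt w q t (i + d - 1)"
        by (simp add: vfilt_def)
    qed
    ultimately have "cls (i + d) (\<Phi> (\<lambda>j. star (hc w d p) (v j))) = F (i + d - 1)" by simp
    then show "b (hc w d p) \<odot>\<^bsub>M\<^esub> m \<in> F (i + d - 1)"
      by (subst (asm) cls_eq_one) (auto simp: Phi_rules v(2))
  qed
next
  assume *: "\<forall>d i. \<forall>m\<in>F i. b (hc w d p) \<odot>\<^bsub>M\<^esub> m \<in> F (i + d - 1)"
  show "p \<in> colon (initial w q t L)"
    unfolding colon_def phi_eq_0_iff[symmetric]
  proof (intro CollectI allI)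
    fix v
    have "(p \<odot>\<^bsub>gr\<^esub> \<phi> v) k = \<zero>\<^bsub>gr\<^esub> k" for k
    proof -
      interpret G: comm_group "gr_piece M F k" by (rule comm_group_gr_piece)
      have "(p \<odot>\<^bsub>gr\<^esub> \<phi> v) k = (\<Otimes>\<^bsub>gr_piece M F k\<^esub>i\<in>{i. hc w i p \<noteq> 0}. coset_smult M (F (k - 1)) (symbol p i) (\<phi> v (k - i)))"
        unfolding gr_def restrict_scalars_def gr_module_def by (simp add: symbol_eq_one)
      also have "\<dots> = (\<Otimes>\<^bsub>gr_piece M F k\<^esub>i\<in>{i. hc w i p \<noteq> 0}. \<one>\<^bsub>gr_piece M F k\<^esub>)"
      proof (rule G.finprod_cong')
        fix i
        have "b (hc w i p) \<odot>\<^bsub>M\<^esub> \<Phi> (vhom w q (k - i) v) \<in> F (k - 1)"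
          using *[rule_format, OF Phi_vhom_F[of "k - i" v], of i] by simp
        then show "coset_smult M (F (k - 1)) (symbol p i) (\<phi> v (k - i)) = \<one>\<^bsub>gr_piece M F k\<^esub>"
          by (simp add: \<phi>_def coset_smult_symbol Phi_vhom_F one_gr_piece cls_eq_one F_carrier)
      qed auto
      also have "\<dots> = \<one>\<^bsub>gr_piece M F k\<^esub>" by simp
      finally show ?thesis
        by (simp add: zero_gr \<phi>_def vhom_def Phi_rules cls_0 one_gr_piece)
    qed
    then show "\<phi> (\<lambda>j. p * v j) = \<phi> (\<lambda>_. 0)" unfolding smult_gr zero_gr[symmetric] by blast
  qed
qed

text \<open>Any filtration contains a good one up to a shift of degrees: it suffices to place the finitely
  many generators.\<close>

lemma filtration_bounded:
  assumes "\<And>j. j < t \<Longrightarrow> \<exists>c. x j \<in> F' c" and F': "module_filtration R FR M F'"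
  shows "\<exists>c \<ge> 0. \<forall>i. F i \<subseteq> F' (i + c)"
proof -
  have "\<forall>j. \<exists>c. j < t \<longrightarrow> x j \<in> F' c" using assms(1) by blast
  from choice[OF this] obtain c where c: "\<And>j. j < t \<Longrightarrow> x j \<in> F' (c j)" by blast
  define C where "C = (\<Sum>j<t. \<bar>c j - q j\<bar>)"
  have F'_sub: "additive_subgroup (F' i) M" "i \<le> j \<Longrightarrow> F' i \<subseteq> F' j" for i j
    using F' by (auto simp: module_filtration_def)
  have F'_smult: "b p \<odot>\<^bsub>M\<^esub> m \<in> F' (i + j)" if "p \<in> PF w i" "m \<in> F' j" for p m i j
    using F' that by (auto simp: module_filtration_def)
  have "\<Phi> v \<in> F' (i + C)" if v: "v \<in> vfilt w q t i" for v i
  proof -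
    have mem: "b (v j) \<odot>\<^bsub>M\<^esub> x j \<in> F' (i + C)" if j: "j < t" for j
    proof -
      have "v j \<in> PF w (i - q j)" using v j by (simp add: vfilt_def)
      then have "b (v j) \<odot>\<^bsub>M\<^esub> x j \<in> F' (i - q j + c j)" using c[OF j] by (rule F'_smult)
      moreover have "\<bar>c j - q j\<bar> \<le> C" unfolding C_def using j by (intro member_le_sum) auto
      then have "i - q j + c j \<le> i + C" by linarith
      ultimately show ?thesis using F'_sub(2) by blast
    qed
    have "(\<Oplus>\<^bsub>M\<^esub>j\<in>A. b (v j) \<odot>\<^bsub>M\<^esub> x j) \<in> F' (i + C)" if "A \<subseteq> {..<t}" for A
      using finite_subset[OF that finite_lessThan] that
    proof (induction A rule: finite_induct)
      case empty
      show ?case using additive_subgroup.zero_closed[OF F'_sub(1)] by simp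
    next
      case (insert j A)
      then have "(\<Oplus>\<^bsub>M\<^esub>j\<in>insert j A. b (v j) \<odot>\<^bsub>M\<^esub> x j) = b (v j) \<odot>\<^bsub>M\<^esub> x j \<oplus>\<^bsub>M\<^esub> (\<Oplus>\<^bsub>M\<^esub>j\<in>A. b (v j) \<odot>\<^bsub>M\<^esub> x j)"
        by (intro M.finsum_insert) (auto simp: x)
      then show ?case using insert mem additive_subgroup.a_closed[OF F'_sub(1)] by auto
    qed
    from this[OF subset_refl] show ?thesis by (simp add: Phi_def)
  qed
  then have "\<forall>i. F i \<subseteq> F' (i + C)" unfolding F_eq by blast
  moreover have "C \<ge> 0" unfolding C_def by (rule sum_nonneg) simp
  ultimately show ?thesis by blast
qed

text \<open>If \<open>p\<close> annihilates the graded module, a component of \<open>p\<^sup>n\<close> lowers the filtration by \<open>n\<close>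
  steps, but only after a correction by a ring element of smaller degree, because the products of
  components are formed in the noncommutative ring.\<close>

lemma power_lowers_degree:
  assumes p: "p \<in> colon (initial w q t L)"
  shows "\<exists>s. (\<forall>i. \<forall>m\<in>F i. b s \<odot>\<^bsub>M\<^esub> m \<in> F (i + d - int n)) \<and> hc w d (p ^ n) - s \<in> PF w (d - 1)"
proof (induction n arbitrary: d)
  case 0
  have "hc w d (1 :: ('n, 'k) polyXY) = (if d = 0 then 1 else 0)" by (simp add: hc_single wt_def flip: single_one)
  then have "b (hc w d 1) \<odot>\<^bsub>M\<^esub> m \<in> F (i + d - int 0)" if "m \<in> F i" for i m
    using that by (cases "d = 0") (simp_all add: b_one b_0 F_carrier F_0)
  then show ?case by (intro exI[of _ "hc w d 1"]) simp
next
  case (Suc n)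
  then have "\<forall>e. \<exists>s. (\<forall>i. \<forall>m\<in>F i. b s \<odot>\<^bsub>M\<^esub> m \<in> F (i + e - int n)) \<and> hc w e (p ^ n) - s \<in> PF w (e - 1)" by blast
  from choice[OF this] obtain s where s: "\<And>e i m. m \<in> F i \<Longrightarrow> b (s e) \<odot>\<^bsub>M\<^esub> m \<in> F (i + e - int n)"
    "\<And>e. hc w e (p ^ n) - s e \<in> PF w (e - 1)" by blast
  have s_in: "s e \<in> PF w e" for e
    using PF_cong[OF PF_mono[OF s(2)[of e]], of e] hc_PF[of w e "p ^ n"] by simp
  let ?I = "{i. hc w i p \<noteq> 0}"
  let ?s = "\<Sum>e\<in>?I. star (hc w e p) (s (d - e))"
  have product: "b (star (hc w e p) (s (d - e))) \<odot>\<^bsub>M\<^esub> m \<in> F (i + d - int (Suc n))" if m: "m \<in> F i" for e i m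
  proof -
    have "b (s (d - e)) \<odot>\<^bsub>M\<^esub> m \<in> F (i + (d - e) - int n)" using s(1)[OF m] .
    then have "b (hc w e p) \<odot>\<^bsub>M\<^esub> (b (s (d - e)) \<odot>\<^bsub>M\<^esub> m) \<in> F (i + (d - e) - int n + e - 1)"
      using p by (simp only: annihilates_iff)
    then show ?thesis using m by (simp add: b_star smult_assoc1 F_carrier algebra_simps)
  qed
  have "b (\<Sum>e\<in>I. star (hc w e p) (s (d - e))) \<odot>\<^bsub>M\<^esub> m \<in> F (i + d - int (Suc n))" if "finite I" "m \<in> F i" for I i m
    using that
    by (induction I rule: finite_induct) (auto simp: b_0 F_carrier F_0 b_add smult_l_distr product simp del: of_nat_Suc intro!: F_add)
  moreover have "hc w d (p ^ Suc n) - ?s \<in> PF w (d - 1)"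
  proof -
    have "hc w e p * hc w (d - e) (p ^ n) - star (hc w e p) (s (d - e)) \<in> PF w (d - 1)" for e
    proof (rule PF_trans)
      show "hc w e p * hc w (d - e) (p ^ n) - hc w e p * s (d - e) \<in> PF w (d - 1)"
        using PF_mult[OF hc_PF[of w e p] s(2)[of "d - e"]] by (simp add: algebra_simps)
      have "- (star (hc w e p) (s (d - e)) - hc w e p * s (d - e)) \<in> PF w (d - 1)"
        using star_leading[OF hc_PF[of w e p] s_in[of "d - e"]] by (subst PF_uminus_iff) simp
      then show "hc w e p * s (d - e) - star (hc w e p) (s (d - e)) \<in> PF w (d - 1)" by simp
    qed
    then have "(\<Sum>e\<in>?I. hc w e p * hc w (d - e) (p ^ n) - star (hc w e p) (s (d - e))) \<in> PF w (d - 1)"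
      by (intro PF_sum)
    then show ?thesis by (simp add: hc_mult[OF finite_hc] sum_subtractf)
  qed
  ultimately show ?case using finite_hc by blast
qed

end

text \<open>Two good filtrations differ by shifts \<open>c\<close> and \<open>c'\<close> at most. An operator lowering the first one
  by more than \<open>c + c'\<close> steps lowers the second one; the correction in \<open>power_lowers_degree\<close> lowers every
  filtration by one step anyway.\<close>

lemma rad_good_filtered_mono:
  fixes b :: "('n::finite, 'k::field_char_0) polyXY \<Rightarrow> 'r"
  assumes "good_filtered R M b star w F t x q" "good_filtered R M b star w F' t' x' q'"
  shows "rad (annihilator polyXY_ring (good_filtered.gr R M b w F))
     \<subseteq> rad (annihilator polyXY_ring (good_filtered.gr R M b w F'))"
proof -
  interpret A: good_filtered R M b star w F t x q by fact
  interpret B: good_filtered R M b star w F' t' x' q' by fact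
  have "\<exists>c. x j \<in> F' c" if "j < t" for j using A.x[OF that] B.F_union by blast
  then obtain c where c: "c \<ge> 0" "\<And>i. F i \<subseteq> F' (i + c)" using A.filtration_bounded[OF _ B.filt] by blast
  have "\<exists>c. x' j \<in> F c" if "j < t'" for j using B.x[OF that] A.F_union by blast
  then obtain c' where c': "c' \<ge> 0" "\<And>i. F' i \<subseteq> F (i + c')" using B.filtration_bounded[OF _ A.filt] by blast
  show ?thesis
    unfolding A.annihilator_gr B.annihilator_gr
  proof (rule rad_subsetI)
    fix p assume p: "p \<in> colon (initial w q t A.L)"
    \<comment> \<open>\<open>c + c'\<close> steps make up for the passage between the filtrations, one more lowers the degree\<close>
    let ?n = "nat (c + c' + 1)"
    have "p ^ ?n \<in> colon (initial w q' t' B.L)"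
      unfolding B.annihilates_iff
    proof (intro allI ballI)
      fix d i m assume m: "m \<in> F' i"
      obtain s where s: "\<And>i m. m \<in> F i \<Longrightarrow> b s \<odot>\<^bsub>M\<^esub> m \<in> F (i + d - int ?n)"
        and low: "hc w d (p ^ ?n) - s \<in> PF w (d - 1)" using A.power_lowers_degree[OF p, of d ?n] by blast
      have "b s \<odot>\<^bsub>M\<^esub> m \<in> F (i + c' + d - int ?n)" using m c'(2) by (intro s) blast
      then have "b s \<odot>\<^bsub>M\<^esub> m \<in> F' (i + c' + d - int ?n + c)" using c(2) by blast
      then have 1: "b s \<odot>\<^bsub>M\<^esub> m \<in> F' (i + d - 1)" using c(1) c'(1) by (simp add: algebra_simps)
      have 2: "b (hc w d (p ^ ?n) - s) \<odot>\<^bsub>M\<^esub> m \<in> F' (i + d - 1)"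
        using B.F_smult[OF low m] by (simp add: algebra_simps)
      have "hc w d (p ^ ?n) = (hc w d (p ^ ?n) - s) + s" by simp
      then have "b (hc w d (p ^ ?n)) \<odot>\<^bsub>M\<^esub> m = b (hc w d (p ^ ?n) - s) \<odot>\<^bsub>M\<^esub> m \<oplus>\<^bsub>M\<^esub> b s \<odot>\<^bsub>M\<^esub> m"
        using A.b_add A.smult_l_distr[OF A.b_closed A.b_closed B.F_carrier[OF m]] by metis
      then show "b (hc w d (p ^ ?n)) \<odot>\<^bsub>M\<^esub> m \<in> F' (i + d - 1)" using B.F_add[OF 2 1] by simp
    qed
    moreover have "?n > 0" using c(1) c'(1) by simp
    ultimately show "\<exists>m>0. p ^ m \<in> colon (initial w q' t' B.L)" by blast
  qed
qed

section \<open>Presentations of finitely generated modules\<close>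

context symbol_module
begin

lemma good_filtration_imp_good_filtered:
  assumes "good_filtration R FR M F"
  shows "\<exists>t x q. good_filtered R M b star w F t x q"
proof -
  from assms obtain t :: nat and x :: "nat \<Rightarrow> 'm" and q :: "nat \<Rightarrow> int" where filt: "module_filtration R FR M F"
    and x: "\<And>j. j < t \<Longrightarrow> x j \<in> carrier M"
    and F: "\<And>i. F i = {(\<Oplus>\<^bsub>M\<^esub>j\<in>{..<t}. r j \<odot>\<^bsub>M\<^esub> x j) | r. \<forall>j<t. r j \<in> FR (i - q j)}"
    unfolding good_filtration_def by blast
  have "F i = Phi t x ` vfilt w q t i" for i
  proof (intro equalityI subsetI)
    fix m assume "m \<in> F i"
    then obtain r where r: "m = (\<Oplus>\<^bsub>M\<^esub>j\<in>{..<t}. r j \<odot>\<^bsub>M\<^esub> x j)" "\<And>j. j < t \<Longrightarrow> r j \<in> FR (i - q j)"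
      unfolding F by blast
    then have "\<forall>j. \<exists>v. j < t \<longrightarrow> v \<in> PF w (i - q j) \<and> r j = b v" by blast
    from choice[OF this] obtain v where v: "\<And>j. j < t \<Longrightarrow> v j \<in> PF w (i - q j) \<and> r j = b (v j)" by blast
    have "m = Phi t x v"
      unfolding r(1) Phi_def by (rule M.finsum_cong') (auto simp: v x)
    then show "m \<in> Phi t x ` vfilt w q t i" using v by (auto simp: vfilt_def)
  next
    fix m assume "m \<in> Phi t x ` vfilt w q t i"
    then obtain v where "v \<in> vfilt w q t i" "m = Phi t x v" by blast
    then show "m \<in> F i" unfolding F Phi_def vfilt_def by (intro CollectI exI[of _ "\<lambda>j. b (v j)"]) auto
  qed
  then have "good_filtered R M b star w F t x q"
    using x filt by unfold_locales auto
  then show ?thesis by blast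
qed

lemma finitely_generated_imp_presentation:
  assumes "finitely_generated R M"
  shows "\<exists>t x. (\<forall>j<t. x j \<in> carrier M) \<and> carrier M = range (Phi t x)"
proof -
  from assms obtain G where G: "finite G" "G \<subseteq> carrier M"
    and gen: "carrier M = {(\<Oplus>\<^bsub>M\<^esub>g\<in>G. r g \<odot>\<^bsub>M\<^esub> g) | r. r \<in> G \<rightarrow> carrier R}"
    unfolding finitely_generated_def by blast
  obtain h where h: "bij_betw h {..<card G} G" using ex_bij_betw_nat_finite[OF G(1)] by (auto simp: atLeast0LessThan)
  then have hG: "\<And>j. j < card G \<Longrightarrow> h j \<in> G" and inj: "inj_on h {..<card G}" and img: "h ` {..<card G} = G"
    by (auto simp: bij_betw_def)
  have x: "\<And>j. j < card G \<Longrightarrow> h j \<in> carrier M" using hG G(2) by blast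
  have "m \<in> range (Phi (card G) h)" if m: "m \<in> carrier M" for m
  proof -
    from m gen obtain r where r: "m = (\<Oplus>\<^bsub>M\<^esub>g\<in>G. r g \<odot>\<^bsub>M\<^esub> g)" "r \<in> G \<rightarrow> carrier R" by auto
    have "\<forall>j. \<exists>v. j < card G \<longrightarrow> r (h j) = b v" using b_surj r(2) hG by blast
    from choice[OF this] obtain v where v: "\<And>j. j < card G \<Longrightarrow> r (h j) = b (v j)" by blast
    have "m = (\<Oplus>\<^bsub>M\<^esub>g\<in>h ` {..<card G}. r g \<odot>\<^bsub>M\<^esub> g)" using r(1) img by simp
    also have "\<dots> = (\<Oplus>\<^bsub>M\<^esub>j\<in>{..<card G}. r (h j) \<odot>\<^bsub>M\<^esub> h j)"
      by (rule M.finsum_reindex[OF _ inj]) (use r(2) G(2) img in auto)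
    also have "\<dots> = Phi (card G) h v"
      unfolding Phi_def by (rule M.finsum_cong') (auto simp: v x)
    finally show ?thesis by simp
  qed
  moreover have "Phi (card G) h v \<in> carrier M" for v by (rule Phi_closed[of "card G" h, OF x])
  ultimately show ?thesis using x by (intro exI[of _ "card G"] exI[of _ h]) auto
qed

text \<open>All generators are placed in degree \<open>0\<close>, for every weight; so the module of relations is the
  same for all weights.\<close>

lemma standard_filtration:
  assumes x: "\<And>j. j < t \<Longrightarrow> x j \<in> carrier M" and gen: "carrier M = range (Phi t x)"
  shows "good_filtered R M b star w (\<lambda>i. Phi t x ` vfilt w (\<lambda>_. 0) t i) t x (\<lambda>_. 0)"
proof
  note rules = Phi_closed[of t x, OF x] Phi_add[of t x, OF x] Phi_0[of t x, OF x] Phi_star[of t x, OF x]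
  let ?F = "\<lambda>i. Phi t x ` vfilt w (\<lambda>_. 0) t i"
  show "module_filtration R FR M ?F"
    unfolding module_filtration_def
  proof (intro conjI allI impI ballI)
    fix i
    show "additive_subgroup (?F i) M"
    proof (rule additive_subgroup.intro, rule group.subgroupI)
      show "group (add_monoid M)" by (rule M.add.is_group)
      show "?F i \<subseteq> carrier (add_monoid M)" using rules(1) by auto
      have "(\<lambda>_. 0) \<in> vfilt w (\<lambda>_. 0) t i" by (simp add: vfilt_def)
      then show "?F i \<noteq> {}" by blast
    next
      fix m assume "m \<in> ?F i"
      then obtain v where v: "v \<in> vfilt w (\<lambda>_. 0) t i" "m = Phi t x v" by blast
      have "Phi t x (\<lambda>j. - v j) \<oplus>\<^bsub>M\<^esub> m = \<zero>\<^bsub>M\<^esub>"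
        using rules(2)[of "\<lambda>j. - v j" v] by (simp add: v(2) rules(3))
      then have "\<ominus>\<^bsub>M\<^esub> m = Phi t x (\<lambda>j. - v j)"
        by (intro M.minus_equality) (auto simp: rules v(2))
      moreover have "(\<lambda>j. - v j) \<in> vfilt w (\<lambda>_. 0) t i" using v(1) by (simp add: vfilt_def)
      ultimately show "inv\<^bsub>add_monoid M\<^esub> m \<in> ?F i" by (simp flip: a_inv_def)
    next
      fix m m' assume "m \<in> ?F i" "m' \<in> ?F i"
      then obtain v v' where "v \<in> vfilt w (\<lambda>_. 0) t i" "m = Phi t x v" "v' \<in> vfilt w (\<lambda>_. 0) t i" "m' = Phi t x v'"
        by blast
      then show "m \<otimes>\<^bsub>add_monoid M\<^esub> m' \<in> ?F i"
        by (intro image_eqI[of _ _ "\<lambda>j. v j + v' j"]) (auto simp: rules vfilt_add)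
    qed
  next
    fix i j :: int assume "i \<le> j"
    then show "?F i \<subseteq> ?F j" by (intro image_mono subsetI) (rule vfilt_mono)
  next
    have "\<exists>i. v \<in> vfilt w (\<lambda>_. 0) t i" for v :: "('n, 'k) pvec"
    proof -
      have "\<forall>j. \<exists>i. v j \<in> PF w i" using PF_exists by blast
      from choice[OF this] obtain d where d: "\<And>j. v j \<in> PF w (d j)" by blast
      have "v j \<in> PF w (\<Sum>j<t. \<bar>d j\<bar>)" if "j < t" for j
      proof (rule PF_mono[OF d])
        have "\<bar>d j\<bar> \<le> (\<Sum>j<t. \<bar>d j\<bar>)" using that by (intro member_le_sum) auto
        then show "d j \<le> (\<Sum>j<t. \<bar>d j\<bar>)" by simp
      qed
      then show ?thesis by (intro exI[of _ "\<Sum>j<t. \<bar>d j\<bar>"]) (simp add: vfilt_def)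
    qed
    then show "(\<Union>i. ?F i) = carrier M" unfolding gen by blast
  next
    fix i j r m assume "r \<in> FR i" "m \<in> ?F j"
    then obtain p v where p: "p \<in> PF w i" "r = b p" and v: "v \<in> vfilt w (\<lambda>_. 0) t j" "m = Phi t x v" by blast
    have "(\<lambda>l. star p (v l)) \<in> vfilt w (\<lambda>_. 0) t (i + j)"
    proof -
      have "star p (v l) \<in> PF w (i + j)" if "l < t" for l
      proof -
        have "v l \<in> PF w j" using v(1) that by (simp add: vfilt_def)
        then have "p * v l \<in> PF w (i + j)" and "star p (v l) - p * v l \<in> PF w (i + j - 1)"
          by (rule PF_mult[OF p(1)], rule star_leading[OF p(1)])
        then show ?thesis using PF_cong[OF PF_mono[of "star p (v l) - p * v l" w "i + j - 1" "i + j"]] by simp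
      qed
      then show ?thesis by (simp add: vfilt_def)
    qed
    moreover have "r \<odot>\<^bsub>M\<^esub> m = Phi t x (\<lambda>l. star p (v l))" by (simp add: p(2) v(2) rules(4))
    ultimately show "r \<odot>\<^bsub>M\<^esub> m \<in> ?F (i + j)" by blast
  qed
qed (use x in auto)

end

section \<open>The two instances: the Weyl algebra and the polynomial ring\<close>

lemma weyl_filtration_eq: "weyl_filtration w i = weyl_of_poly ` PF w i"
proof -
  have "weyl_supp (weyl_of_poly p) = keys p" for p :: "('a, 'b) polyXY"
    by (simp add: weyl_supp_def the_inv_f_f inj_weyl_of_poly)
  moreover have "carrier (weyl_algebra :: ('a, 'b) diffop ring) = Set.range (weyl_of_poly :: ('a, 'b) polyXY \<Rightarrow> _)"
    by (rule bij_betw_imp_surj_on[OF bij_weyl_of_poly, symmetric])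
  ultimately show ?thesis
    by (auto simp: weyl_filtration_def poly_filtration_def)
qed

lemma symbol_module_weyl:
  assumes "left_module weyl_algebra M" "w \<in> Omega"
  shows "symbol_module weyl_algebra M weyl_of_poly wmul w"
proof (intro symbol_module.intro symbol_module_axioms.intro)
  show "weyl_of_poly (1 :: ('a, 'b) polyXY) = \<one>\<^bsub>weyl_algebra\<^esub>"
  proof -
    have "weyl_of_poly (single 0 1 :: ('a, 'b) polyXY) f = f" for f
      by (simp only: weyl_of_poly_single weyl_monomial_0 scalar_def) simp
    then show ?thesis by (simp add: fun_eq_iff weyl_algebra_def)
  qed
qed (use assms in \<open>simp_all add: bij_weyl_of_poly wmul_leading\<close>,
     simp_all add: weyl_of_poly_wmul weyl_of_poly_add weyl_algebra_def fun_eq_iff)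

lemma symbol_module_poly:
  assumes "left_module polyXY_ring N"
  shows "symbol_module polyXY_ring N id (*) w"
  using assms
  by (intro symbol_module.intro symbol_module_axioms.intro)
     (assumption, simp_all add: polyXY_ring_def bij_betw_def)

lemma rad_ann_eq_rad: "rad_ann N = rad (annihilator polyXY_ring N)"
proof -
  interpret cring polyXY_ring by (rule cring_polyXY_ring)
  have "p [^]\<^bsub>polyXY_ring\<^esub> k = p ^ k" for p :: "('a, 'b) polyXY" and k :: nat
  proof (induction k)
    case (Suc k)
    have "p [^]\<^bsub>polyXY_ring\<^esub> Suc k = p [^]\<^bsub>polyXY_ring\<^esub> k \<otimes>\<^bsub>polyXY_ring\<^esub> p" by (rule nat_pow_Suc)
    then show ?case using Suc by (simp add: polyXY_ring_def mult.commute)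
  qed (simp, simp add: polyXY_ring_def)
  then show ?thesis by (auto simp: rad_ann_def radical_def rad_def polyXY_ring_def)
qed

lemma good_weyl_filtered:
  assumes "left_module weyl_algebra M" "w \<in> Omega" "good_weyl_filtration w M F"
  obtains t x q where "good_filtered weyl_algebra M weyl_of_poly wmul w F t x q"
    and "gr_weyl w M F = good_filtered.gr weyl_algebra M weyl_of_poly w F"
proof -
  interpret symbol_module weyl_algebra M weyl_of_poly wmul w by (rule symbol_module_weyl[OF assms(1,2)])
  have FR: "weyl_filtration w = FR" by (rule ext) (rule weyl_filtration_eq)
  obtain t x q where g: "good_filtered weyl_algebra M weyl_of_poly wmul w F t x q"
    using good_filtration_imp_good_filtered assms(3) unfolding FR by blast
  have "weyl_symbol w = symbol" by (simp add: fun_eq_iff weyl_symbol_def symbol_def FR)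
  then have "gr_weyl w M F = good_filtered.gr weyl_algebra M weyl_of_poly w F"
    unfolding gr_weyl_def good_filtered.gr_def[OF g] FR by simp
  then show ?thesis using g that by blast
qed

lemma good_poly_filtered:
  assumes "left_module polyXY_ring N" "good_poly_filtration w N F"
  obtains t x q where "good_filtered polyXY_ring N id (*) w F t x q"
    and "gr_poly w N F = good_filtered.gr polyXY_ring N id w F"
proof -
  interpret symbol_module polyXY_ring N id "(*)" w by (rule symbol_module_poly[OF assms(1)])
  obtain t x q where g: "good_filtered polyXY_ring N id (*) w F t x q"
    using good_filtration_imp_good_filtered[of F] assms(2) by auto
  have "poly_symbol w = symbol" by (simp add: fun_eq_iff poly_symbol_def symbol_def)
  then have "gr_poly w N F = good_filtered.gr polyXY_ring N id w F"
    unfolding gr_poly_def good_filtered.gr_def[OF g] by simp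
  then show ?thesis using g that by blast
qed

text \<open>The graded module of \<open>N\<close> enters the radical only through the annihilator of \<open>N\<close>, in the form
  of its initial ideal. For this reason the radicals belonging to iterated graded modules are
  independent of the choices of filtrations.\<close>

lemma rad_ann_gr_poly:
  assumes N: "left_module polyXY_ring N" and "good_poly_filtration w N F"
  shows "rad_ann (gr_poly w N F) = rad (initial_ideal w (annihilator polyXY_ring N))"
proof -
  obtain t x q where "good_filtered polyXY_ring N id (*) w F t x q"
    and gr: "gr_poly w N F = good_filtered.gr polyXY_ring N id w F"
    using good_poly_filtered[OF assms] by blast
  then interpret good_filtered polyXY_ring N id "(*)" w F t x q by simp
  have "annihilator polyXY_ring N = colon L"
  proof -
    have "p \<in> annihilator polyXY_ring N \<longleftrightarrow> (\<forall>v. p \<odot>\<^bsub>N\<^esub> \<Phi> v = \<zero>\<^bsub>N\<^esub>)" for p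
      using carrier_Phi Phi_rules(1) by (auto simp: annihilator_def polyXY_ring_def)
    then show ?thesis using Phi_rules(4) by (auto simp: colon_def relations_def)
  qed
  then show ?thesis
    using rad_initial_ideal_colon[OF submod_relations[of t x, OF x], of w q]
    by (simp add: rad_ann_eq_rad gr annihilator_gr)
qed

theorem theorem4p9:
  fixes M :: "(('n::finite, 'k::field_char_0) diffop, 'm) module"
  assumes "left_module weyl_algebra M"
    and "finitely_generated weyl_algebra M"
  shows "\<forall>\<nu> :: 'n weight. \<exists>s\<^sub>\<nu> :: nat. \<forall>\<omega> \<in> Omega. \<forall>s :: nat. s > s\<^sub>\<nu> \<longrightarrow>
    (\<forall>F F1 F2 G G1.
       good_weyl_filtration \<omega> M F \<and>
       good_poly_filtration \<nu> (gr_weyl \<omega> M F) G \<and>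
       good_weyl_filtration (\<lambda>i. \<nu> i + s * \<omega> i) M F1 \<and>
       good_poly_filtration \<nu> (gr_weyl (\<lambda>i. \<nu> i + s * \<omega> i) M F1) G1 \<and>
       good_weyl_filtration (\<lambda>i. \<nu> i + s * \<omega> i) M F2 \<longrightarrow>
       rad_ann (gr_poly \<nu> (gr_weyl \<omega> M F) G)
         = rad_ann (gr_poly \<nu> (gr_weyl (\<lambda>i. \<nu> i + s * \<omega> i) M F1) G1) \<and>
       rad_ann (gr_poly \<nu> (gr_weyl (\<lambda>i. \<nu> i + s * \<omega> i) M F1) G1)
         = rad_ann (gr_weyl (\<lambda>i. \<nu> i + s * \<omega> i) M F2))"
proof
  fix \<nu> :: "'n weight"
  let ?q = "\<lambda>_ :: nat. 0 :: int"
  \<comment> \<open>generators and relations do not depend on the weight; any element of \<open>Omega\<close> gives access to them\<close>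
  have "(\<lambda>_. 1) \<in> (Omega :: 'n weight set)" by (simp add: Omega_def)
  then interpret W: symbol_module weyl_algebra M weyl_of_poly wmul "\<lambda>_. 1"
    by (rule symbol_module_weyl[OF assms(1)])
  obtain t x where x: "\<And>j. j < t \<Longrightarrow> x j \<in> carrier M" and gen: "carrier M = Set.range (W.Phi t x)"
    using W.finitely_generated_imp_presentation[OF assms(2)] by blast
  define L where "L = W.relations t x"
  have L: "submod wmul t L" unfolding L_def by (rule W.submod_relations[of t x, OF x])
  have weyl: "left_module polyXY_ring (gr_weyl w M F)"
    "is_ideal (annihilator polyXY_ring (gr_weyl w M F))"
    "is_ideal (colon (initial w ?q t L))"
    "rad (annihilator polyXY_ring (gr_weyl w M F)) = rad (colon (initial w ?q t L))"
    if w: "w \<in> Omega" and F: "good_weyl_filtration w M F" for w F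
  proof -
    obtain t' x' q' where A: "good_filtered weyl_algebra M weyl_of_poly wmul w F t' x' q'"
      and gr: "gr_weyl w M F = good_filtered.gr weyl_algebra M weyl_of_poly w F"
      using good_weyl_filtered[OF assms(1) w F] by blast
    have S: "symbol_module weyl_algebra M weyl_of_poly wmul w" by (rule symbol_module_weyl[OF assms(1) w])
    have B: "good_filtered weyl_algebra M weyl_of_poly wmul w
        (\<lambda>i. W.Phi t x ` vfilt w ?q t i) t x ?q"
      by (rule symbol_module.standard_filtration[OF S x gen])
    show "left_module polyXY_ring (gr_weyl w M F)"
      unfolding gr by (rule good_filtered.left_module_gr[OF A])
    show "is_ideal (annihilator polyXY_ring (gr_weyl w M F))"
      unfolding gr good_filtered.annihilator_gr[OF A] by (rule good_filtered.is_ideal_annihilator_gr[OF A])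
    show "is_ideal (colon (initial w ?q t L))"
      unfolding L_def by (rule good_filtered.is_ideal_annihilator_gr[OF B])
    show "rad (annihilator polyXY_ring (gr_weyl w M F)) = rad (colon (initial w ?q t L))"
      unfolding gr L_def good_filtered.annihilator_gr[OF B, symmetric]
      using rad_good_filtered_mono[OF A B] rad_good_filtered_mono[OF B A] by (rule equalityI)
  qed
  obtain s\<^sub>0 where s0: "\<And>\<omega> s. \<omega> \<in> Omega \<Longrightarrow> s > s\<^sub>0 \<Longrightarrow>
      initial (\<lambda>i. \<nu> i + s * \<omega> i) ?q t L = initial \<nu> ?q t (initial \<omega> ?q t L)"
    using initial_of_initial[OF L] by blast
  show "\<exists>s\<^sub>\<nu> :: nat. \<forall>\<omega> \<in> Omega. \<forall>s :: nat. s > s\<^sub>\<nu> \<longrightarrow>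
    (\<forall>F F1 F2 G G1.
       good_weyl_filtration \<omega> M F \<and>
       good_poly_filtration \<nu> (gr_weyl \<omega> M F) G \<and>
       good_weyl_filtration (\<lambda>i. \<nu> i + s * \<omega> i) M F1 \<and>
       good_poly_filtration \<nu> (gr_weyl (\<lambda>i. \<nu> i + s * \<omega> i) M F1) G1 \<and>
       good_weyl_filtration (\<lambda>i. \<nu> i + s * \<omega> i) M F2 \<longrightarrow>
       rad_ann (gr_poly \<nu> (gr_weyl \<omega> M F) G)
         = rad_ann (gr_poly \<nu> (gr_weyl (\<lambda>i. \<nu> i + s * \<omega> i) M F1) G1) \<and>
       rad_ann (gr_poly \<nu> (gr_weyl (\<lambda>i. \<nu> i + s * \<omega> i) M F1) G1)
         = rad_ann (gr_weyl (\<lambda>i. \<nu> i + s * \<omega> i) M F2))"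
  proof (intro exI[of _ s\<^sub>0] ballI allI impI)
    fix \<omega> :: "'n weight" and s :: nat and F F1 F2 G G1
    let ?w = "\<lambda>i. \<nu> i + s * \<omega> i"
    assume \<omega>: "\<omega> \<in> Omega" and s: "s\<^sub>0 < s"
      and good: "good_weyl_filtration \<omega> M F \<and>
       good_poly_filtration \<nu> (gr_weyl \<omega> M F) G \<and>
       good_weyl_filtration ?w M F1 \<and>
       good_poly_filtration \<nu> (gr_weyl ?w M F1) G1 \<and>
       good_weyl_filtration ?w M F2"
    have w: "?w \<in> Omega" using Omega_add_mult[OF \<omega>] s by simp
    have J: "submod (*) t (initial \<omega> ?q t L)" "submod (*) t (initial ?w ?q t L)"
      by (rule submod_initial_wmul[OF \<omega> L] submod_initial_wmul[OF w L])+
    have eq: "initial ?w ?q t L = initial \<nu> ?q t (initial \<omega> ?q t L)" by (rule s0[OF \<omega> s])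
    have gr_\<nu>: "rad_ann (gr_poly \<nu> (gr_weyl w M F) G) = rad (colon (initial \<nu> ?q t (initial w ?q t L)))"
      if "w \<in> Omega" "good_weyl_filtration w M F" "good_poly_filtration \<nu> (gr_weyl w M F) G" for w F G
    proof -
      note W = weyl[OF that(1,2)]
      have "rad_ann (gr_poly \<nu> (gr_weyl w M F) G) = rad (initial_ideal \<nu> (annihilator polyXY_ring (gr_weyl w M F)))"
        by (rule rad_ann_gr_poly[OF W(1) that(3)])
      also have "\<dots> = rad (initial_ideal \<nu> (colon (initial w ?q t L)))" by (rule rad_initial_ideal_cong[OF W(2,3,4)])
      also have "\<dots> = rad (colon (initial \<nu> ?q t (initial w ?q t L)))"
        by (rule rad_initial_ideal_colon[OF submod_initial_wmul[OF that(1) L]])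
      finally show ?thesis .
    qed
    have "rad_ann (gr_poly \<nu> (gr_weyl \<omega> M F) G) = rad (colon (initial ?w ?q t L))"
      using gr_\<nu>[OF \<omega>] good eq by simp
    moreover have "rad_ann (gr_poly \<nu> (gr_weyl ?w M F1) G1) = rad (colon (initial ?w ?q t L))"
      \<comment> \<open>the module \<open>initial ?w ?q t L\<close> is already \<open>\<nu>\<close>-homogeneous\<close>
      using gr_\<nu>[OF w] good unfolding eq initial_idem[OF J(1)] by blast
    moreover have "rad_ann (gr_weyl ?w M F2) = rad (colon (initial ?w ?q t L))"
      using weyl(4)[OF w] good unfolding rad_ann_eq_rad by blast
    ultimately show "rad_ann (gr_poly \<nu> (gr_weyl \<omega> M F) G) = rad_ann (gr_poly \<nu> (gr_weyl ?w M F1) G1) \<and>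
       rad_ann (gr_poly \<nu> (gr_weyl ?w M F1) G1) = rad_ann (gr_weyl ?w M F2)" by simp
  qed
qed

end
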